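(* For each $n\ge 3$, there is a closed nowhere dense bounded subset $X$ of $\mathbb{R}^n$ such that $\mu(X)>0$ and the action $\mathrm{Iso}(\mathbb{R}^n)\curvearrowright\mathbb{R}^n$ has local spectral gap with respect to $X$ (equivalently, $X$ is a domain of expansion for this action).
   Context: $\mathrm{Iso}(\mathbb{R}^n)$ is the group $\Gamma$ of orientation-preserving isometries of $\mathbb{R}^n$ with its natural action, and $\mu$ is the Lebesgue measure. Local spectral gap: let $X\subseteq\mathbb{R}^n$ be measurable with $0<\mu(X)<\infty$. For $f\in L^2(\mathbb{R}^n,\mu)$ let $\|f\|_{2,X}=(\int_X|f(x)|^2\,d\mu(x))^{1/2}$, and let $(\gamma.f)(x)=f(\gamma^{-1}.x)$. The action has local spectral gap with respect to $X$ if there exist a finite set $Q\subseteq\Gamma$ and a constant $c>0$ such that for every $f\in L^2(\mathbb{R}^n,\mu)$ with $\int_X f\,d\mu=0$ we have $\|f\|_{2,X}\le c\sum_{\gamma\in Q}\|\gamma.f-f\|_{2,X}$. Domain of expansion: a measurable set $C\subseteq\mathbb{R}^n$ with $0<\mu(C)<\infty$ such that for every real $\eta>0$ there is a finite set $R\subseteq\Gamma$ such that for all measurable $Y\subseteq C$ we have $\mu((R.Y)\cap C)\ge\min\left((1-\eta)\mu(C),\ \mu(Y)/\eta\right)$, where $R.Y=\bigcup_{\gamma\in R}\gamma.Y$. *)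

theory Defs
  imports "HOL-Analysis.Analysis"
begin

text \<open>
  The determinant is that of the linear part \<open>x \<mapsto> g x - g 0\<close> of the isometry \<open>g\<close>, which is
  linear because \<open>g\<close> preserves distances; \<open>iso_plus_eq\<close> below gives the explicit form.
\<close>

definition iso_plus :: "(real ^ 'n \<Rightarrow> real ^ 'n) set" where
  "iso_plus = {g. bij g \<and> (\<forall>x y. dist (g x) (g y) = dist x y) \<and> det (matrix (\<lambda>x. g x - g 0)) > 0}"

lemma iso_plus_eq:
  "(iso_plus :: (real ^ 'n \<Rightarrow> real ^ 'n) set) = {(\<lambda>x. A *v x + b) | A b. rotation_matrix A}"
proof (intro set_eqI iffI)
  fix g :: "real ^ 'n \<Rightarrow> real ^ 'n"
  assume g: "g \<in> iso_plus"
  let ?h = "\<lambda>x. g x - g 0"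
  have orth: "orthogonal_transformation ?h"
    using g by (simp add: iso_plus_def orthogonal_transformation_isometry dist_norm)
  then have om: "orthogonal_matrix (matrix ?h)"
    using orthogonal_transformation_matrix by blast
  have lin: "linear ?h"
    using orth by (rule orthogonal_transformation_linear)
  have "det (matrix ?h) > 0"
    using g by (simp add: iso_plus_def)
  with om have "rotation_matrix (matrix ?h)"
    using det_orthogonal_matrix[OF om] by (auto simp: rotation_matrix_def)
  moreover have "g = (\<lambda>x. matrix ?h *v x + g 0)"
    by (simp add: matrix_vector_mul(2)[OF lin] fun_eq_iff)
  ultimately show "g \<in> {(\<lambda>x. A *v x + b) | A b. rotation_matrix A}"
    by blast
next
  fix g :: "real ^ 'n \<Rightarrow> real ^ 'n"
  assume "g \<in> {(\<lambda>x. A *v x + b) | A b. rotation_matrix A}"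
  then obtain A b where g: "g = (\<lambda>x. A *v x + b)" and A: "rotation_matrix A"
    by blast
  have orth: "orthogonal_transformation ((*v) A)"
    using A by (simp add: rotation_matrix_def orthogonal_transformation_matrix)
  have "bij ((*v) A)"
    using orth by (rule orthogonal_transformation_bij)
  moreover have "g = (\<lambda>x. x + b) \<circ> (*v) A"
    by (auto simp: g)
  moreover have "bij (\<lambda>x::real ^ 'n. x + b)"
    by (rule bij_plus_right)
  ultimately have "bij g"
    by (metis bij_comp)
  moreover have "dist (g x) (g y) = dist x y" for x y
    using orth by (simp add: g orthogonal_transformation_isometry)
  moreover have "det (matrix (\<lambda>x. g x - g 0)) > 0"
    using A by (simp add: g rotation_matrix_def)
  ultimately show "g \<in> iso_plus"
    by (simp add: iso_plus_def)
qed

text \<open>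
  Below, \<open>G\<close> is a group of measure-preserving bijections, given as a set of maps and acting by
  application.
\<close>

definition L2 :: "('a::euclidean_space \<Rightarrow> complex) set" where
  "L2 = {f. f \<in> borel_measurable lebesgue \<and> integrable lebesgue (\<lambda>x. (cmod (f x))\<^sup>2)}"

definition norm2_on :: "'a::euclidean_space set \<Rightarrow> ('a \<Rightarrow> complex) \<Rightarrow> real" where
  "norm2_on X f = sqrt (set_lebesgue_integral lebesgue X (\<lambda>x. (cmod (f x))\<^sup>2))"

definition act :: "('a \<Rightarrow> 'a) \<Rightarrow> ('a \<Rightarrow> 'b) \<Rightarrow> 'a \<Rightarrow> 'b" where
  "act g f = (\<lambda>x. f (inv g x))"

definition local_spectral_gap :: "('a::euclidean_space \<Rightarrow> 'a) set \<Rightarrow> 'a set \<Rightarrow> bool" where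
  "local_spectral_gap G X \<longleftrightarrow>
     X \<in> lmeasurable \<and> measure lebesgue X > 0 \<and>
     (\<exists>Q c. finite Q \<and> Q \<subseteq> G \<and> c > 0 \<and>
       (\<forall>f\<in>L2. set_lebesgue_integral lebesgue X f = 0 \<longrightarrow>
          norm2_on X f \<le> c * (\<Sum>g\<in>Q. norm2_on X (\<lambda>x. act g f x - f x))))"

definition domain_of_expansion :: "('a::euclidean_space \<Rightarrow> 'a) set \<Rightarrow> 'a set \<Rightarrow> bool" where
  "domain_of_expansion G C \<longleftrightarrow>
     C \<in> lmeasurable \<and> measure lebesgue C > 0 \<and>
     (\<forall>\<eta>>0. \<exists>R. finite R \<and> R \<subseteq> G \<and>
       (\<forall>Y\<in>sets lebesgue. Y \<subseteq> C \<longrightarrow>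
          measure lebesgue ((\<Union>g\<in>R. g ` Y) \<inter> C)
            \<ge> min ((1 - \<eta>) * measure lebesgue C) (measure lebesgue Y / \<eta>)))"

end

theory Submission
  imports Defs
begin

text \<open>
  Everything takes place on the torus: functions on \<open>\<real>\<^sup>n\<close> that are periodic under \<open>\<int>\<^sup>n\<close>, integrated over
  the unit cube. The rotations used are those by the angle with cosine \<open>3/5\<close> and sine \<open>4/5\<close> in a
  coordinate plane. Composing a periodic function with such a rotation does not give a periodic
  function, but averaging over finitely many shifts repairs this, and the average over all
  coordinate planes is a Hecke operator \<open>T\<close> on the torus. On the frequency side \<open>T\<close> averages a
  function on \<open>\<int>\<^sup>n\<close> over those rotated frequencies that are again integral.

  The operator \<open>T\<close> contracts functions of mean zero for a 5-adic reason. If a frequency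
  \<open>m \<noteq> 0\<close> has 5-adic valuation \<open>k\<close>, then each rotation changes the valuation by at most one, and
  for \<open>n \<ge> 3\<close> those that lower it outweigh those that raise it. So \<open>t ^ k\<close>, for \<open>t\<close> slightly larger than 1, is a
  weight that \<open>T\<close> multiplies by at most a constant below 1, and the Schur test bounds the norm of
  \<open>T\<close> by this constant (\<open>schur_weight\<close>, \<open>hecke_coeff_contraction\<close>). A power of \<open>T\<close> has norm as
  small as desired on mean zero functions; it is an average of compositions with finitely many
  isometries of \<open>\<real>\<^sup>n\<close>. Parseval's identity for trigonometric polynomials and their density in
  \<open>L\<^sup>2\<close> of the cube transfer the estimate to all square integrable periodic functions
  (\<open>exists_contracting_average\<close>).

  The set \<open>X\<close> arises by removing a small dense open set from the torus. The removal
  could isolate some of the remaining points from their images under the isometries, so every point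
  for which more than half of the images are lost is removed as well, and so on. Because the average
  is strongly contracting, Chebyshev's inequality shows that these removals form a process that
  stays small (\<open>exists_robust_set\<close>). What remains is a closed, nowhere dense, periodic set \<open>P\<close>
  of positive measure, and every point of \<open>P\<close> keeps at least half of its images.

  Let \<open>X\<close> be the part of \<open>P\<close> in the unit cube. A function of mean zero on \<open>X\<close>, extended
  periodically and by zero off \<open>P\<close>, has small image under the average, while its
  energy along the moves that stay in \<open>P\<close> is at least a fixed multiple of its square norm minus a
  small cross term. Translating images back to the cube turns these moves into finitely many
  isometries, and yields a Poincare inequality that only involves points of \<open>X\<close> moved within \<open>X\<close>
  (\<open>robust_poincare\<close>). This implies the local spectral gap at once
  (\<open>local_spectral_gapI\<close>); applied to indicator functions it gives a fixed amount of
  expansion, and iterating it gives expansion of any order (\<open>expansion_of_poincare\<close>).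
\<close>

section \<open>Orientation-preserving isometries preserve Lebesgue measure\<close>

lemma iso_plus_comp:
  assumes "g \<in> iso_plus" "h \<in> iso_plus"
  shows "g \<circ> h \<in> (iso_plus :: (real ^ 'n \<Rightarrow> real ^ 'n) set)"
proof -
  obtain A b where g: "g = (\<lambda>x. A *v x + b)" and A: "rotation_matrix A"
    using assms(1) unfolding iso_plus_eq by blast
  obtain B c where h: "h = (\<lambda>x. B *v x + c)" and B: "rotation_matrix B"
    using assms(2) unfolding iso_plus_eq by blast
  have "g \<circ> h = (\<lambda>x. (A ** B) *v x + (A *v c + b))"
    by (auto simp: g h fun_eq_iff matrix_vector_right_distrib matrix_vector_mul_assoc)
  moreover have "rotation_matrix (A ** B)"
    using A B by (auto simp: rotation_matrix_def orthogonal_matrix_mul det_mul)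
  ultimately show ?thesis
    unfolding iso_plus_eq by blast
qed

lemma iso_plus_inv:
  assumes "g \<in> iso_plus"
  shows "inv g \<in> (iso_plus :: (real ^ 'n \<Rightarrow> real ^ 'n) set)"
proof -
  obtain A b where g: "g = (\<lambda>x. A *v x + b)" and A: "rotation_matrix A"
    using assms(1) unfolding iso_plus_eq by blast
  have o: "transpose A ** A = mat 1" "A ** transpose A = mat 1"
    using A by (auto simp: rotation_matrix_def orthogonal_matrix_def)
  have "inv g = (\<lambda>x. transpose A *v x + - (transpose A *v b))"
  proof (rule inv_equality)
    fix x show "transpose A *v g x + - (transpose A *v b) = x"
      by (simp add: g matrix_vector_right_distrib matrix_vector_mul_assoc o)
  next
    fix y show "g (transpose A *v y + - (transpose A *v b)) = y"
      by (simp add: g matrix_vector_mult_diff_distrib matrix_vector_mul_assoc o del: transpose_matrix_vector)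
  qed
  moreover have "rotation_matrix (transpose A)"
    using A by (simp add: rotation_matrix_def)
  ultimately show ?thesis
    unfolding iso_plus_eq by blast
qed

lemma iso_plus_translation: "(\<lambda>x. x + b) \<in> (iso_plus :: (real ^ 'n \<Rightarrow> real ^ 'n) set)"
proof -
  have "rotation_matrix (mat 1 :: real ^ 'n ^ 'n)"
    by (simp add: rotation_matrix_def orthogonal_matrix_id)
  then show ?thesis
    unfolding iso_plus_eq
    by (intro CollectI exI[of _ "mat 1"] exI[of _ b]) (auto simp: fun_eq_iff)
qed

lemma iso_plus_id: "id \<in> (iso_plus :: (real ^ 'n \<Rightarrow> real ^ 'n) set)"
  using iso_plus_translation[of 0] by (simp add: id_def)

lemma iso_plus_bij: "g \<in> iso_plus \<Longrightarrow> bij g"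
  by (simp add: iso_plus_def)

lemma iso_plus_continuous:
  assumes "g \<in> (iso_plus :: (real ^ 'n \<Rightarrow> real ^ 'n) set)"
  shows "continuous_on S g"
proof -
  obtain A b where g: "g = (\<lambda>x. A *v x + b)"
    using assms(1) unfolding iso_plus_eq by blast
  show ?thesis unfolding g
    by (intro continuous_intros)
qed

lemma iso_plus_ball_image:
  fixes g :: "real ^ 'n \<Rightarrow> real ^ 'n"
  assumes "g \<in> iso_plus"
  shows "g ` ball c r = ball (g c) r"
proof -
  have d: "dist (g x) (g y) = dist x y" for x y
    using assms by (simp add: iso_plus_def)
  have "y \<in> g ` ball c r" if "y \<in> ball (g c) r" for y
  proof -
    obtain x where "y = g x"
      using iso_plus_bij[OF assms] by (meson bij_pointE)
    then show ?thesis
      using that by (auto simp: d)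
  qed
  then show ?thesis
    by (auto simp: d)
qed

text \<open>
  By the Vitali covering theorem an open set is, up to a null set, a disjoint union of balls, and an
  isometry maps balls to balls of the same radius. Applied to the inverse isometry too, this gives
  equality of measures.
\<close>

lemma iso_plus_emeasure_open_le:
  fixes g :: "real ^ 'n \<Rightarrow> real ^ 'n"
  assumes g: "g \<in> iso_plus" and U: "open U"
  shows "emeasure lebesgue (g ` U) \<le> emeasure lebesgue (U)"
proof -
  define K where "K = {(c, r). 0 < r \<and> ball c r \<subseteq> U}"
  have cover: "\<exists>i. i \<in> K \<and> x \<in> ball (fst i) (snd i) \<and> snd i < d" if "x \<in> U" "0 < d" for x d
  proof -
    obtain e where "e > 0" "ball x e \<subseteq> U"
      using \<open>x \<in> U\<close> U open_contains_ball by blast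
    then show ?thesis
      using \<open>0 < d\<close> by (intro exI[of _ "(x, min e (d / 2))"]) (auto simp: K_def)
  qed
  obtain C where C: "countable C" "C \<subseteq> K"
     and pw: "pairwise (\<lambda>i j. disjnt (ball (fst i) (snd i)) (ball (fst j) (snd j))) C"
     and neg: "negligible (U - (\<Union>i\<in>C. ball (fst i) (snd i)))"
    using Vitali_covering_theorem_balls[of "U" K fst snd, OF cover] by blast
  have gi: "inj g"
    using iso_plus_bij[OF g] by (simp add: bij_is_inj)
  define N where "N = U - (\<Union>i\<in>C. ball (fst i) (snd i))"
  have negN: "negligible (g ` N)"
  proof -
    obtain A b where gA: "g = (\<lambda>x. A *v x + b)"
      using g unfolding iso_plus_eq by blast
    have "linear ((*v) A)" by simp
    then have "g differentiable_on N"
      unfolding gA by (intro differentiable_on_add linear_imp_differentiable_on differentiable_on_const)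
    then show ?thesis
      using neg by (intro negligible_differentiable_image_negligible) (auto simp: N_def)
  qed
  have disj: "disjoint_family_on (\<lambda>i. ball (fst i) (snd i)) C"
    using pw unfolding disjoint_family_on_def pairwise_def disjnt_def by auto
  have disj': "disjoint_family_on (\<lambda>i. ball (g (fst i)) (snd i)) C"
    using disj gi unfolding disjoint_family_on_def iso_plus_ball_image[OF g, symmetric]
    by (metis image_Int image_empty)
  have "g ` U \<subseteq> (\<Union>i\<in>C. ball (g (fst i)) (snd i)) \<union> g ` N"
    unfolding iso_plus_ball_image[OF g, symmetric] N_def by blast
  then have "emeasure lebesgue (g ` U) \<le> emeasure lebesgue ((\<Union>i\<in>C. ball (g (fst i)) (snd i)) \<union> g ` N)"
    using negN C(1) by (intro emeasure_mono sets.Un sets.countable_UN'') (auto simp: negligible_iff_null_sets)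
  also have "\<dots> = emeasure lebesgue (\<Union>i\<in>C. ball (g (fst i)) (snd i))"
    using negN C(1) by (intro emeasure_Un_null_set) (auto simp: negligible_iff_null_sets)
  also have "\<dots> = (\<integral>\<^sup>+i. emeasure lebesgue (ball (g (fst i)) (snd i)) \<partial>count_space C)"
    using disj' C(1) by (intro emeasure_UN_countable) auto
  also have "\<dots> = (\<integral>\<^sup>+i. emeasure lebesgue (ball (fst i) (snd i)) \<partial>count_space C)"
  proof (rule nn_integral_cong)
    fix i assume "i \<in> space (count_space C)"
    then have "0 \<le> snd i"
      using C(2) by (auto simp: K_def)
    then show "emeasure lebesgue (ball (g (fst i)) (snd i)) = emeasure lebesgue (ball (fst i) (snd i))"
      by (simp add: emeasure_ball)
  qed
  also have "\<dots> = emeasure lebesgue (\<Union>i\<in>C. ball (fst i) (snd i))"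
    using disj C(1) by (intro emeasure_UN_countable[symmetric]) auto
  also have "\<dots> \<le> emeasure lebesgue (U)"
    using C(2) by (intro emeasure_mono) (auto simp: U K_def subset_iff)
  finally show ?thesis .
qed

lemma iso_plus_vimage: "g \<in> iso_plus \<Longrightarrow> g -` S = inv g ` S"
  by (simp add: bij_vimage_eq_inv_image iso_plus_bij)

lemma iso_plus_borel: "g \<in> (iso_plus :: (real ^ 'n \<Rightarrow> real ^ 'n) set) \<Longrightarrow> g \<in> borel \<rightarrow>\<^sub>M borel"
  by (intro borel_measurable_continuous_onI iso_plus_continuous)

lemma iso_plus_distr_lborel:
  fixes g :: "real ^ 'n \<Rightarrow> real ^ 'n"
  assumes "g \<in> iso_plus"
  shows "distr lborel borel g = lborel"
proof (rule lborel_eqI[symmetric])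
  fix l u :: "real ^ 'n"
  assume lu: "\<And>b. b \<in> Basis \<Longrightarrow> l \<bullet> b \<le> u \<bullet> b"
  let ?B = "box l u"
  have op: "open (inv g ` ?B)"
    using open_vimage[OF open_box iso_plus_continuous[OF assms]] by (simp add: iso_plus_vimage[OF assms, symmetric])
  have "g ` (inv g ` ?B) = ?B"
    using iso_plus_bij[OF assms] by (simp add: image_f_inv_f bij_is_surj)
  then have "emeasure lebesgue (inv g ` ?B) = emeasure lebesgue ?B"
    using iso_plus_emeasure_open_le[OF assms op] iso_plus_emeasure_open_le[OF iso_plus_inv[OF assms] open_box, of l u]
    by simp
  then show "emeasure (distr lborel borel g) ?B = (\<Prod>b\<in>Basis. (u - l) \<bullet> b)"
    using iso_plus_borel[OF assms] op lu
    by (simp add: emeasure_distr iso_plus_vimage[OF assms] emeasure_lborel_box)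
qed simp

lemma
  fixes g :: "real ^ 'n \<Rightarrow> real ^ 'n"
  assumes "g \<in> iso_plus"
  shows iso_plus_measurable: "g \<in> lebesgue \<rightarrow>\<^sub>M lebesgue"
    and iso_plus_distr: "distr lebesgue lebesgue g = lebesgue"
proof -
  have d: "distr lebesgue lborel g = lborel"
    using iso_plus_distr_lborel[OF assms] iso_plus_borel[OF assms]
    by (simp add: distr_completion cong: distr_cong)
  have m: "g \<in> lebesgue \<rightarrow>\<^sub>M lborel"
    using iso_plus_borel[OF assms] by (intro measurable_completion) auto
  show "g \<in> lebesgue \<rightarrow>\<^sub>M lebesgue"
    using completion.measurable_completion2[OF m] by (simp add: d)
  show "distr lebesgue lebesgue g = lebesgue"
    using completion.completion_distr_eq[OF m] by (simp add: d)
qed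

lemma iso_plus_image_sets:
  fixes g :: "real ^ 'n \<Rightarrow> real ^ 'n"
  assumes "g \<in> iso_plus" "S \<in> sets lebesgue"
  shows "g ` S \<in> sets lebesgue"
proof -
  have "g ` S = inv g -` S"
    using iso_plus_vimage[OF iso_plus_inv[OF assms(1)], of S] iso_plus_bij[OF assms(1)]
    by (simp add: inv_inv_eq)
  then show ?thesis
    using measurable_sets[OF iso_plus_measurable[OF iso_plus_inv[OF assms(1)]] assms(2)] by simp
qed

lemma integrable_iso_plus:
  fixes g :: "real ^ 'n \<Rightarrow> real ^ 'n" and f :: "real ^ 'n \<Rightarrow> 'b::{banach, second_countable_topology}"
  assumes "g \<in> iso_plus" "integrable lebesgue f"
  shows "integrable lebesgue (\<lambda>x. f (g x))"
  using integrable_distr[OF iso_plus_measurable[OF assms(1)], of f] assms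
  by (simp add: iso_plus_distr)

lemma integral_iso_plus:
  fixes g :: "real ^ 'n \<Rightarrow> real ^ 'n" and f :: "real ^ 'n \<Rightarrow> 'b::{banach, second_countable_topology}"
  assumes "g \<in> iso_plus" "f \<in> borel_measurable lebesgue"
  shows "integral\<^sup>L lebesgue (\<lambda>x. f (g x)) = integral\<^sup>L lebesgue f"
  using integral_distr[OF iso_plus_measurable[OF assms(1)], of f] assms(2)
  by (simp add: iso_plus_distr[OF assms(1)])

lemma nn_integral_iso_plus:
  fixes g :: "real ^ 'n \<Rightarrow> real ^ 'n"
  assumes "g \<in> iso_plus" "f \<in> borel_measurable lebesgue"
  shows "(\<integral>\<^sup>+x. f (g x) \<partial>lebesgue) = integral\<^sup>N lebesgue f"
  using nn_integral_distr[OF iso_plus_measurable[OF assms(1)], of f] assms(2)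
  by (simp add: iso_plus_distr[OF assms(1)])

lemma measurable_iso_plus_comp:
  fixes g :: "real ^ 'n \<Rightarrow> real ^ 'n"
  assumes "g \<in> iso_plus" "f \<in> borel_measurable lebesgue"
  shows "(\<lambda>x. f (g x)) \<in> borel_measurable lebesgue"
  using measurable_compose[OF iso_plus_measurable[OF assms(1)] assms(2)] .

section \<open>Rational rotations and integral frequencies\<close>

definition distinct_pairs :: "('n \<times> 'n) set" where
  "distinct_pairs = {(i, j). i \<noteq> j}"

text \<open>
  Rotation by the angle with cosine \<open>3/5\<close> and sine \<open>4/5\<close> in the plane of the coordinates \<open>i\<close>
  and \<open>j\<close>. Exchanging \<open>i\<close> and \<open>j\<close> gives the inverse rotation.
\<close>

definition rot :: "'n \<Rightarrow> 'n \<Rightarrow> real ^ 'n \<Rightarrow> real ^ 'n" where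
  "rot i j x = (\<chi> k. if k = i then (3 * x $ i - 4 * x $ j) / 5
                     else if k = j then (4 * x $ i + 3 * x $ j) / 5 else x $ k)"

text \<open>
  Dually, a frequency \<open>m\<close> is moved by the transposed rotation. The predicate says that the moved
  frequency is again integral, and \<open>int_rot\<close> is that frequency. One divisibility suffices
  for both coordinates, since the two numerators are proportional modulo 5
  (\<open>integral_rot_iff\<close>); hence integer division is exact wherever it is used.
\<close>

definition integral_rot :: "'n \<Rightarrow> 'n \<Rightarrow> int ^ 'n \<Rightarrow> bool" where
  "integral_rot i j m \<longleftrightarrow> 5 dvd 3 * m $ i + 4 * m $ j"

definition int_rot :: "'n \<Rightarrow> 'n \<Rightarrow> int ^ 'n \<Rightarrow> int ^ 'n" where
  "int_rot i j m = (\<chi> k. if k = i then (3 * m $ i + 4 * m $ j) div 5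
                    else if k = j then (3 * m $ j - 4 * m $ i) div 5 else m $ k)"

lemma integral_rot_iff: "integral_rot i j m \<longleftrightarrow> 5 dvd 3 * m $ j - 4 * m $ i"
proof -
  have "3 * m $ j - 4 * m $ i = 2 * (3 * m $ i + 4 * m $ j) + 5 * (- (2 * m $ i + m $ j))"
    "3 * m $ i + 4 * m $ j = 3 * (3 * m $ j - 4 * m $ i) + 5 * (3 * m $ i - m $ j)"
    by (simp_all add: algebra_simps)
  then show ?thesis
    unfolding integral_rot_def by (metis dvd_add dvd_mult dvd_triv_left)
qed

lemma integral_rot_mod5: "integral_rot i j m \<longleftrightarrow> m $ i mod 5 = 2 * (m $ j mod 5) mod 5"
proof -
  have "m $ i - 2 * m $ j = 2 * (3 * m $ i + 4 * m $ j) + 5 * (- (m $ i + 2 * m $ j))"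
    "3 * m $ i + 4 * m $ j = 3 * (m $ i - 2 * m $ j) + 5 * (2 * m $ j)"
    by (simp_all add: algebra_simps)
  then have "integral_rot i j m \<longleftrightarrow> 5 dvd m $ i - 2 * m $ j"
    unfolding integral_rot_def by (metis dvd_add dvd_mult dvd_triv_left)
  then show ?thesis
    by (simp add: mod_eq_dvd_iff mod_mult_right_eq)
qed

lemma mod5_cases:
  fixes x :: int
  assumes "\<not> 5 dvd x"
  shows "x mod 5 = 1 \<or> x mod 5 = 2 \<or> x mod 5 = 3 \<or> x mod 5 = 4"
proof -
  have "x mod 5 \<noteq> 0" "0 \<le> x mod 5" "x mod 5 < 5"
    using assms by (auto simp: dvd_eq_mod_eq_0)
  then show ?thesis by linarith
qed

text \<open>
  Integrality in both directions means \<open>m\<^sub>i = 2 m\<^sub>j\<close> and \<open>m\<^sub>j = 2 m\<^sub>i\<close> modulo 5, so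
  \<open>3 m\<^sub>i = 0\<close> modulo 5.
\<close>

lemma integral_rot_both_directions:
  assumes "integral_rot i j m" "integral_rot j i m"
  shows "5 dvd m $ i \<and> 5 dvd m $ j"
proof -
  have *: "x = 0" if "x = 2 * y mod 5" "y = 2 * x mod 5" for x y :: int
  proof -
    have "0 \<le> x" "x < 5" using that(1) by auto
    then have "x = 0 \<or> x = 1 \<or> x = 2 \<or> x = 3 \<or> x = 4" by linarith
    then show ?thesis
      using that by (elim disjE) simp_all
  qed
  have "m $ i mod 5 = 0" "m $ j mod 5 = 0"
    using assms * unfolding integral_rot_mod5 by blast+
  then show ?thesis
    by (simp add: dvd_eq_mod_eq_0)
qed

lemma int_rot_inverse:
  assumes "integral_rot i j m" "i \<noteq> j"
  shows "integral_rot j i (int_rot i j m)" "int_rot j i (int_rot i j m) = m"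
proof -
  obtain a where a: "3 * m $ i + 4 * m $ j = 5 * a"
    using assms(1) unfolding integral_rot_def by (auto simp: dvd_def)
  obtain b where b: "3 * m $ j - 4 * m $ i = 5 * b"
    using assms(1) unfolding integral_rot_iff by (auto simp: dvd_def)
  have ab: "3 * a - 4 * b = 5 * m $ i" "3 * b + 4 * a = 5 * m $ j"
    using a b by auto
  have "(3 * m $ i + 4 * m $ j) div 5 = a" "(3 * m $ j - 4 * m $ i) div 5 = b"
    using a b by auto
  then show "integral_rot j i (int_rot i j m)" "int_rot j i (int_rot i j m) = m"
    using assms(2) ab by (auto simp: integral_rot_def int_rot_def vec_eq_iff)
qed

text \<open>
  The 5-adic valuation of a nonzero integer vector: the least valuation of a coordinate.
\<close>

definition val5 :: "int ^ 'n \<Rightarrow> nat" where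
  "val5 m = Max {k. \<forall>i. 5 ^ k dvd m $ i}"

lemma val5_finite:
  assumes "m \<noteq> 0"
  shows "finite {k. \<forall>i. (5::int) ^ k dvd m $ i}"
proof -
  obtain i where i: "m $ i \<noteq> 0"
    using assms by (auto simp: vec_eq_iff)
  have "{k. \<forall>i. (5::int) ^ k dvd m $ i} \<subseteq> {..nat \<bar>m $ i\<bar>}"
  proof
    fix k assume "k \<in> {k. \<forall>i. (5::int) ^ k dvd m $ i}"
    then have "(5::int) ^ k \<le> \<bar>m $ i\<bar>"
      using i by (auto intro!: dvd_imp_le_int[of "m $ i" "5 ^ k", simplified])
    moreover have "int k < 5 ^ k"
    proof -
      have "k < 5 ^ k" by (induction k) auto
      then have "int k < int (5 ^ k)" by (simp only: of_nat_less_iff)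
      then show ?thesis by (simp only: of_nat_power of_nat_numeral)
    qed
    ultimately have "int k \<le> \<bar>m $ i\<bar>" by linarith
    then show "k \<in> {..nat \<bar>m $ i\<bar>}"
      by (simp add: le_nat_iff)
  qed
  then show ?thesis
    by (rule finite_subset) simp
qed

lemma val5_ge_iff:
  assumes "m \<noteq> 0"
  shows "k \<le> val5 m \<longleftrightarrow> (\<forall>i. 5 ^ k dvd m $ i)"
proof
  have "val5 m \<in> {k. \<forall>i. (5::int) ^ k dvd m $ i}"
    unfolding val5_def using val5_finite[OF assms] by (intro Max_in) (auto intro: exI[of _ 0])
  moreover assume "k \<le> val5 m"
  ultimately show "\<forall>i. 5 ^ k dvd m $ i"
    using le_imp_power_dvd dvd_trans by (metis (mono_tags, lifting) mem_Collect_eq)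
next
  assume "\<forall>i. 5 ^ k dvd m $ i"
  then show "k \<le> val5 m"
    unfolding val5_def using val5_finite[OF assms] by (intro Max_ge) auto
qed

lemma int_rot_nonzero:
  assumes "integral_rot i j m" "i \<noteq> j" "m \<noteq> 0"
  shows "int_rot i j m \<noteq> 0"
proof
  assume "int_rot i j m = 0"
  then have "m = int_rot j i 0"
    using int_rot_inverse(2)[OF assms(1,2)] by simp
  also have "\<dots> = 0" by (simp add: int_rot_def vec_eq_iff)
  finally show False using assms by simp
qed

lemma primitive_part:
  assumes "m \<noteq> 0"
  obtains w where "\<And>i. m $ i = 5 ^ val5 m * w $ i" "\<exists>i. \<not> 5 dvd w $ i"
proof -
  have "\<forall>i. \<exists>c. m $ i = 5 ^ val5 m * c"
    using val5_ge_iff[OF assms, of "val5 m"] by (auto simp: dvd_def)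
  then obtain c where c: "\<And>i. m $ i = 5 ^ val5 m * c i" by metis
  have "\<not> Suc (val5 m) \<le> val5 m" by simp
  then have "\<exists>i. \<not> 5 dvd c i"
    unfolding val5_ge_iff[OF assms] c by (simp add: mult.commute)
  then show thesis
    using c by (intro that[of "\<chi> i. c i"]) auto
qed

text \<open>
  The inverse move divides by 5 only once, so a move cannot gain two powers of 5.
\<close>

lemma val5_step_up:
  assumes "integral_rot i j m" "i \<noteq> j" "m \<noteq> 0"
  shows "val5 (int_rot i j m) \<le> Suc (val5 m)"
proof (rule ccontr)
  let ?v = "val5 m" and ?m' = "int_rot i j m"
  assume "\<not> ?thesis"
  then have "Suc (Suc ?v) \<le> val5 ?m'" by simp
  then have d: "5 ^ Suc (Suc ?v) dvd ?m' $ k" for k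
    using val5_ge_iff[OF int_rot_nonzero[OF assms]] by blast
  have m: "m = int_rot j i ?m'" "integral_rot j i ?m'"
    using int_rot_inverse[OF assms(1,2)] by auto
  have cancel: "5 ^ Suc ?v dvd x div 5" if x: "(5::int) ^ Suc (Suc ?v) dvd x" for x
  proof -
    obtain c where "x = 5 ^ Suc (Suc ?v) * c" using x unfolding dvd_def by blast
    then have "x = 5 * (5 ^ Suc ?v * c)" by simp
    then have "x div 5 = 5 ^ Suc ?v * c"
      by (metis nonzero_mult_div_cancel_left zero_neq_numeral)
    then show ?thesis by (metis dvd_triv_left)
  qed
  have "5 ^ Suc ?v dvd m $ k" for k
  proof -
    have c1: "5 ^ Suc ?v dvd (3 * ?m' $ j + 4 * ?m' $ i) div 5"
      and c2: "5 ^ Suc ?v dvd (3 * ?m' $ i - 4 * ?m' $ j) div 5"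
      by (intro cancel dvd_add dvd_diff dvd_mult d)+
    have c3: "5 ^ Suc ?v dvd ?m' $ k"
      using d[of k] by (metis dvd_mult_right power_Suc)
    have "m $ k = (if k = j then (3 * ?m' $ j + 4 * ?m' $ i) div 5
                    else if k = i then (3 * ?m' $ i - 4 * ?m' $ j) div 5 else ?m' $ k)"
      by (subst m(1)) (simp add: int_rot_def[of j i])
    then show ?thesis
      using c1 c2 c3 by presburger
  qed
  then have "Suc ?v \<le> ?v"
    using val5_ge_iff[OF assms(3)] by blast
  then show False by simp
qed

lemma val5_step_same:
  assumes "integral_rot i j m" "i \<noteq> j" "m \<noteq> 0"
    and w: "\<And>i. m $ i = 5 ^ val5 m * w $ i" "\<exists>i. \<not> 5 dvd w $ i" "5 dvd w $ i" "5 dvd w $ j"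
  shows "val5 (int_rot i j m) \<le> val5 m"
proof (rule ccontr)
  assume "\<not> ?thesis"
  then have "Suc (val5 m) \<le> val5 (int_rot i j m)" by simp
  then have d: "5 ^ Suc (val5 m) dvd int_rot i j m $ k" for k
    using val5_ge_iff[OF int_rot_nonzero[OF assms(1-3)]] by blast
  obtain k where k: "\<not> 5 dvd w $ k" using w by blast
  with w have "k \<noteq> i" "k \<noteq> j" by auto
  then have "5 ^ Suc (val5 m) dvd 5 ^ val5 m * w $ k"
    using d[of k] w(1)[of k] by (simp add: int_rot_def)
  then show False using k by (simp add: mult.commute)
qed

lemma val5_step_down:
  assumes "integral_rot i j m" "i \<noteq> j" "m \<noteq> 0"
    and w: "\<And>i. m $ i = 5 ^ val5 m * w $ i" "\<not> integral_rot i j w"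
  shows "Suc (val5 (int_rot i j m)) \<le> val5 m"
proof (rule ccontr)
  assume "\<not> ?thesis"
  then have "val5 m \<le> val5 (int_rot i j m)" by simp
  then have d: "5 ^ val5 m dvd int_rot i j m $ i"
    using val5_ge_iff[OF int_rot_nonzero[OF assms(1-3)]] by blast
  have "3 * m $ i + 4 * m $ j = 5 * int_rot i j m $ i"
    using assms(1) by (auto simp: integral_rot_def int_rot_def)
  moreover have "3 * m $ i + 4 * m $ j = 5 ^ val5 m * (3 * w $ i + 4 * w $ j)"
    using w(1) by (simp add: algebra_simps)
  ultimately have "5 ^ val5 m * 5 dvd 5 ^ val5 m * (3 * w $ i + 4 * w $ j)"
    using d by (metis mult.commute mult_dvd_mono dvd_refl)
  then show False using w(2) by (simp add: integral_rot_def)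
qed

text \<open>
  This is where \<open>n \<ge> 3\<close> is needed: some plane has both of its rotations lower the valuation. A unit
  modulo 5 and a multiple of 5 always span such a plane. Two units do so unless
  \<open>w\<^sub>i\<^sup>2 = - w\<^sub>j\<^sup>2\<close> modulo 5; as squares of units modulo 5 are \<open>\<plusminus> 1\<close>, two of any three units have
  equal squares.
\<close>

lemma exists_descending_pair:
  fixes w :: "int ^ 'n"
  assumes n: "CARD('n::finite) \<ge> 3" and w: "\<exists>i. \<not> 5 dvd w $ i"
  obtains i j where "i \<noteq> j" "\<not> integral_rot i j w" "\<not> integral_rot j i w"
proof (cases "\<exists>j. 5 dvd w $ j")
  case True
  then obtain i j where "\<not> 5 dvd w $ i" "5 dvd w $ j" using w by blast
  moreover have "\<not> integral_rot i j w" "\<not> integral_rot j i w"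
  proof -
    have "w $ j mod 5 = 0" using \<open>5 dvd w $ j\<close> by simp
    then show "\<not> integral_rot i j w" "\<not> integral_rot j i w"
      using mod5_cases[OF \<open>\<not> 5 dvd w $ i\<close>] unfolding integral_rot_mod5 by (elim disjE; simp)+
  qed
  moreover have "i \<noteq> j"
    using \<open>\<not> 5 dvd w $ i\<close> \<open>5 dvd w $ j\<close> by blast
  ultimately show thesis using that by blast
next
  case False
  obtain i j k :: 'n where ijk: "i \<noteq> j" "j \<noteq> k" "i \<noteq> k"
  proof -
    obtain S :: "'n set" where "card S = 3"
      using obtain_subset_with_card_n[OF n] by auto
    then show thesis using that by (auto simp: card_3_iff)
  qed
  have res: "w $ a mod 5 = 1 \<or> w $ a mod 5 = 2 \<or> w $ a mod 5 = 3 \<or> w $ a mod 5 = 4" for a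
    using False by (intro mod5_cases) auto
  have "(\<not> integral_rot i j w \<and> \<not> integral_rot j i w) \<or> (\<not> integral_rot j k w \<and> \<not> integral_rot k j w) \<or> (\<not> integral_rot i k w \<and> \<not> integral_rot k i w)"
    using res[of i] res[of j] res[of k] unfolding integral_rot_mod5 by (elim disjE) simp_all
  then show thesis
    using ijk that by blast
qed

section \<open>The Schur test on frequencies\<close>

text \<open>
  Each coordinate plane contributes its two opposite rotations. Relative to the weight of \<open>m\<close>,
  they contribute at most \<open>t + 1/t\<close>, and only \<open>2/t\<close> in a plane where both lower the valuation.
  With \<open>t = 1 + 1/N\<close> the excess of \<open>t + 1/t\<close> over 2 is quadratic in \<open>1/N\<close>, so even summed over all
  planes it is beaten by the linear gain from one such plane.
\<close>

lemma schur_weight: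
  fixes m :: "int ^ 'n"
  assumes n: "CARD('n::finite) \<ge> 3" and m: "m \<noteq> 0"
  defines "N \<equiv> card (distinct_pairs :: ('n \<times> 'n) set)"
  defines "t \<equiv> 1 + 1 / real N"
  shows "(\<Sum>(i, j) \<in> distinct_pairs. if integral_rot i j m then t ^ val5 (int_rot i j m) else 0)
           \<le> (real N / 2 * (t + 1 / t) - (t - 1 / t)) * t ^ val5 m"
proof -
  obtain w where w: "\<And>i. m $ i = 5 ^ val5 m * w $ i" "\<exists>i. \<not> 5 dvd w $ i"
    using primitive_part[OF m] by blast
  have fin: "finite (distinct_pairs :: ('n \<times> 'n) set)" by simp
  obtain i0 j0 where ij0: "i0 \<noteq> j0" "\<not> integral_rot i0 j0 w" "\<not> integral_rot j0 i0 w"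
    using exists_descending_pair[OF n w(2)] by blast
  have "(i0, j0) \<in> distinct_pairs" using ij0 by (simp add: distinct_pairs_def)
  then have Npos: "N > 0"
    unfolding N_def using fin card_gt_0_iff by blast
  then have t: "t > 1" by (simp add: t_def)
  define v where "v = t ^ val5 m"
  have v: "v > 0" using t by (simp add: v_def)
  (* Bound for the weight of the moved frequency relative to that of m, from the residues of the
     primitive part w: the valuation drops, stays, or rises by at most one. *)
  define c where "c i j = (if \<not> integral_rot i j w then 1 / t else if 5 dvd w $ i \<and> 5 dvd w $ j then 1 else t)" for i j
  have term_le: "(if integral_rot i j m then t ^ val5 (int_rot i j m) else 0) \<le> c i j * v" if "i \<noteq> j" for i j
  proof (cases "integral_rot i j m")
    case False
    then show ?thesis using v t by (simp add: c_def)
  next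
    case int: True
    consider "\<not> integral_rot i j w" | "integral_rot i j w" "5 dvd w $ i" "5 dvd w $ j"
      | "integral_rot i j w" "\<not> (5 dvd w $ i \<and> 5 dvd w $ j)" by blast
    then show ?thesis
    proof cases
      case 1
      have "t ^ Suc (val5 (int_rot i j m)) \<le> v"
        unfolding v_def using val5_step_down[OF int that m w(1) 1] t by (intro power_increasing) auto
      then show ?thesis using 1 int t by (simp add: c_def field_simps)
    next
      case 2
      have "t ^ val5 (int_rot i j m) \<le> v"
        unfolding v_def using val5_step_same[OF int that m w(1) w(2) 2(2,3)] t by (intro power_increasing) auto
      then show ?thesis using 2 int by (simp add: c_def)
    next
      case 3
      have "t ^ val5 (int_rot i j m) \<le> t ^ Suc (val5 m)"
        using val5_step_up[OF int that m] t by (intro power_increasing) auto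
      then show ?thesis using 3 int by (auto simp: c_def v_def)
    qed
  qed
  have amgm: "2 \<le> t + 1 / t"
  proof -
    have "0 \<le> (t - 1)\<^sup>2 / t" using t by simp
    also have "\<dots> = t + 1 / t - 2" using t by (simp add: field_simps power2_eq_square)
    finally show ?thesis by simp
  qed
  have t1: "1 / t < 1" using t by simp
  have pair_le: "c i j + c j i \<le> t + 1 / t" for i j
  proof -
    have le_t: "1 / t + 1 / t \<le> t + 1 / t" using t t1 by linarith
    consider "5 dvd w $ i" "5 dvd w $ j" | "\<not> (5 dvd w $ i \<and> 5 dvd w $ j)" "\<not> integral_rot i j w"
      | "\<not> (5 dvd w $ i \<and> 5 dvd w $ j)" "\<not> integral_rot j i w"
      using integral_rot_both_directions by blast
    then show ?thesis
    proof cases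
      case 1
      then have "c i j = 1" "c j i = 1" by (simp_all add: c_def integral_rot_def)
      then show ?thesis using amgm by simp
    next
      case 2
      then have "c i j = 1 / t" "c j i = 1 / t \<or> c j i = t" unfolding c_def by argo+
      then show ?thesis using le_t by argo
    next
      case 3
      then have "c j i = 1 / t" "c i j = 1 / t \<or> c i j = t" unfolding c_def by argo+
      then show ?thesis using le_t by argo
    qed
  qed
  have pair0: "c i0 j0 + c j0 i0 = 2 / t"
    using ij0 by (simp add: c_def)
  have swap: "(\<Sum>(i, j)\<in>distinct_pairs. c j i) = (\<Sum>(i, j)\<in>distinct_pairs. c i j)"
    by (rule sum.reindex_bij_witness[where i = prod.swap and j = prod.swap]) (auto simp: distinct_pairs_def)
  have "2 * (\<Sum>(i, j)\<in>distinct_pairs. c i j) = (\<Sum>(i, j)\<in>distinct_pairs. c i j + c j i)"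
    using swap by (simp add: case_prod_unfold sum.distrib)
  also have "\<dots> \<le> (\<Sum>p\<in>distinct_pairs. t + 1 / t - (if p \<in> {(i0, j0), (j0, i0)} then t - 1 / t else 0))"
  proof (rule sum_mono)
    fix p :: "'n \<times> 'n"
    show "(case p of (i, j) \<Rightarrow> c i j + c j i) \<le> t + 1 / t - (if p \<in> {(i0, j0), (j0, i0)} then t - 1 / t else 0)"
      using pair_le[of "fst p" "snd p"] pair0 by (auto simp: case_prod_unfold)
  qed
  also have "\<dots> = real N * (t + 1 / t) - (\<Sum>p\<in>distinct_pairs. if p \<in> {(i0, j0), (j0, i0)} then t - 1 / t else 0)"
    by (simp only: sum_subtractf sum_constant N_def)
  also have "(\<Sum>p\<in>(distinct_pairs :: ('n \<times> 'n) set). if p \<in> {(i0, j0), (j0, i0)} then t - 1 / t else 0)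
              = (\<Sum>p\<in>{(i0, j0), (j0, i0)}. t - 1 / t)"
    using ij0 by (subst sum.inter_restrict[symmetric]) (auto simp: distinct_pairs_def intro!: sum.cong)
  also have "\<dots> = 2 * (t - 1 / t)"
    using ij0 by simp
  finally have csum2: "2 * (\<Sum>(i, j)\<in>distinct_pairs. c i j) \<le> real N * (t + 1 / t) - 2 * (t - 1 / t)" .
  have "x \<le> real N / 2 * y - z" if "2 * x \<le> real N * y - 2 * z" for x y z :: real
    using that by simp
  from this[OF csum2] have csum: "(\<Sum>(i, j)\<in>distinct_pairs. c i j) \<le> real N / 2 * (t + 1 / t) - (t - 1 / t)" .
  have "(\<Sum>(i, j) \<in> distinct_pairs. if integral_rot i j m then t ^ val5 (int_rot i j m) else 0) \<le> (\<Sum>(i, j)\<in>distinct_pairs. c i j * v)"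
    using term_le by (intro sum_mono) (auto simp: distinct_pairs_def)
  also have "\<dots> = (\<Sum>(i, j)\<in>distinct_pairs. c i j) * v"
    by (simp add: case_prod_unfold sum_distrib_right)
  also have "\<dots> \<le> (real N / 2 * (t + 1 / t) - (t - 1 / t)) * v"
    using csum v by (intro mult_right_mono) auto
  finally show ?thesis by (simp add: v_def)
qed

lemma schur_constant_less:
  assumes "N > 0"
  defines "t \<equiv> 1 + 1 / real N"
  shows "real N / 2 * (t + 1 / t) - (t - 1 / t) < real N"
proof -
  define e where "e = 1 / real N"
  have e: "e > 0" "real N * e = 1" "t = 1 + e"
    using assms by (auto simp: e_def t_def)
  have t: "t > 0" using e by simp
  have "t + 1 / t = 2 + e * e / t" "t - 1 / t = (2 * e + e * e) / t"
    using t by (simp_all add: field_simps e(3))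
  moreover have "real N / 2 * (2 + e * e / t) = real N + e / (2 * t)"
  proof -
    have "real N / 2 * (2 + e * e / t) = real N + (real N * e) * e / (2 * t)"
      using t by (simp add: field_simps)
    then show ?thesis using e(2) by simp
  qed
  moreover have "e / (2 * t) < (2 * e + e * e) / t"
    using e(1) t by (simp add: field_simps add_pos_pos)
  ultimately have "real N / 2 * (t + 1 / t) - (t - 1 / t) = real N + e / (2 * t) - (2 * e + e * e) / t"
    by simp
  then show ?thesis
    using \<open>e / (2 * t) < (2 * e + e * e) / t\<close> by simp
qed

text \<open>
  The effect of the operator \<open>hecke\<close> below on Fourier coefficients (\<open>hecke_trig\<close>). Moves that
  leave the integer lattice contribute zero.
\<close>

definition hecke_coeff :: "(int ^ 'n \<Rightarrow> complex) \<Rightarrow> int ^ 'n \<Rightarrow> complex" where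
  "hecke_coeff a m = (\<Sum>(i, j) \<in> distinct_pairs. if integral_rot i j m then a (int_rot i j m) else 0) / of_nat (card (distinct_pairs :: ('n \<times> 'n) set))"

definition supp :: "('a \<Rightarrow> complex) \<Rightarrow> 'a set" where
  "supp a = {m. a m \<noteq> 0}"

lemma int_rot_zero [simp]: "int_rot i j 0 = 0" and integral_rot_zero [simp]: "integral_rot i j 0"
  by (auto simp: int_rot_def integral_rot_def vec_eq_iff)

lemma supp_hecke_coeff:
  "supp (hecke_coeff a) \<subseteq> (\<Union>(i, j)\<in>distinct_pairs. int_rot j i ` supp a)"
proof
  fix m assume "m \<in> supp (hecke_coeff a)"
  then have "(\<Sum>p\<in>distinct_pairs. if integral_rot (fst p) (snd p) m then a (int_rot (fst p) (snd p) m) else 0) \<noteq> 0"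
    by (auto simp: supp_def hecke_coeff_def case_prod_unfold)
  then obtain p where "p \<in> distinct_pairs" "(if integral_rot (fst p) (snd p) m then a (int_rot (fst p) (snd p) m) else 0) \<noteq> 0"
    by (rule sum.not_neutral_contains_not_neutral)
  then obtain i j where ij: "i \<noteq> j" "integral_rot i j m" "a (int_rot i j m) \<noteq> 0"
    by (cases p) (auto simp: distinct_pairs_def split: if_splits)
  then show "m \<in> (\<Union>(i, j)\<in>distinct_pairs. int_rot j i ` supp a)"
    using int_rot_inverse(2)[OF ij(2,1)] by (force simp: distinct_pairs_def supp_def)
qed

lemma finite_supp_hecke_coeff:
  fixes a :: "int ^ 'n::finite \<Rightarrow> complex"
  shows "finite (supp a) \<Longrightarrow> finite (supp (hecke_coeff a))"
  by (rule finite_subset[OF supp_hecke_coeff]) auto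

lemma card_distinct_pairs_pos:
  assumes "CARD('n::finite) \<ge> 3"
  shows "card (distinct_pairs :: ('n \<times> 'n) set) > 0"
proof -
  obtain S :: "'n set" where "card S = 2"
    using obtain_subset_with_card_n[of 2 "UNIV :: 'n set"] assms by auto
  then obtain x y :: 'n where "x \<noteq> y" by (auto simp: card_2_iff)
  then have "(x, y) \<in> distinct_pairs" by (simp add: distinct_pairs_def)
  then show ?thesis using card_gt_0_iff finite by blast
qed

lemma hecke_coeff_zero:
  assumes "CARD('n::finite) \<ge> 3"
  shows "hecke_coeff a (0 :: int ^ 'n) = a 0"
  using card_distinct_pairs_pos[OF assms] by (auto simp: hecke_coeff_def case_prod_unfold)

text \<open>
  The Schur test: Cauchy--Schwarz with the weight \<open>t ^ val5 m\<close>, used once for the sum over moves and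
  once, after interchanging the sums, for the inverse moves.
\<close>

lemma hecke_coeff_contraction:
  fixes a :: "int ^ 'n \<Rightarrow> complex"
  assumes n: "CARD('n::finite) \<ge> 3" and fin: "finite (supp a)"
  defines "N \<equiv> real (card (distinct_pairs :: ('n \<times> 'n) set))"
  defines "t \<equiv> 1 + 1 / N"
  defines "\<rho> \<equiv> (N / 2 * (t + 1 / t) - (t - 1 / t)) / N"
  shows "(\<Sum>m\<in>supp (hecke_coeff a) - {0}. (cmod (hecke_coeff a m))\<^sup>2)
           \<le> \<rho>\<^sup>2 * (\<Sum>m\<in>supp a - {0}. (cmod (a m))\<^sup>2)"
proof -
  define h where "h m = t ^ val5 m" for m :: "int ^ 'n"
  have N: "N > 0" using card_distinct_pairs_pos[OF n] by (simp add: N_def)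
  have t: "t > 1" using N by (simp add: t_def)
  have h: "h m > 0" for m using t by (simp add: h_def)
  have schur: "(\<Sum>(i, j) \<in> distinct_pairs. if integral_rot i j m then h (int_rot i j m) else 0) \<le> \<rho> * N * h m" if "m \<noteq> 0" for m
    using schur_weight[OF n that] N unfolding h_def \<rho>_def t_def N_def by simp
  define M where "M = (supp a \<union> supp (hecke_coeff a)) - {0}"
  have finM: "finite M" using fin finite_supp_hecke_coeff by (auto simp: M_def)
  have \<rho>: "0 \<le> \<rho>"
  proof -
    have "axis undefined 1 \<noteq> (0 :: int ^ 'n)" by (simp add: axis_eq_0_iff)
    from schur[OF this] have "0 \<le> \<rho> * N * h (axis undefined 1)"
      using h by (intro order_trans[OF _ schur] sum_nonneg) (auto simp: less_imp_le axis_eq_0_iff)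
    then show ?thesis using N h[of "axis undefined 1"] by (simp add: zero_le_mult_iff)
  qed
  define A where "A i j m = (if integral_rot i j m then (cmod (a (int_rot i j m)))\<^sup>2 / h (int_rot i j m) else 0)" for i j m
  have point: "(cmod (hecke_coeff a m))\<^sup>2 \<le> \<rho> / N * (h m * (\<Sum>(i, j)\<in>distinct_pairs. A i j m))" if "m \<noteq> 0" for m
  proof -
    let ?x = "\<lambda>p. if integral_rot (fst p) (snd p) m then sqrt (h (int_rot (fst p) (snd p) m)) else 0"
    let ?y = "\<lambda>p. if integral_rot (fst p) (snd p) m then cmod (a (int_rot (fst p) (snd p) m)) / sqrt (h (int_rot (fst p) (snd p) m)) else 0"
    have "N * cmod (hecke_coeff a m) = cmod (\<Sum>(i, j) \<in> distinct_pairs. if integral_rot i j m then a (int_rot i j m) else 0)"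
      using N by (simp add: hecke_coeff_def N_def norm_divide)
    also have "\<dots> \<le> (\<Sum>p\<in>distinct_pairs. ?x p * ?y p)"
      by (rule sum_norm_le) (use h in \<open>auto simp: less_imp_neq[THEN not_sym]\<close>)
    finally have "(N * cmod (hecke_coeff a m))\<^sup>2 \<le> (\<Sum>p\<in>distinct_pairs. ?x p * ?y p)\<^sup>2"
      using N by (intro power_mono) auto
    also have "\<dots> \<le> (\<Sum>p\<in>distinct_pairs. (?x p)\<^sup>2) * (\<Sum>p\<in>distinct_pairs. (?y p)\<^sup>2)"
      by (rule Cauchy_Schwarz_ineq_sum)
    also have "(\<Sum>p\<in>distinct_pairs. (?x p)\<^sup>2) = (\<Sum>(i, j) \<in> distinct_pairs. if integral_rot i j m then h (int_rot i j m) else 0)"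
      using h by (intro sum.cong) (auto simp: less_imp_le)
    also have "(\<Sum>p\<in>distinct_pairs. (?y p)\<^sup>2) = (\<Sum>(i, j)\<in>distinct_pairs. A i j m)"
      using h by (intro sum.cong) (auto simp: less_imp_le power_divide A_def)
    also have "(\<Sum>(i, j) \<in> distinct_pairs. if integral_rot i j m then h (int_rot i j m) else 0) * (\<Sum>(i, j)\<in>distinct_pairs. A i j m)
                 \<le> \<rho> * N * h m * (\<Sum>(i, j)\<in>distinct_pairs. A i j m)"
      using h by (intro mult_right_mono schur that sum_nonneg) (auto simp: A_def less_imp_le)
    finally show ?thesis
      using N by (simp add: field_simps power2_eq_square)
  qed
  have move: "(\<Sum>m\<in>M. h m * A i j m) \<le> (\<Sum>m\<in>supp a - {0}. (if integral_rot j i m then h (int_rot j i m) else 0) * ((cmod (a m))\<^sup>2 / h m))"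
    if "i \<noteq> j" for i j
  proof -
    have "(\<Sum>m\<in>M. h m * A i j m) = (\<Sum>m\<in>{m\<in>M. integral_rot i j m \<and> a (int_rot i j m) \<noteq> 0}. h m * A i j m)"
      using finM by (intro sum.mono_neutral_right) (auto simp: A_def)
    also have "\<dots> = (\<Sum>m\<in>int_rot i j ` {m\<in>M. integral_rot i j m \<and> a (int_rot i j m) \<noteq> 0}. h (int_rot j i m) * ((cmod (a m))\<^sup>2 / h m))"
    proof (rule sum.reindex_cong[symmetric])
      show "inj_on (int_rot i j) {m \<in> M. integral_rot i j m \<and> a (int_rot i j m) \<noteq> 0}"
        using int_rot_inverse(2) that by (intro inj_on_inverseI[of _ "int_rot j i"]) auto
      show "h (int_rot j i (int_rot i j m)) * ((cmod (a (int_rot i j m)))\<^sup>2 / h (int_rot i j m)) = h m * A i j m"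
        if m: "m \<in> {m \<in> M. integral_rot i j m \<and> a (int_rot i j m) \<noteq> 0}" for m
        using m int_rot_inverse(2)[of i j m] \<open>i \<noteq> j\<close> by (simp add: A_def)
    qed simp
    also have "\<dots> = (\<Sum>m\<in>int_rot i j ` {m\<in>M. integral_rot i j m \<and> a (int_rot i j m) \<noteq> 0}. (if integral_rot j i m then h (int_rot j i m) else 0) * ((cmod (a m))\<^sup>2 / h m))"
      using that by (intro sum.cong) (auto simp: int_rot_inverse)
    also have "\<dots> \<le> (\<Sum>m\<in>supp a - {0}. (if integral_rot j i m then h (int_rot j i m) else 0) * ((cmod (a m))\<^sup>2 / h m))"
      using fin h that by (intro sum_mono2) (auto simp: supp_def M_def less_imp_le int_rot_nonzero)
    finally show ?thesis .
  qed
  have swap: "(\<Sum>(i, j)\<in>distinct_pairs. f j i) = (\<Sum>(i, j)\<in>distinct_pairs. f i j)" for f :: "'n \<Rightarrow> 'n \<Rightarrow> real"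
    by (rule sum.reindex_bij_witness[where i = prod.swap and j = prod.swap]) (auto simp: distinct_pairs_def)
  have "(\<Sum>m\<in>supp (hecke_coeff a) - {0}. (cmod (hecke_coeff a m))\<^sup>2) \<le> (\<Sum>m\<in>M. (cmod (hecke_coeff a m))\<^sup>2)"
    using finM by (intro sum_mono2) (auto simp: M_def)
  also have "\<dots> \<le> (\<Sum>m\<in>M. \<rho> / N * (h m * (\<Sum>(i, j)\<in>distinct_pairs. A i j m)))"
    by (intro sum_mono point) (auto simp: M_def)
  also have "\<dots> = \<rho> / N * (\<Sum>(i, j)\<in>distinct_pairs. \<Sum>m\<in>M. h m * A i j m)"
    unfolding sum_distrib_left case_prod_unfold by (subst sum.swap) (simp add: mult_ac)
  also have "\<dots> \<le> \<rho> / N * (\<Sum>(i, j)\<in>distinct_pairs. \<Sum>m\<in>supp a - {0}. (if integral_rot j i m then h (int_rot j i m) else 0) * ((cmod (a m))\<^sup>2 / h m))"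
    using \<rho> N move by (intro mult_left_mono sum_mono) (auto simp: distinct_pairs_def)
  also have "(\<Sum>(i, j)\<in>distinct_pairs. \<Sum>m\<in>supp a - {0}. (if integral_rot j i m then h (int_rot j i m) else 0) * ((cmod (a m))\<^sup>2 / h m))
      = (\<Sum>m\<in>supp a - {0}. \<Sum>(i, j)\<in>distinct_pairs. (if integral_rot j i m then h (int_rot j i m) else 0) * ((cmod (a m))\<^sup>2 / h m))"
    unfolding case_prod_unfold by (rule sum.swap)
  also have "\<dots> = (\<Sum>m\<in>supp a - {0}. (\<Sum>(i, j)\<in>distinct_pairs. if integral_rot i j m then h (int_rot i j m) else 0) * ((cmod (a m))\<^sup>2 / h m))"
  proof (rule sum.cong[OF refl])
    fix m
    have "(\<Sum>(i, j)\<in>distinct_pairs. (if integral_rot j i m then h (int_rot j i m) else 0) * ((cmod (a m))\<^sup>2 / h m))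
        = (\<Sum>(i, j)\<in>distinct_pairs. (if integral_rot i j m then h (int_rot i j m) else 0) * ((cmod (a m))\<^sup>2 / h m))"
      by (rule swap[of "\<lambda>i j. (if integral_rot i j m then h (int_rot i j m) else 0) * ((cmod (a m))\<^sup>2 / h m)"])
    also have "\<dots> = (\<Sum>(i, j)\<in>distinct_pairs. if integral_rot i j m then h (int_rot i j m) else 0) * ((cmod (a m))\<^sup>2 / h m)"
      unfolding sum_distrib_right by (simp add: case_prod_unfold)
    finally show "(\<Sum>(i, j)\<in>distinct_pairs. (if integral_rot j i m then h (int_rot j i m) else 0) * ((cmod (a m))\<^sup>2 / h m))
        = (\<Sum>(i, j)\<in>distinct_pairs. if integral_rot i j m then h (int_rot i j m) else 0) * ((cmod (a m))\<^sup>2 / h m)" .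
  qed
  also have "\<rho> / N * \<dots> \<le> \<rho> / N * (\<Sum>m\<in>supp a - {0}. (\<rho> * N * h m) * ((cmod (a m))\<^sup>2 / h m))"
  proof -
    have "(\<Sum>m\<in>supp a - {0}. (\<Sum>(i, j)\<in>distinct_pairs. if integral_rot i j m then h (int_rot i j m) else 0) * ((cmod (a m))\<^sup>2 / h m))
        \<le> (\<Sum>m\<in>supp a - {0}. (\<rho> * N * h m) * ((cmod (a m))\<^sup>2 / h m))"
    proof (rule sum_mono)
      fix m assume "m \<in> supp a - {0}"
      then have "m \<noteq> 0" by simp
      have "0 \<le> (cmod (a m))\<^sup>2 / h m"
        using h[of m] by simp
      then show "(\<Sum>(i, j)\<in>distinct_pairs. if integral_rot i j m then h (int_rot i j m) else 0) * ((cmod (a m))\<^sup>2 / h m)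
          \<le> (\<rho> * N * h m) * ((cmod (a m))\<^sup>2 / h m)"
        by (rule mult_right_mono[OF schur[OF \<open>m \<noteq> 0\<close>]])
    qed
    moreover have "0 \<le> \<rho> / N" using \<rho> N by simp
    ultimately show ?thesis by (rule mult_left_mono)
  qed
  also have "\<dots> = \<rho> / N * (\<Sum>m\<in>supp a - {0}. (\<rho> * N) * (cmod (a m))\<^sup>2)"
    using h by (intro arg_cong[of _ _ "\<lambda>x. \<rho> / N * x"] sum.cong) (auto simp: less_imp_neq[THEN not_sym])
  also have "\<dots> = \<rho>\<^sup>2 * (\<Sum>m\<in>supp a - {0}. (cmod (a m))\<^sup>2)"
    using N by (simp add: sum_distrib_left[symmetric] power2_eq_square)
  finally show ?thesis .
qed

section \<open>The Hecke operator on periodic functions\<close>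

lemma sum_split_pair:
  fixes g :: "'n::finite \<Rightarrow> 'b::comm_monoid_add"
  assumes "i \<noteq> j"
  shows "(\<Sum>k\<in>UNIV. g k) = g i + (g j + (\<Sum>k\<in>UNIV - {i, j}. g k))"
proof -
  have "(\<Sum>k\<in>UNIV. g k) = g i + (\<Sum>k\<in>UNIV - {i}. g k)"
    by (simp add: sum.remove)
  also have "(\<Sum>k\<in>UNIV - {i}. g k) = g j + (\<Sum>k\<in>UNIV - {i} - {j}. g k)"
    using assms by (subst sum.remove[of _ j]) auto
  also have "UNIV - {i} - {j} = UNIV - {i, j}" by auto
  finally show ?thesis .
qed

text \<open>
  A square root of \<open>rot\<close>, coming from \<open>(2 + \<i>)\<^sup>2 = 3 + 4 \<i>\<close>. Being a square of an orthogonal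
  transformation, \<open>rot\<close> has determinant 1.
\<close>

definition half_rot :: "'n \<Rightarrow> 'n \<Rightarrow> real ^ 'n \<Rightarrow> real ^ 'n" where
  "half_rot i j x = (\<chi> k. if k = i then (2 * x $ i - x $ j) / sqrt 5
                     else if k = j then (x $ i + 2 * x $ j) / sqrt 5 else x $ k)"

lemma orthogonal_half_rot:
  assumes "i \<noteq> j"
  shows "orthogonal_transformation (half_rot i j :: real ^ 'n \<Rightarrow> real ^ 'n)"
  unfolding orthogonal_transformation
proof (intro conjI allI)
  show "linear (half_rot i j :: real ^ 'n \<Rightarrow> real ^ 'n)"
    by (rule linearI) (auto simp: half_rot_def vec_eq_iff field_simps)
  fix x :: "real ^ 'n"
  have "((2 * x $ i - x $ j) / sqrt 5)\<^sup>2 + ((x $ i + 2 * x $ j) / sqrt 5)\<^sup>2 = (x $ i)\<^sup>2 + (x $ j)\<^sup>2"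
    by (simp add: power_divide power2_eq_square field_simps)
  then have "(\<Sum>k\<in>UNIV. (half_rot i j x $ k)\<^sup>2) = (\<Sum>k\<in>UNIV. (x $ k)\<^sup>2)"
    unfolding sum_split_pair[OF assms] using assms by (simp add: half_rot_def)
  then show "norm (half_rot i j x) = norm x"
    by (simp add: norm_vec_def L2_set_def)
qed

lemma rot_eq_half_rot:
  assumes "i \<noteq> j"
  shows "rot i j = half_rot i j \<circ> half_rot i j"
  using assms by (auto simp: fun_eq_iff vec_eq_iff rot_def half_rot_def field_simps)

lemma rot_iso_plus:
  assumes "i \<noteq> j"
  shows "rot i j \<in> (iso_plus :: (real ^ 'n \<Rightarrow> real ^ 'n) set)"
proof -
  let ?B = "matrix (half_rot i j) :: real ^ 'n ^ 'n"
  have o: "orthogonal_transformation (half_rot i j :: real ^ 'n \<Rightarrow> real ^ 'n)"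
    by (rule orthogonal_half_rot[OF assms])
  then have om: "orthogonal_matrix ?B" and l: "linear (half_rot i j :: real ^ 'n \<Rightarrow> real ^ 'n)"
    by (auto simp: orthogonal_transformation_matrix orthogonal_transformation_linear)
  have "det ?B * det ?B = 1"
    using det_orthogonal_matrix[OF om] by auto
  then have "rotation_matrix (?B ** ?B)"
    using om by (simp add: rotation_matrix_def orthogonal_matrix_mul det_mul)
  moreover have "half_rot i j x = ?B *v x" for x
    using matrix_vector_mul(2)[OF l] by (metis)
  then have "rot i j = (\<lambda>x. (?B ** ?B) *v x + 0)"
    by (simp add: rot_eq_half_rot[OF assms] fun_eq_iff matrix_vector_mul_assoc[symmetric])
  ultimately show ?thesis
    unfolding iso_plus_eq by blast
qed

definition lattice_vec :: "real ^ 'n \<Rightarrow> bool" where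
  "lattice_vec z \<longleftrightarrow> (\<forall>i. z $ i \<in> \<int>)"

definition periodic :: "(real ^ 'n \<Rightarrow> 'b) \<Rightarrow> bool" where
  "periodic F \<longleftrightarrow> (\<forall>x z. lattice_vec z \<longrightarrow> F (x + z) = F x)"

definition branch :: "'n \<Rightarrow> 'n \<Rightarrow> nat \<Rightarrow> real ^ 'n \<Rightarrow> real ^ 'n" where
  "branch i j k x = rot i j (x + axis i (real k))"

text \<open>
  The five shifts \<open>k\<close> represent the cosets that occur when the rotated lattice is compared with
  \<open>\<int>\<^sup>n\<close>; summing over them restores periodicity.
\<close>

definition hecke :: "(real ^ 'n \<Rightarrow> 'b::real_vector) \<Rightarrow> real ^ 'n \<Rightarrow> 'b" where
  "hecke F x = (\<Sum>(i, j)\<in>distinct_pairs. \<Sum>k<5. F (branch i j k x)) /\<^sub>R (5 * real (card (distinct_pairs :: ('n \<times> 'n) set)))"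

lemma branch_iso_plus:
  assumes "i \<noteq> j"
  shows "branch i j k \<in> (iso_plus :: (real ^ 'n \<Rightarrow> real ^ 'n) set)"
proof -
  have "branch i j k = rot i j \<circ> (\<lambda>x. x + axis i (real k))"
    by (simp add: fun_eq_iff branch_def)
  then show ?thesis
    using iso_plus_comp[OF rot_iso_plus[OF assms] iso_plus_translation] by simp
qed

lemma sum_five_shift:
  fixes G :: "int \<Rightarrow> 'b::real_vector"
  assumes "\<And>a. G (a + 5) = G a"
  shows "(\<Sum>k<5. G (int k + c)) = (\<Sum>k<5. G (int k))"
proof -
  have shift: "(\<Sum>k<5. G (int k + (c + 1))) = (\<Sum>k<5. G (int k + c))" for c
    using assms[of c] by (simp add: eval_nat_numeral algebra_simps)
  show ?thesis
  proof (induction c rule: int_induct[where k = 0])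
    case (step1 c)
    then show ?case by (simp only: shift)
  next
    case (step2 c)
    then show ?case using shift[of "c - 1"] by simp
  qed simp
qed

lemma hecke_periodic:
  fixes F :: "real ^ 'n \<Rightarrow> 'b::real_vector"
  assumes "periodic F"
  shows "periodic (hecke F)"
proof -
  have F: "F (x + z) = F x" if "lattice_vec z" for x z
    using assms that by (simp add: periodic_def)
  have "(\<Sum>k<5. F (branch i j k (x + z))) = (\<Sum>k<5. F (branch i j k x))"
    if z: "lattice_vec z" and ij: "i \<noteq> j" for x z i j
  proof -
    obtain u v where u: "z $ i = of_int u" and v: "z $ j = of_int v"
      using z unfolding lattice_vec_def by (meson Ints_cases)
    (* Modulo integral vectors, rotating the unit vector of coordinate j equals rotating twice the
       unit vector of coordinate i, so a lattice translation permutes the five shifts cyclically. *)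
    define c where "c = u + 2 * v"
    define G where "G a = F (rot i j (x + axis i (real_of_int a)))" for a
    have per: "G (a + 5) = G a" for a
    proof -
      have "lattice_vec (rot i j (axis i 5))"
        using ij by (auto simp: lattice_vec_def rot_def axis_def)
      moreover have "rot i j (x + axis i (real_of_int (a + 5))) = rot i j (x + axis i (real_of_int a)) + rot i j (axis i 5)"
        by (auto simp: rot_def vec_eq_iff axis_def field_simps)
      ultimately show ?thesis
        by (simp add: G_def F)
    qed
    have "F (branch i j k (x + z)) = G (int k + c)" for k
    proof -
      let ?z' = "\<chi> l. if l = i then - 2 * z $ j else if l = j then - z $ j else z $ l"
      have "lattice_vec ?z'"
        using z unfolding lattice_vec_def by auto
      moreover have "branch i j k (x + z) = rot i j (x + axis i (real_of_int (int k + c))) + ?z'"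
        using ij by (auto simp: branch_def rot_def vec_eq_iff axis_def c_def u v field_simps)
      ultimately show ?thesis
        by (simp add: G_def F)
    qed
    moreover have "F (branch i j k x) = G (int k)" for k
      by (simp add: G_def branch_def)
    ultimately show ?thesis
      using sum_five_shift[of G c, OF per] by simp
  qed
  then show ?thesis
    unfolding periodic_def hecke_def
    by (intro allI impI arg_cong2[where f = scaleR] refl sum.cong) (auto simp: distinct_pairs_def)
qed

definition chr :: "int ^ 'n \<Rightarrow> real ^ 'n \<Rightarrow> complex" where
  "chr m x = cis (2 * pi * (\<Sum>k\<in>UNIV. of_int (m $ k) * x $ k))"

definition trig :: "(int ^ 'n \<Rightarrow> complex) \<Rightarrow> real ^ 'n \<Rightarrow> complex" where
  "trig a x = (\<Sum>m\<in>supp a. a m * chr m x)"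

lemma trig_superset:
  assumes "finite S" "supp a \<subseteq> S"
  shows "trig a x = (\<Sum>m\<in>S. a m * chr m x)"
  unfolding trig_def using assms by (intro sum.mono_neutral_left) (auto simp: supp_def)

lemma periodic_chr: "periodic (chr (m :: int ^ 'n))"
  unfolding periodic_def
proof (intro allI impI)
  fix x z :: "real ^ 'n" assume "lattice_vec z"
  then have "(\<Sum>k\<in>UNIV. of_int (m $ k) * z $ k) \<in> \<int>"
    by (intro Ints_sum Ints_mult) (auto simp: lattice_vec_def)
  then have "cis (2 * pi * (\<Sum>k\<in>UNIV. of_int (m $ k) * z $ k)) = 1"
    by (rule cis_multiple_2pi)
  then show "chr m (x + z) = chr m x"
    by (simp add: chr_def distrib_left sum.distrib cis_mult[symmetric])
qed

text \<open>
  The five shifts multiply the character by the powers of a fifth root of unity, which is 1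
  exactly if the moved frequency is integral; otherwise the geometric sum vanishes.
\<close>

lemma chr_branch_sum:
  fixes m :: "int ^ 'n"
  assumes ij: "i \<noteq> j"
  shows "(\<Sum>k<5. chr m (branch i j k x)) = (if integral_rot i j m then 5 * chr (int_rot i j m) x else 0)"
proof -
  define d where "d = (3 * real_of_int (m $ i) + 4 * real_of_int (m $ j)) / 5"
  define d' where "d' = (3 * real_of_int (m $ j) - 4 * real_of_int (m $ i)) / 5"
  define R where "R = (\<Sum>l\<in>UNIV - {i, j}. of_int (m $ l) * x $ l)"
  define \<omega> where "\<omega> = cis (2 * pi * d)"
  have phase: "(\<Sum>l\<in>UNIV. of_int (m $ l) * branch i j k x $ l) = (d * x $ i + d' * x $ j + R) + real k * d" for k
    unfolding sum_split_pair[OF ij] using ij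
    by (simp add: branch_def rot_def axis_def d_def d'_def R_def field_simps)
  have eq: "chr m (branch i j k x) = cis (2 * pi * (d * x $ i + d' * x $ j + R)) * \<omega> ^ k" for k
  proof -
    have "chr m (branch i j k x) = cis (2 * pi * (d * x $ i + d' * x $ j + R) + real k * (2 * pi * d))"
      unfolding chr_def phase by (rule arg_cong[of _ _ cis]) (simp add: algebra_simps)
    also have "\<dots> = cis (2 * pi * (d * x $ i + d' * x $ j + R)) * cis (real k * (2 * pi * d))"
      by (simp only: cis_mult)
    finally show ?thesis by (simp only: \<omega>_def Complex.DeMoivre)
  qed
  have sum_eq: "(\<Sum>k<5. chr m (branch i j k x)) = cis (2 * pi * (d * x $ i + d' * x $ j + R)) * (\<Sum>k<5. \<omega> ^ k)"
    unfolding eq by (simp add: sum_distrib_left)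
  show ?thesis
  proof (cases "integral_rot i j m")
    case True
    obtain a where a: "3 * m $ i + 4 * m $ j = 5 * a"
      using True unfolding integral_rot_def by (auto simp: dvd_def)
    obtain b where b: "3 * m $ j - 4 * m $ i = 5 * b"
      using True unfolding integral_rot_iff by (auto simp: dvd_def)
    have "real_of_int (3 * m $ i + 4 * m $ j) = 5 * real_of_int a" "real_of_int (3 * m $ j - 4 * m $ i) = 5 * real_of_int b"
      unfolding a b by simp_all
    then have dd: "d = real_of_int a" "d' = real_of_int b"
      by (simp_all add: d_def d'_def)
    have "\<omega> = 1"
      unfolding \<omega>_def dd by (rule cis_multiple_2pi) simp
    moreover have "chr (int_rot i j m) x = cis (2 * pi * (d * x $ i + d' * x $ j + R))"
      unfolding chr_def sum_split_pair[OF ij] using ij a b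
      by (simp add: int_rot_def dd R_def add.assoc)
    ultimately show ?thesis
      using True by (simp add: sum_eq)
  next
    case False
    have "\<omega> ^ 5 = cis (2 * pi * real_of_int (3 * m $ i + 4 * m $ j))"
    proof -
      have "real 5 * (2 * pi * d) = 2 * pi * real_of_int (3 * m $ i + 4 * m $ j)"
        by (simp add: d_def)
      then show ?thesis by (simp only: \<omega>_def Complex.DeMoivre)
    qed
    also have "\<dots> = 1"
      by (rule cis_multiple_2pi) simp
    finally have w5: "\<omega> ^ 5 = 1" .
    have "\<omega> \<noteq> 1"
    proof
      assume "\<omega> = 1"
      then have "cos (2 * pi * d) = 1"
        by (simp add: \<omega>_def complex_eq_iff)
      then obtain n :: int where "2 * pi * d = of_int n * 2 * pi"
        by (auto simp: cos_one_2pi_int)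
      then have "d = of_int n" by simp
      then have "real_of_int (3 * m $ i + 4 * m $ j) = real_of_int (5 * n)"
        by (simp add: d_def)
      then have "3 * m $ i + 4 * m $ j = 5 * n"
        by (simp only: of_int_eq_iff)
      then show False using False by (simp add: integral_rot_def)
    qed
    then have "(\<Sum>k<5. \<omega> ^ k) = 0"
      using w5 by (simp add: geometric_sum)
    then show ?thesis
      using False by (simp add: sum_eq)
  qed
qed

lemma hecke_trig:
  fixes a :: "int ^ 'n \<Rightarrow> complex"
  assumes n: "CARD('n::finite) \<ge> 3" and fin: "finite (supp a)"
  shows "hecke (trig a) = trig (hecke_coeff a)"
proof
  fix x :: "real ^ 'n"
  define N where "N = card (distinct_pairs :: ('n \<times> 'n) set)"
  have N: "N > 0" using card_distinct_pairs_pos[OF n] by (simp add: N_def)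
  define S where "S = (\<Union>(i, j)\<in>distinct_pairs. int_rot j i ` supp a)"
  have finS: "finite S" using fin by (auto simp: S_def)
  have step: "(\<Sum>k<5. trig a (branch i j k x)) = 5 * (\<Sum>m\<in>S. (if integral_rot j i m then a (int_rot j i m) else 0) * chr m x)"
    if ij: "(i, j) \<in> distinct_pairs" for i j
  proof -
    have ne: "i \<noteq> j" using ij by (simp add: distinct_pairs_def)
    have "(\<Sum>k<5. trig a (branch i j k x)) = (\<Sum>m\<in>supp a. a m * (\<Sum>k<5. chr m (branch i j k x)))"
      unfolding trig_def sum_distrib_left by (rule sum.swap)
    also have "\<dots> = (\<Sum>m\<in>supp a. if integral_rot i j m then 5 * (a m * chr (int_rot i j m) x) else 0)"
      unfolding chr_branch_sum[OF ne] by (intro sum.cong) auto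
    also have "\<dots> = (\<Sum>m\<in>{m\<in>supp a. integral_rot i j m}. 5 * (a m * chr (int_rot i j m) x))"
      using fin by (simp add: sum.inter_filter)
    also have "\<dots> = (\<Sum>m\<in>{m\<in>S. integral_rot j i m \<and> a (int_rot j i m) \<noteq> 0}. 5 * (a (int_rot j i m) * chr m x))"
    proof (rule sum.reindex_bij_witness[where i = "int_rot j i" and j = "int_rot i j"])
      fix m assume m: "m \<in> {m\<in>supp a. integral_rot i j m}"
      then show "int_rot j i (int_rot i j m) = m" using int_rot_inverse(2) ne by blast
      have "int_rot i j m \<in> S"
        using m ne unfolding S_def by (intro UN_I[of "(j, i)"]) (auto simp: distinct_pairs_def)
      then show "int_rot i j m \<in> {m\<in>S. integral_rot j i m \<and> a (int_rot j i m) \<noteq> 0}"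
        using m int_rot_inverse[of i j m] ne by (auto simp: supp_def)
      show "5 * (a (int_rot j i (int_rot i j m)) * chr (int_rot i j m) x) = 5 * (a m * chr (int_rot i j m) x)"
        using m int_rot_inverse(2)[of i j m] ne by simp
    next
      fix m assume m: "m \<in> {m\<in>S. integral_rot j i m \<and> a (int_rot j i m) \<noteq> 0}"
      then show "int_rot i j (int_rot j i m) = m" using int_rot_inverse(2)[of j i m] ne by simp
      show "int_rot j i m \<in> {m\<in>supp a. integral_rot i j m}"
        using m int_rot_inverse(1)[of j i m] ne by (simp add: supp_def)
    qed
    also have "\<dots> = (\<Sum>m\<in>S. 5 * ((if integral_rot j i m then a (int_rot j i m) else 0) * chr m x))"
      using finS by (intro sum.mono_neutral_cong_left) auto
    finally show ?thesis by (simp add: sum_distrib_left)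
  qed
  have "(\<Sum>(i, j)\<in>distinct_pairs. \<Sum>k<5. trig a (branch i j k x))
      = (\<Sum>(i, j)\<in>distinct_pairs. 5 * (\<Sum>m\<in>S. (if integral_rot j i m then a (int_rot j i m) else 0) * chr m x))"
    using step by (intro sum.cong) auto
  also have "\<dots> = (\<Sum>(i, j)\<in>distinct_pairs. 5 * (\<Sum>m\<in>S. (if integral_rot i j m then a (int_rot i j m) else 0) * chr m x))"
    by (rule sum.reindex_bij_witness[where i = prod.swap and j = prod.swap]) (auto simp: distinct_pairs_def)
  also have "\<dots> = (\<Sum>m\<in>S. 5 * ((\<Sum>(i, j)\<in>distinct_pairs. if integral_rot i j m then a (int_rot i j m) else 0) * chr m x))"
    unfolding sum_distrib_left sum_distrib_right case_prod_unfold by (rule sum.swap)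
  also have "\<dots> = (\<Sum>m\<in>S. 5 * (of_nat N * hecke_coeff a m * chr m x))"
  proof -
    have "of_nat N * hecke_coeff a m = (\<Sum>(i, j)\<in>distinct_pairs. if integral_rot i j m then a (int_rot i j m) else 0)" for m
      unfolding hecke_coeff_def N_def[symmetric] using N by simp
    then show ?thesis by simp
  qed
  also have "\<dots> = 5 * of_nat N * (\<Sum>m\<in>S. hecke_coeff a m * chr m x)"
    by (simp add: sum_distrib_left mult.assoc)
  also have "(\<Sum>m\<in>S. hecke_coeff a m * chr m x) = trig (hecke_coeff a) x"
    using finS supp_hecke_coeff[of a] by (intro trig_superset[symmetric]) (auto simp: S_def)
  finally show "hecke (trig a) x = trig (hecke_coeff a) x"
    unfolding hecke_def N_def[symmetric] using N by (simp add: scaleR_conv_of_real field_simps)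
qed

section \<open>Integration over the unit cube\<close>

definition unit_cube :: "(real ^ 'n) set" where
  "unit_cube = cbox 0 1"

abbreviation cube_measure :: "(real ^ 'n) measure" where
  "cube_measure \<equiv> lebesgue_on unit_cube"

abbreviation cube_integral :: "(real ^ 'n \<Rightarrow> 'b) \<Rightarrow> 'b::{banach, second_countable_topology}" where
  "cube_integral \<equiv> integral\<^sup>L cube_measure"

lemma mem_unit_cube: "x \<in> unit_cube \<longleftrightarrow> (\<forall>i. 0 \<le> x $ i \<and> x $ i \<le> 1)"
  by (simp add: unit_cube_def mem_box_cart)

lemma unit_cube_lmeasurable [simp]: "unit_cube \<in> lmeasurable"
  by (simp add: unit_cube_def)

lemma unit_cube_sets [measurable, simp]: "unit_cube \<in> sets lebesgue"
  by (simp add: fmeasurableD)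

lemma unit_cube_borel [measurable, simp]: "unit_cube \<in> sets borel"
  by (simp add: unit_cube_def)

lemma emeasure_unit_cube: "emeasure lebesgue (unit_cube :: (real ^ 'n) set) = 1"
proof -
  have "emeasure lborel (cbox (0 :: real ^ 'n) 1) = (\<Prod>b\<in>Basis. (1 - 0 :: real ^ 'n) \<bullet> b)"
    by (rule emeasure_lborel_cbox) (auto simp: Basis_vec_def inner_axis)
  also have "(\<Prod>b\<in>Basis. (1 - 0 :: real ^ 'n) \<bullet> b) = 1"
    by (intro prod.neutral) (auto simp: Basis_vec_def inner_axis)
  finally show ?thesis by (simp add: unit_cube_def)
qed

lemma measure_unit_cube: "measure lebesgue (unit_cube :: (real ^ 'n) set) = 1"
  by (simp add: measure_def emeasure_unit_cube)

lemma finite_cube_measure: "finite_measure (cube_measure :: (real ^ 'n) measure)"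
  by (rule finite_measure_lebesgue_on) simp

lemma measure_cube_measure [simp]: "measure (cube_measure :: (real ^ 'n) measure) unit_cube = 1"
  by (simp add: measure_restrict_space measure_unit_cube)

lemma integral_cube_const [simp]: "integral\<^sup>L (cube_measure :: (real ^ 'n) measure) (\<lambda>x. c) = (c :: 'b::{banach, second_countable_topology})"
  by (simp add: measure_restrict_space measure_unit_cube)

lemma integrable_cube_bounded:
  fixes f :: "real ^ 'n \<Rightarrow> 'b::{banach, second_countable_topology}"
  assumes "f \<in> borel_measurable lebesgue" "\<And>x. norm (f x) \<le> B"
  shows "integrable cube_measure f"
  using finite_cube_measure assms
  by (intro finite_measure.integrable_const_bound[of _ _ B] measurable_restrict_space1) auto

lemma AE_not_integer: "AE x in (lebesgue :: (real ^ 'n) measure). \<forall>i. x $ i \<notin> \<int>"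
proof -
  have "AE x in (lebesgue :: (real ^ 'n) measure). x $ i \<noteq> of_int n" for i and n :: int
  proof -
    have "{x :: real ^ 'n. x $ i = of_int n} \<in> null_sets lebesgue"
      using negligible_standard_hyperplane[of "axis i 1 :: real ^ 'n" "of_int n"]
      by (simp add: negligible_iff_null_sets[symmetric] inner_axis)
    then show ?thesis
      by (rule AE_I') blast
  qed
  then have "AE x in (lebesgue :: (real ^ 'n) measure). \<forall>i. \<forall>n :: int. x $ i \<noteq> of_int n"
    by (simp only: AE_all_countable simp_thms)
  then show ?thesis
  proof eventually_elim
    case (elim x)
    then show ?case unfolding Ints_def by blast
  qed
qed

text \<open>
  Cut the shifted half-open cube at the face of the original one and move the protruding slab back
  by one period.
\<close>

lemma periodic_shift_integral:
  fixes F :: "real ^ 'n \<Rightarrow> complex"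
  assumes per: "periodic F" and F: "F \<in> borel_measurable borel" and bdd: "\<And>x. cmod (F x) \<le> B"
    and s: "0 \<le> s" "s \<le> 1"
  shows "cube_integral (\<lambda>x. F (x + axis i s)) = cube_integral F"
proof -
  define D where "D = {x :: real ^ 'n. \<forall>k. 0 \<le> x $ k \<and> x $ k < 1}"
  define D1 where "D1 = {x \<in> D. s \<le> x $ i}"
  define D2 where "D2 = {x \<in> D. x $ i < s}"
  have Dmeas: "D \<in> sets borel" "D1 \<in> sets borel" "D2 \<in> sets borel"
    unfolding D_def D1_def D2_def by measurable
  have sub: "D \<subseteq> unit_cube" "D1 \<subseteq> unit_cube" "D2 \<subseteq> unit_cube"
    by (auto simp: D_def D1_def D2_def mem_unit_cube less_imp_le)
  have cube_eq: "cube_integral g = integral\<^sup>L lebesgue (\<lambda>x. indicator D x *\<^sub>R g x)"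
    if g: "g \<in> borel_measurable borel" for g :: "real ^ 'n \<Rightarrow> complex"
  proof -
    have "cube_integral g = integral\<^sup>L lebesgue (\<lambda>x. indicator unit_cube x *\<^sub>R g x)"
      by (subst integral_restrict_space) auto
    also have "\<dots> = integral\<^sup>L lebesgue (\<lambda>x. indicator D x *\<^sub>R g x)"
    proof (rule integral_cong_AE)
      show "AE x in lebesgue. indicator unit_cube x *\<^sub>R g x = indicator D x *\<^sub>R g x"
        using AE_not_integer
      proof eventually_elim
        case (elim x)
        have "x \<in> unit_cube \<longleftrightarrow> x \<in> D"
        proof
          assume x: "x \<in> unit_cube"
          have "x $ k \<noteq> 1" for k using elim by (metis Ints_1)
          then show "x \<in> D" using x by (auto simp: D_def mem_unit_cube order_less_le)
        qed (use sub in auto)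
        then show ?case by (simp add: indicator_def)
      qed
    qed (use g Dmeas in \<open>auto intro!: borel_measurable_scaleR borel_measurable_indicator measurable_completion\<close>)
    finally show ?thesis .
  qed
  have int: "integrable lebesgue (\<lambda>x. indicator E x *\<^sub>R F x)" if "E \<in> sets borel" "E \<subseteq> unit_cube" for E
  proof (rule Bochner_Integration.integrable_bound)
    show "integrable lebesgue (\<lambda>x. indicator unit_cube x *\<^sub>R \<bar>B\<bar> :: real)"
      by (intro integrable_scaleR_left) (simp add: emeasure_unit_cube)
    show "(\<lambda>x. indicator E x *\<^sub>R F x) \<in> borel_measurable lebesgue"
      using that F by (auto intro!: borel_measurable_scaleR borel_measurable_indicator measurable_completion)
    show "AE x in lebesgue. norm (indicator E x *\<^sub>R F x) \<le> norm (indicator unit_cube x *\<^sub>R \<bar>B\<bar> :: real)"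
      using that bdd by (auto intro!: AE_I2 simp: indicator_def intro: order_trans[OF bdd] abs_ge_self)
  qed
  have F': "F (x + axis i 1) = F x" for x
    using per unfolding periodic_def lattice_vec_def by (auto simp: axis_def)
  let ?e = "axis i 1 :: real ^ 'n" and ?s = "axis i s :: real ^ 'n"
  have tr: "integral\<^sup>L lebesgue (\<lambda>x. g (x + b)) = integral\<^sup>L lebesgue g" if "g \<in> borel_measurable borel"
    for g :: "real ^ 'n \<Rightarrow> complex" and b
    by (rule integral_iso_plus[OF iso_plus_translation]) (rule measurable_completion, simp add: that)
  have meas: "(\<lambda>x. indicator E (x - b) *\<^sub>R F x) \<in> borel_measurable borel" if "E \<in> sets borel" for E b
  proof -
    have "(\<lambda>x. indicator E (x - b) :: real) \<in> borel_measurable borel"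
      using that by (intro measurable_compose[OF _ borel_measurable_indicator]) simp_all
    then show ?thesis using F by (intro borel_measurable_scaleR)
  qed
  have "cube_integral (\<lambda>x. F (x + ?s)) = integral\<^sup>L lebesgue (\<lambda>x. indicator D ((x + ?s) - ?s) *\<^sub>R F (x + ?s))"
    using F by (subst cube_eq) simp_all
  also have "\<dots> = integral\<^sup>L lebesgue (\<lambda>x. indicator D (x - ?s) *\<^sub>R F x)"
    by (rule tr[OF meas[OF Dmeas(1)]])
  also have "\<dots> = integral\<^sup>L lebesgue (\<lambda>x. indicator D1 x *\<^sub>R F x + indicator D2 (x - ?e) *\<^sub>R F x)"
  proof (rule Bochner_Integration.integral_cong[OF refl])
    fix x :: "real ^ 'n"
    have ax: "axis i c $ k = (if k = i then c else 0)" for c :: real and k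
      by (simp add: axis_def)
    have "x - ?s \<in> D \<longleftrightarrow> (s \<le> x $ i \<and> x $ i < 1 + s \<and> (\<forall>k. k \<noteq> i \<longrightarrow> 0 \<le> x $ k \<and> x $ k < 1))"
      unfolding D_def by (auto simp: ax split: if_splits)
    moreover have "x \<in> D1 \<longleftrightarrow> (s \<le> x $ i \<and> x $ i < 1 \<and> (\<forall>k. k \<noteq> i \<longrightarrow> 0 \<le> x $ k \<and> x $ k < 1))"
      unfolding D_def D1_def using s by (auto simp: ax split: if_splits) (metis order_trans)
    moreover have "x - ?e \<in> D2 \<longleftrightarrow> (1 \<le> x $ i \<and> x $ i < 1 + s \<and> (\<forall>k. k \<noteq> i \<longrightarrow> 0 \<le> x $ k \<and> x $ k < 1))"
      unfolding D_def D2_def using s by (auto simp: ax split: if_splits)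
    ultimately show "indicator D (x - ?s) *\<^sub>R F x = indicator D1 x *\<^sub>R F x + indicator D2 (x - ?e) *\<^sub>R F x"
      using s by (auto simp: indicator_def)
  qed
  also have "\<dots> = integral\<^sup>L lebesgue (\<lambda>x. indicator D1 x *\<^sub>R F x) + integral\<^sup>L lebesgue (\<lambda>x. indicator D2 (x - ?e) *\<^sub>R F x)"
  proof (rule Bochner_Integration.integral_add)
    show "integrable lebesgue (\<lambda>x. indicator D1 x *\<^sub>R F x)"
      by (rule int[OF Dmeas(2) sub(2)])
    have "integrable lebesgue (\<lambda>x. indicator D2 (x + - ?e) *\<^sub>R F (x + - ?e))"
      by (rule integrable_iso_plus[OF iso_plus_translation int[OF Dmeas(3) sub(3)]])
    moreover have "F (x + - ?e) = F x" for x
      using F'[of "x + - ?e"] by simp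
    ultimately show "integrable lebesgue (\<lambda>x. indicator D2 (x - ?e) *\<^sub>R F x)"
      by simp
  qed
  also have "integral\<^sup>L lebesgue (\<lambda>x. indicator D2 (x - ?e) *\<^sub>R F x) = integral\<^sup>L lebesgue (\<lambda>x. indicator D2 x *\<^sub>R F x)"
    using tr[OF meas[OF Dmeas(3)], of ?e ?e] by (simp add: F')
  also have "integral\<^sup>L lebesgue (\<lambda>x. indicator D1 x *\<^sub>R F x) + integral\<^sup>L lebesgue (\<lambda>x. indicator D2 x *\<^sub>R F x)
      = integral\<^sup>L lebesgue (\<lambda>x. indicator D1 x *\<^sub>R F x + indicator D2 x *\<^sub>R F x)"
    by (intro Bochner_Integration.integral_add[symmetric] int Dmeas sub)
  also have "\<dots> = integral\<^sup>L lebesgue (\<lambda>x. indicator D x *\<^sub>R F x)"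
    by (intro Bochner_Integration.integral_cong[OF refl]) (auto simp: D1_def D2_def indicator_def)
  also have "\<dots> = cube_integral F"
    using F by (rule cube_eq[symmetric])
  finally show ?thesis .
qed

lemma continuous_chr: "continuous_on S (chr (m :: int ^ 'n))"
  unfolding chr_def by (intro continuous_intros)

lemma borel_chr [measurable]: "chr (m :: int ^ 'n) \<in> borel_measurable borel"
  by (intro borel_measurable_continuous_onI continuous_chr)

lemma cmod_chr [simp]: "cmod (chr m x) = 1"
  by (simp add: chr_def)

text \<open>
  Shifting by half a period in a coordinate with nonzero frequency changes the sign of the character
  but not its integral.
\<close>

lemma integral_chr:
  fixes m :: "int ^ 'n"
  shows "cube_integral (chr m) = (if m = 0 then 1 else 0)"
proof (cases "m = 0")
  case True
  then have "chr m = (\<lambda>x. 1)" by (simp add: chr_def fun_eq_iff)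
  then show ?thesis using True by simp
next
  case False
  then obtain i where i: "m $ i \<noteq> 0" by (auto simp: vec_eq_iff)
  define s where "s = 1 / (2 * \<bar>real_of_int (m $ i)\<bar>)"
  have "\<bar>real_of_int (m $ i)\<bar> \<ge> 1"
    using i by (metis abs_ge_zero of_int_abs of_int_1_le_iff zero_less_abs_iff int_one_le_iff_zero_less)
  then have s: "0 \<le> s" "s \<le> 1" by (auto simp: s_def field_simps)
  have "chr m (x + axis i s) = - chr m x" for x
  proof -
    have sg: "real_of_int (m $ i) * s = sgn (real_of_int (m $ i)) / 2"
      using i by (simp add: s_def sgn_if)
    have "(\<Sum>k\<in>UNIV. of_int (m $ k) * (x + axis i s) $ k) = (\<Sum>k\<in>UNIV. of_int (m $ k) * x $ k) + (\<Sum>k\<in>UNIV. of_int (m $ k) * axis i s $ k)"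
      by (simp add: distrib_left sum.distrib)
    also have "(\<Sum>k\<in>UNIV. of_int (m $ k) * axis i s $ k) = real_of_int (m $ i) * s"
      by (simp add: axis_def if_distrib cong: if_cong)
    finally have "chr m (x + axis i s) = chr m x * cis (2 * pi * (real_of_int (m $ i) * s))"
      by (simp add: chr_def cis_mult distrib_left)
    also have "cis (2 * pi * (real_of_int (m $ i) * s)) = -1"
      unfolding sg using i by (auto simp: sgn_if complex_eq_iff)
    finally show ?thesis by simp
  qed
  then have "cube_integral (chr m) = - cube_integral (chr m)"
    using periodic_shift_integral[OF periodic_chr borel_chr, of m 1 s i] s by simp
  then show ?thesis using False by simp
qed

lemma chr_mult_cnj: "chr m x * cnj (chr m' x) = chr (m - m') x"
  by (simp add: chr_def cis_cnj cis_mult right_diff_distrib[symmetric] sum_subtractf[symmetric] left_diff_distrib)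

lemma continuous_trig: "continuous_on S (trig (a :: int ^ 'n \<Rightarrow> complex))"
  unfolding trig_def by (intro continuous_intros continuous_chr)

lemma borel_trig [measurable]: "trig (a :: int ^ 'n \<Rightarrow> complex) \<in> borel_measurable borel"
  by (intro borel_measurable_continuous_onI continuous_trig)

lemma cmod_trig_le: "cmod (trig a x) \<le> (\<Sum>m\<in>supp a. cmod (a m))"
  unfolding trig_def by (rule sum_norm_le) (simp add: norm_mult)

lemma integral_trig:
  assumes "finite (supp a)"
  shows "cube_integral (trig a) = a (0 :: int ^ 'n)"
proof -
  have "cube_integral (trig a) = (\<Sum>m\<in>supp a. a m * cube_integral (chr m))"
    unfolding trig_def
    by (subst Bochner_Integration.integral_sum)
       (auto intro!: integrable_mult_right integrable_cube_bounded[where B = 1] measurable_completion)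
  also have "\<dots> = (\<Sum>m\<in>supp a. if m = 0 then a m else 0)"
    by (intro sum.cong) (auto simp: integral_chr)
  also have "\<dots> = a 0"
    using assms by (auto simp: supp_def)
  finally show ?thesis .
qed

lemma parseval_trig:
  fixes a :: "int ^ 'n \<Rightarrow> complex"
  assumes fin: "finite (supp a)"
  shows "cube_integral (\<lambda>x. (cmod (trig a x))\<^sup>2) = (\<Sum>m\<in>supp a. (cmod (a m))\<^sup>2)"
proof -
  have eq: "complex_of_real ((cmod (trig a x))\<^sup>2) = (\<Sum>m\<in>supp a. \<Sum>m'\<in>supp a. (a m * cnj (a m')) * chr (m - m') x)" for x
  proof -
    have "complex_of_real ((cmod (trig a x))\<^sup>2) = trig a x * cnj (trig a x)"
      by (rule complex_norm_square)
    also have "\<dots> = (\<Sum>m\<in>supp a. \<Sum>m'\<in>supp a. (a m * chr m x) * cnj (a m' * chr m' x))"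
      unfolding trig_def cnj_sum sum_product ..
    also have "\<dots> = (\<Sum>m\<in>supp a. \<Sum>m'\<in>supp a. (a m * cnj (a m')) * chr (m - m') x)"
      by (simp add: chr_mult_cnj[symmetric] mult_ac)
    finally show ?thesis .
  qed
  have int: "integrable cube_measure (chr m)" for m :: "int ^ 'n"
    by (rule integrable_cube_bounded[where B = 1]) (auto intro!: measurable_completion)
  have "complex_of_real (cube_integral (\<lambda>x. (cmod (trig a x))\<^sup>2))
      = cube_integral (\<lambda>x. complex_of_real ((cmod (trig a x))\<^sup>2))"
    by (rule integral_complex_of_real[symmetric])
  also have "\<dots> = (\<Sum>m\<in>supp a. \<Sum>m'\<in>supp a. (a m * cnj (a m')) * cube_integral (chr (m - m')))"
  proof -
    have "cube_integral (\<lambda>x. \<Sum>m'\<in>supp a. (a m * cnj (a m')) * chr (m - m') x)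
        = (\<Sum>m'\<in>supp a. (a m * cnj (a m')) * cube_integral (chr (m - m')))" for m
    proof (subst Bochner_Integration.integral_sum)
      show "integrable cube_measure (\<lambda>x. (a m * cnj (a m')) * chr (m - m') x)" for m'
        by (rule integrable_mult_right[OF int])
    qed simp
    moreover have "cube_integral (\<lambda>x. \<Sum>m\<in>supp a. \<Sum>m'\<in>supp a. (a m * cnj (a m')) * chr (m - m') x)
        = (\<Sum>m\<in>supp a. cube_integral (\<lambda>x. \<Sum>m'\<in>supp a. (a m * cnj (a m')) * chr (m - m') x))"
      by (rule Bochner_Integration.integral_sum) (intro Bochner_Integration.integrable_sum integrable_mult_right int)
    ultimately show ?thesis by (simp only: eq)
  qed
  also have "\<dots> = (\<Sum>m\<in>supp a. \<Sum>m'\<in>supp a. if m' = m then a m * cnj (a m) else 0)"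
    by (intro sum.cong refl) (auto simp: integral_chr)
  also have "\<dots> = (\<Sum>m\<in>supp a. a m * cnj (a m))"
    using fin by (intro sum.cong refl) simp
  also have "\<dots> = complex_of_real (\<Sum>m\<in>supp a. (cmod (a m))\<^sup>2)"
    by (simp add: complex_norm_square[symmetric])
  finally show ?thesis
    by (simp only: of_real_eq_iff)
qed

section \<open>Density of trigonometric polynomials\<close>

definition trig_poly :: "(real ^ 'n \<Rightarrow> complex) \<Rightarrow> bool" where
  "trig_poly p \<longleftrightarrow> (\<exists>a. finite (supp a) \<and> p = trig a)"

lemma trig_poly_chr: "trig_poly (\<lambda>x. c * chr m x)"
proof -
  let ?a = "\<lambda>m'. if m' = m then c else 0"
  have "supp ?a \<subseteq> {m}" by (auto simp: supp_def)
  then have "finite (supp ?a)" "trig ?a = (\<lambda>x. c * chr m x)"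
    using trig_superset[of "{m}" ?a] finite_subset by (auto simp: fun_eq_iff)
  then show ?thesis unfolding trig_poly_def by metis
qed

lemma trig_poly_const: "trig_poly (\<lambda>x. c)"
  using trig_poly_chr[of c 0] by (simp add: chr_def)

lemma trig_poly_add:
  assumes "trig_poly p" "trig_poly q"
  shows "trig_poly (\<lambda>x. p x + q x)"
proof -
  obtain a b where a: "finite (supp a)" "p = trig a" and b: "finite (supp b)" "q = trig b"
    using assms unfolding trig_poly_def by blast
  let ?S = "supp a \<union> supp b" and ?c = "\<lambda>m. a m + b m"
  have S: "finite ?S" "supp ?c \<subseteq> ?S"
    using a b by (auto simp: supp_def)
  then have "trig ?c = (\<lambda>x. p x + q x)"
    unfolding fun_eq_iff a b
    using trig_superset[of ?S a] trig_superset[of ?S b] trig_superset[of ?S ?c]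
    by (auto simp: distrib_right sum.distrib)
  then show ?thesis
    unfolding trig_poly_def using finite_subset[OF S(2,1)] by metis
qed

lemma trig_poly_sum:
  "finite I \<Longrightarrow> (\<And>i. i \<in> I \<Longrightarrow> trig_poly (p i)) \<Longrightarrow> trig_poly (\<lambda>x. \<Sum>i\<in>I. p i x)"
  by (induction I rule: finite_induct) (auto intro: trig_poly_add trig_poly_const)

lemma chr_mult: "chr m x * chr m' x = chr (m + m') x"
  by (simp add: chr_def cis_mult distrib_left[symmetric] sum.distrib[symmetric] distrib_right[symmetric])

lemma trig_poly_mult:
  assumes "trig_poly p" "trig_poly q"
  shows "trig_poly (\<lambda>x. p x * q x)"
proof -
  obtain a b where a: "finite (supp a)" "p = trig a" and b: "finite (supp b)" "q = trig b"
    using assms unfolding trig_poly_def by blast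
  have "(\<lambda>x. p x * q x) = (\<lambda>x. \<Sum>m\<in>supp a. \<Sum>m'\<in>supp b. (a m * b m') * chr (m + m') x)"
    unfolding a b trig_def sum_product by (simp add: chr_mult[symmetric] mult_ac)
  then show ?thesis
    using a b by (simp add: trig_poly_sum trig_poly_chr)
qed

lemma trig_poly_cmult: "trig_poly p \<Longrightarrow> trig_poly (\<lambda>x. c * p x)"
  by (intro trig_poly_mult trig_poly_const)

text \<open>
  The quotient map from the unit cube onto a product of circles. On its compact image trigonometric
  polynomials are restrictions of polynomials, which makes the Stone--Weierstrass theorem available.
\<close>

definition torus_map :: "real ^ 'n \<Rightarrow> complex ^ 'n" where
  "torus_map x = (\<chi> i. cis (2 * pi * x $ i))"

lemma chr_axis: "chr (axis i 1) x = cis (2 * pi * x $ i)" "chr (- axis i 1) x = cis (- (2 * pi * x $ i))"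
  by (simp_all add: chr_def axis_def if_distrib[of of_int] if_distrib[of "\<lambda>c. c * _"] sum_negf cong: if_cong)

lemma trig_poly_polynomial:
  assumes "real_polynomial_function g"
  shows "trig_poly (\<lambda>x :: real ^ 'n. complex_of_real (g (torus_map x)))"
  using assms
proof (induction g rule: real_polynomial_function.induct)
  case (linear f)
  interpret bounded_linear f by (rule linear)
  have re: "trig_poly (\<lambda>x :: real ^ 'n. complex_of_real (Re (torus_map x $ i)))" for i
  proof -
    have "complex_of_real (Re (torus_map x $ i)) = (1 / 2) * chr (axis i 1) x + (1 / 2) * chr (- axis i 1) x" for x :: "real ^ 'n"
      unfolding chr_axis by (simp add: torus_map_def complex_eq_iff)
    then show ?thesis by (simp only:) (intro trig_poly_add trig_poly_chr)
  qed
  have im: "trig_poly (\<lambda>x :: real ^ 'n. complex_of_real (Im (torus_map x $ i)))" for i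
  proof -
    have "complex_of_real (Im (torus_map x $ i)) = (- \<i> / 2) * chr (axis i 1) x + (\<i> / 2) * chr (- axis i 1) x" for x :: "real ^ 'n"
      unfolding chr_axis by (simp add: torus_map_def complex_eq_iff)
    then show ?thesis by (simp only:) (intro trig_poly_add trig_poly_chr)
  qed
  have fz: "f z = (\<Sum>i\<in>UNIV. Re (z $ i) * f (axis i 1) + Im (z $ i) * f (axis i \<i>))" for z :: "complex ^ 'n"
  proof -
    have "z = (\<Sum>i\<in>UNIV. Re (z $ i) *\<^sub>R axis i 1 + Im (z $ i) *\<^sub>R axis i \<i>)"
      by (auto simp: vec_eq_iff axis_def complex_eq_iff if_distrib[of "\<lambda>c. _ * c"] if_distrib[of "\<lambda>c. _ *\<^sub>R c"] sum.distrib cong: if_cong)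
    then have "f z = f (\<Sum>i\<in>UNIV. Re (z $ i) *\<^sub>R axis i 1 + Im (z $ i) *\<^sub>R axis i \<i>)"
      by simp
    then show ?thesis by (simp add: sum add scaleR)
  qed
  have eq: "(\<lambda>x :: real ^ 'n. complex_of_real (f (torus_map x))) =
      (\<lambda>x. \<Sum>i\<in>UNIV. complex_of_real (f (axis i 1)) * complex_of_real (Re (torus_map x $ i))
                 + complex_of_real (f (axis i \<i>)) * complex_of_real (Im (torus_map x $ i)))"
    by (rule ext, subst fz) (simp add: mult.commute)
  show ?case
    unfolding eq by (intro trig_poly_sum trig_poly_add trig_poly_cmult re im) simp
next
  case (add f g)
  then show ?case by (simp add: trig_poly_add)
next
  case (mult f g)
  then show ?case by (simp add: trig_poly_mult)
qed (simp add: trig_poly_const)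

lemma cis_eq_imp_Ints:
  assumes "cis (2 * pi * s) = cis (2 * pi * t)"
  shows "s - t \<in> \<int>"
proof -
  have "cis (2 * pi * (s - t)) = cis (2 * pi * s) / cis (2 * pi * t)"
    by (simp add: cis_divide right_diff_distrib)
  also have "\<dots> = 1" using assms by simp
  finally have "cos (2 * pi * (s - t)) = 1" by (simp add: complex_eq_iff)
  then obtain n :: int where "2 * pi * (s - t) = of_int n * 2 * pi"
    by (auto simp: cos_one_2pi_int)
  then have "s - t = of_int n" by simp
  then show ?thesis by simp
qed

text \<open>
  A continuous function that vanishes on the boundary of the cube factors through the torus, because
  two different points of the cube with the same image both lie on the boundary. The factor is
  continuous as the torus map is a quotient map.
\<close>

lemma trig_poly_dense_uniform:
  fixes \<phi> :: "real ^ 'n \<Rightarrow> real"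
  assumes cont: "continuous_on unit_cube \<phi>"
    and bd: "\<And>x i. x \<in> unit_cube \<Longrightarrow> x $ i = 0 \<or> x $ i = 1 \<Longrightarrow> \<phi> x = 0"
    and e: "e > 0"
  obtains p where "trig_poly p" "\<And>x. x \<in> unit_cube \<Longrightarrow> cmod (complex_of_real (\<phi> x) - p x) < e"
proof -
  define K where "K = torus_map ` (unit_cube :: (real ^ 'n) set)"
  define G where "G z = \<phi> (SOME x. x \<in> unit_cube \<and> torus_map x = z)" for z
  have eq\<phi>: "\<phi> x = \<phi> y" if "x \<in> unit_cube" "y \<in> unit_cube" "torus_map x = torus_map y" for x y
  proof (cases "x = y")
    case False
    then obtain i where i: "x $ i \<noteq> y $ i" by (auto simp: vec_eq_iff)
    have "x $ i - y $ i \<in> \<int>"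
      using that(3) by (intro cis_eq_imp_Ints) (auto simp: torus_map_def vec_eq_iff)
    then obtain n :: int where n: "x $ i - y $ i = of_int n" by (auto elim: Ints_cases)
    have r: "0 \<le> x $ i" "x $ i \<le> 1" "0 \<le> y $ i" "y $ i \<le> 1"
      using that by (auto simp: mem_unit_cube)
    then have "\<bar>real_of_int n\<bar> \<le> 1" using n by linarith
    then have "n = 1 \<or> n = -1" using i n by (cases "n = 0") auto
    then have "(x $ i = 0 \<or> x $ i = 1) \<and> (y $ i = 0 \<or> y $ i = 1)"
      using n r by auto
    then show ?thesis using bd that by metis
  qed simp
  have G: "G (torus_map x) = \<phi> x" if x: "x \<in> unit_cube" for x
  proof -
    have "(SOME y. y \<in> unit_cube \<and> torus_map y = torus_map x) \<in> unit_cube \<and>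
        torus_map (SOME y. y \<in> unit_cube \<and> torus_map y = torus_map x) = torus_map x"
      by (rule someI[of _ x]) (use x in simp)
    then show ?thesis unfolding G_def by (intro eq\<phi> x) auto
  qed
  have comp: "compact (unit_cube :: (real ^ 'n) set)" by (simp add: unit_cube_def)
  have cE: "continuous_on unit_cube (torus_map :: real ^ 'n \<Rightarrow> _)"
    unfolding torus_map_def by (intro continuous_intros)
  have compK: "compact K" unfolding K_def by (intro compact_continuous_image cE comp)
  have contG: "continuous_on K G"
    unfolding continuous_openin_preimage_eq
  proof (intro allI impI)
    fix V :: "real set" assume V: "open V"
    have "unit_cube \<inter> torus_map -` (K \<inter> G -` V) = unit_cube \<inter> \<phi> -` V"
    proof (rule set_eqI)
      fix x
      show "x \<in> unit_cube \<inter> torus_map -` (K \<inter> G -` V) \<longleftrightarrow> x \<in> unit_cube \<inter> \<phi> -` V"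
        by (cases "x \<in> unit_cube") (simp_all add: K_def G)
    qed
    moreover have "openin (top_of_set unit_cube) (unit_cube \<inter> \<phi> -` V)"
      using cont V unfolding continuous_openin_preimage_eq by blast
    ultimately show "openin (top_of_set K) (K \<inter> G -` V)"
      using Abstract_Topology_2.continuous_imp_quotient_map[OF cE K_def[symmetric] comp, of "K \<inter> G -` V"] by auto
  qed
  obtain g where g: "real_polynomial_function g" "\<And>z. z \<in> K \<Longrightarrow> \<bar>G z - g z\<bar> < e"
    using Stone_Weierstrass_real_polynomial_function[OF compK contG e] by blast
  show thesis
  proof
    show "trig_poly (\<lambda>x :: real ^ 'n. complex_of_real (g (torus_map x)))"
      by (rule trig_poly_polynomial[OF g(1)])
    fix x :: "real ^ 'n" assume x: "x \<in> unit_cube"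
    have "cmod (complex_of_real (\<phi> x) - complex_of_real (g (torus_map x))) = \<bar>\<phi> x - g (torus_map x)\<bar>"
      by (simp flip: of_real_diff)
    also have "\<dots> < e" using g(2)[of "torus_map x"] x G[OF x] by (auto simp: K_def)
    finally show "cmod (complex_of_real (\<phi> x) - complex_of_real (g (torus_map x))) < e" .
  qed
qed

definition cube_L2 :: "(real ^ 'n \<Rightarrow> complex) \<Rightarrow> bool" where
  "cube_L2 f \<longleftrightarrow> f \<in> borel_measurable lebesgue \<and> integrable cube_measure (\<lambda>x. (cmod (f x))\<^sup>2)"

abbreviation cube_norm_sq :: "(real ^ 'n \<Rightarrow> complex) \<Rightarrow> real" where
  "cube_norm_sq f \<equiv> cube_integral (\<lambda>x. (cmod (f x))\<^sup>2)"

lemma cmod_add_sq: "(cmod (u + v))\<^sup>2 \<le> 2 * (cmod u)\<^sup>2 + 2 * (cmod v)\<^sup>2"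
proof -
  have "(cmod (u + v))\<^sup>2 \<le> (cmod u + cmod v)\<^sup>2"
    by (intro power_mono norm_triangle_ineq) simp
  also have "\<dots> \<le> 2 * (cmod u)\<^sup>2 + 2 * (cmod v)\<^sup>2"
    using sum_squares_bound[of "cmod u" "cmod v"] by (simp add: power2_sum)
  finally show ?thesis .
qed

lemma cube_L2_add:
  assumes "cube_L2 f" "cube_L2 g"
  shows "cube_L2 (\<lambda>x. f x + g x)" "cube_norm_sq (\<lambda>x. f x + g x) \<le> 2 * cube_norm_sq f + 2 * cube_norm_sq g"
proof -
  have m: "f \<in> borel_measurable lebesgue" "g \<in> borel_measurable lebesgue"
    and i: "integrable cube_measure (\<lambda>x. (cmod (f x))\<^sup>2)" "integrable cube_measure (\<lambda>x. (cmod (g x))\<^sup>2)"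
    using assms by (auto simp: cube_L2_def)
  have i2: "integrable cube_measure (\<lambda>x. 2 * (cmod (f x))\<^sup>2 + 2 * (cmod (g x))\<^sup>2)"
    using i by auto
  have i3: "integrable cube_measure (\<lambda>x. (cmod (f x + g x))\<^sup>2)"
  proof (rule Bochner_Integration.integrable_bound[OF i2])
    show "(\<lambda>x. (cmod (f x + g x))\<^sup>2) \<in> borel_measurable cube_measure"
      using m by (intro measurable_restrict_space1) measurable
    show "AE x in cube_measure. norm ((cmod (f x + g x))\<^sup>2) \<le> norm (2 * (cmod (f x))\<^sup>2 + 2 * (cmod (g x))\<^sup>2)"
      by (intro AE_I2) (simp add: cmod_add_sq)
  qed
  then show "cube_L2 (\<lambda>x. f x + g x)"
    using m by (simp add: cube_L2_def)
  have "cube_norm_sq (\<lambda>x. f x + g x) \<le> cube_integral (\<lambda>x. 2 * (cmod (f x))\<^sup>2 + 2 * (cmod (g x))\<^sup>2)"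
    by (rule integral_mono[OF i3 i2]) (rule cmod_add_sq)
  also have "\<dots> = 2 * cube_norm_sq f + 2 * cube_norm_sq g"
    using i by simp
  finally show "cube_norm_sq (\<lambda>x. f x + g x) \<le> 2 * cube_norm_sq f + 2 * cube_norm_sq g" .
qed

lemma cube_L2_cmult:
  assumes "cube_L2 f"
  shows "cube_L2 (\<lambda>x. c * f x)" "cube_norm_sq (\<lambda>x. c * f x) = (cmod c)\<^sup>2 * cube_norm_sq f"
  using assms by (auto simp: cube_L2_def norm_mult power_mult_distrib)

lemma cube_L2_diff:
  assumes "cube_L2 f" "cube_L2 g"
  shows "cube_L2 (\<lambda>x. f x - g x)" "cube_norm_sq (\<lambda>x. f x - g x) \<le> 2 * cube_norm_sq f + 2 * cube_norm_sq g"
  using cube_L2_add[OF assms(1) cube_L2_cmult(1)[OF assms(2), of "-1"]] by simp_all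

lemma cube_L2_bounded:
  assumes "f \<in> borel_measurable lebesgue" "\<And>x. cmod (f x) \<le> B"
  shows "cube_L2 f"
  unfolding cube_L2_def
proof (intro conjI assms(1) integrable_cube_bounded)
  show "norm ((cmod (f x))\<^sup>2) \<le> B\<^sup>2" for x
    using assms(2)[of x] by (simp add: power_mono)
qed (use assms(1) in measurable)

lemma cube_L2_mono:
  assumes f: "cube_L2 f" and g: "g \<in> borel_measurable lebesgue" and le: "\<And>x. cmod (g x) \<le> cmod (f x)"
  shows "cube_L2 g"
  unfolding cube_L2_def
proof (intro conjI g)
  have "integrable cube_measure (\<lambda>x. (cmod (f x))\<^sup>2)" using f by (simp add: cube_L2_def)
  then show "integrable cube_measure (\<lambda>x. (cmod (g x))\<^sup>2)"
  proof (rule Bochner_Integration.integrable_bound)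
    show "(\<lambda>x. (cmod (g x))\<^sup>2) \<in> borel_measurable cube_measure"
      using g by (intro measurable_restrict_space1) measurable
    show "AE x in cube_measure. norm ((cmod (g x))\<^sup>2) \<le> norm ((cmod (f x))\<^sup>2)"
      using le by (intro AE_I2) (simp add: power_mono)
  qed
qed

lemma cube_L2_const: "cube_L2 (\<lambda>x. c)"
  by (rule cube_L2_bounded[of _ "cmod c"]) auto

lemma trig_poly_borel: "trig_poly p \<Longrightarrow> p \<in> borel_measurable lebesgue"
  unfolding trig_poly_def by (auto intro: measurable_completion)

lemma cube_L2_trig_poly: "trig_poly p \<Longrightarrow> cube_L2 p"
  unfolding trig_poly_def
  using cmod_trig_le by (auto intro!: cube_L2_bounded measurable_completion)

lemma integrable_cube_L2:
  assumes "cube_L2 f"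
  shows "integrable cube_measure f"
proof -
  have "integrable cube_measure (\<lambda>x. 1 + (cmod (f x))\<^sup>2)"
    using assms finite_measure.integrable_const[OF finite_cube_measure]
    by (intro Bochner_Integration.integrable_add) (auto simp: cube_L2_def)
  then show ?thesis
  proof (rule Bochner_Integration.integrable_bound)
    show "f \<in> borel_measurable cube_measure"
      using assms by (intro measurable_restrict_space1) (simp add: cube_L2_def)
    have "t \<le> 1 + t\<^sup>2" for t :: real
    proof -
      have "2 * t \<le> t\<^sup>2 + 1" using sum_squares_bound[of t 1] by simp
      then show ?thesis using zero_le_power2[of t] by linarith
    qed
    then show "AE x in cube_measure. norm (f x) \<le> norm (1 + (cmod (f x))\<^sup>2)"
      by (intro AE_I2) (simp add: abs_of_nonneg add_nonneg_nonneg)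
  qed
qed

lemma cmod_integral_sq_le:
  fixes f :: "real ^ 'n \<Rightarrow> complex"
  assumes "cube_L2 f"
  shows "(cmod (cube_integral f))\<^sup>2 \<le> cube_norm_sq f"
proof -
  define m where "m = cube_integral (\<lambda>x. cmod (f x))"
  have i: "integrable cube_measure (\<lambda>x. cmod (f x))" "integrable cube_measure (\<lambda>x. (cmod (f x))\<^sup>2)"
    using integrable_cube_L2[OF assms] assms by (auto simp: cube_L2_def)
  have "0 \<le> cube_integral (\<lambda>x. (cmod (f x) - m)\<^sup>2)"
    by (rule integral_nonneg_AE) simp
  also have "\<dots> = cube_integral (\<lambda>x. (cmod (f x))\<^sup>2 - (2 * m) * cmod (f x) + m\<^sup>2)"
    by (rule Bochner_Integration.integral_cong) (auto simp: power2_diff)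
  also have "\<dots> = cube_norm_sq f - 2 * m * m + m\<^sup>2"
  proof -
    have "cube_integral (\<lambda>x. (cmod (f x))\<^sup>2 - (2 * m) * cmod (f x) + m\<^sup>2)
        = cube_integral (\<lambda>x. (cmod (f x))\<^sup>2 - (2 * m) * cmod (f x)) + cube_integral (\<lambda>x :: real ^ 'n. m\<^sup>2)"
      by (intro Bochner_Integration.integral_add Bochner_Integration.integrable_diff integrable_mult_right i
          finite_measure.integrable_const[OF finite_cube_measure])
    also have "cube_integral (\<lambda>x. (cmod (f x))\<^sup>2 - (2 * m) * cmod (f x))
        = cube_norm_sq f - cube_integral (\<lambda>x. (2 * m) * cmod (f x))"
      by (intro Bochner_Integration.integral_diff integrable_mult_right i)
    also have "cube_integral (\<lambda>x. (2 * m) * cmod (f x)) = 2 * m * m"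
      unfolding m_def by (rule integral_mult_right_zero)
    finally show ?thesis by simp
  qed
  finally have "m\<^sup>2 \<le> cube_norm_sq f" by (simp add: power2_eq_square)
  moreover have "(cmod (cube_integral f))\<^sup>2 \<le> m\<^sup>2"
    unfolding m_def by (intro power_mono integral_norm_bound) simp
  ultimately show ?thesis by simp
qed

definition trig_approximable :: "(real ^ 'n \<Rightarrow> complex) \<Rightarrow> bool" where
  "trig_approximable f \<longleftrightarrow> (\<forall>\<epsilon>>0. \<exists>p. trig_poly p \<and> cube_norm_sq (\<lambda>x. f x - p x) < \<epsilon>)"

lemma trig_approximable_limit:
  assumes f: "cube_L2 f" and g: "\<And>k. cube_L2 (g k)" "\<And>k. trig_approximable (g k)"
    and lim: "(\<lambda>k. cube_norm_sq (\<lambda>x. f x - g k x)) \<longlonglongrightarrow> 0"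
  shows "trig_approximable f"
  unfolding trig_approximable_def
proof (intro allI impI)
  fix \<epsilon> :: real assume "\<epsilon> > 0"
  then have "eventually (\<lambda>k. cube_norm_sq (\<lambda>x. f x - g k x) < \<epsilon> / 4) sequentially"
    using lim by (intro order_tendstoD) auto
  then obtain k where k: "cube_norm_sq (\<lambda>x. f x - g k x) < \<epsilon> / 4"
    by (auto simp: eventually_sequentially)
  obtain p where p: "trig_poly p" "cube_norm_sq (\<lambda>x. g k x - p x) < \<epsilon> / 4"
    using g(2)[of k] \<open>\<epsilon> > 0\<close> unfolding trig_approximable_def by (meson divide_pos_pos zero_less_numeral)
  have "cube_norm_sq (\<lambda>x. (f x - g k x) + (g k x - p x)) \<le> 2 * cube_norm_sq (\<lambda>x. f x - g k x) + 2 * cube_norm_sq (\<lambda>x. g k x - p x)"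
    by (intro cube_L2_add cube_L2_diff f g cube_L2_trig_poly p)
  then show "\<exists>p. trig_poly p \<and> cube_norm_sq (\<lambda>x. f x - p x) < \<epsilon>"
    using k p by (intro exI[of _ p]) simp
qed

lemma cube_norm_sq_dominated:
  fixes f :: "real ^ 'n \<Rightarrow> complex"
  assumes f: "f \<in> borel_measurable lebesgue" and g: "\<And>k. g k \<in> borel_measurable lebesgue"
    and lim: "AE x in cube_measure. (\<lambda>k. g k x) \<longlonglongrightarrow> f x"
    and w: "integrable cube_measure w" "\<And>k x. (cmod (f x - g k x))\<^sup>2 \<le> w x"
  shows "(\<lambda>k. cube_norm_sq (\<lambda>x. f x - g k x)) \<longlonglongrightarrow> 0"
proof -
  have "(\<lambda>k. cube_norm_sq (\<lambda>x. f x - g k x)) \<longlonglongrightarrow> cube_integral (\<lambda>x :: real ^ 'n. 0 :: real)"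
  proof (rule Bochner_Integration.integral_dominated_convergence[where w = w])
    show "(\<lambda>x. (cmod (f x - g k x))\<^sup>2) \<in> borel_measurable cube_measure" for k
      using f g[of k] by (intro measurable_restrict_space1) measurable
    show "AE x in cube_measure. (\<lambda>k. (cmod (f x - g k x))\<^sup>2) \<longlonglongrightarrow> 0"
      using lim
    proof eventually_elim
      case (elim x)
      have "(\<lambda>k. (cmod (f x - g k x))\<^sup>2) \<longlonglongrightarrow> (cmod (f x - f x))\<^sup>2"
        by (intro tendsto_intros elim)
      then show ?case by simp
    qed
    show "AE x in cube_measure. norm ((cmod (f x - g k x))\<^sup>2) \<le> w x" for k
      using w(2) by (intro AE_I2) simp
  qed (use w in auto)
  then show ?thesis by simp
qed

lemma trig_approximable_continuous:
  fixes \<phi> :: "real ^ 'n \<Rightarrow> real"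
  assumes cont: "continuous_on UNIV \<phi>"
    and bd: "\<And>x i. x \<in> unit_cube \<Longrightarrow> x $ i = 0 \<or> x $ i = 1 \<Longrightarrow> \<phi> x = 0"
  shows "trig_approximable (\<lambda>x. complex_of_real (\<phi> x))"
  unfolding trig_approximable_def
proof (intro allI impI)
  fix \<epsilon> :: real assume e: "\<epsilon> > 0"
  obtain p where p: "trig_poly p" "\<And>x. x \<in> unit_cube \<Longrightarrow> cmod (complex_of_real (\<phi> x) - p x) < sqrt (\<epsilon> / 2)"
  proof (rule trig_poly_dense_uniform[of \<phi> "sqrt (\<epsilon> / 2)"])
    show "continuous_on unit_cube \<phi>" using cont by (rule continuous_on_subset) simp
    show "\<phi> x = 0" if "x \<in> unit_cube" "x $ i = 0 \<or> x $ i = 1" for x i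
      using bd that by blast
    show "0 < sqrt (\<epsilon> / 2)" using e by simp
  qed blast
  have le: "(cmod (complex_of_real (\<phi> x) - p x))\<^sup>2 \<le> \<epsilon> / 2" if "x \<in> unit_cube" for x
  proof -
    have "(cmod (complex_of_real (\<phi> x) - p x))\<^sup>2 \<le> (sqrt (\<epsilon> / 2))\<^sup>2"
      using p(2)[OF that] by (intro power_mono) auto
    then show ?thesis using e by simp
  qed
  have m: "(\<lambda>x. (cmod (complex_of_real (\<phi> x) - p x))\<^sup>2) \<in> borel_measurable lebesgue"
  proof -
    have "\<phi> \<in> borel_measurable lebesgue"
      using borel_measurable_continuous_onI[OF cont] by (intro measurable_completion) simp
    then show ?thesis using trig_poly_borel[OF p(1)] by measurable
  qed
  have "cube_norm_sq (\<lambda>x. complex_of_real (\<phi> x) - p x) \<le> cube_integral (\<lambda>x :: real ^ 'n. \<epsilon> / 2)"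
  proof (rule integral_mono)
    show "integrable cube_measure (\<lambda>x. (cmod (complex_of_real (\<phi> x) - p x))\<^sup>2)"
      using finite_cube_measure
    proof (rule finite_measure.integrable_const_bound)
      show "AE x in cube_measure. norm ((cmod (complex_of_real (\<phi> x) - p x))\<^sup>2) \<le> \<epsilon> / 2"
        using le by (intro AE_I2) (simp add: space_restrict_space)
    qed (use m in \<open>rule measurable_restrict_space1\<close>)
    show "integrable cube_measure (\<lambda>x :: real ^ 'n. \<epsilon> / 2)"
      by (rule finite_measure.integrable_const[OF finite_cube_measure])
    show "(cmod (complex_of_real (\<phi> x) - p x))\<^sup>2 \<le> \<epsilon> / 2" if "x \<in> space cube_measure" for x
      using le that by (simp add: space_restrict_space)
  qed
  then show "\<exists>p. trig_poly p \<and> cube_norm_sq (\<lambda>x. complex_of_real (\<phi> x) - p x) < \<epsilon>"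
    using p(1) e by (intro exI[of _ p]) simp
qed

lemma AE_cube_measure_interior:
  "AE x in (cube_measure :: (real ^ 'n) measure). \<forall>i. 0 < x $ i \<and> x $ i < 1"
proof -
  have "AE x in (lebesgue :: (real ^ 'n) measure). x \<in> unit_cube \<longrightarrow> (\<forall>i. 0 < x $ i \<and> x $ i < 1)"
    using AE_not_integer
  proof eventually_elim
    case (elim x)
    then have "x $ i \<noteq> 0" "x $ i \<noteq> 1" for i by (metis Ints_0, metis Ints_1)
    then show ?case by (auto simp: mem_unit_cube order_less_le)
  qed
  then show ?thesis by (subst AE_restrict_space_iff) auto
qed

definition clamp_abs :: "real \<Rightarrow> real \<Rightarrow> real" where
  "clamp_abs M t = max (- M) (min M t)"

lemma clamp_abs_le: "0 \<le> M \<Longrightarrow> \<bar>clamp_abs M t\<bar> \<le> M"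
  by (auto simp: clamp_abs_def)

lemma clamp_abs_eq: "\<bar>t\<bar> \<le> M \<Longrightarrow> clamp_abs M t = t"
  by (auto simp: clamp_abs_def)

lemma continuous_clamp_abs: "continuous_on S (clamp_abs M)"
  unfolding clamp_abs_def by (intro continuous_intros)

lemma borel_clamp_abs [measurable]: "clamp_abs M \<in> borel_measurable borel"
  by (intro borel_measurable_continuous_onI continuous_clamp_abs)

text \<open>
  A bounded measurable function is an almost everywhere limit of continuous functions. Truncating
  these and multiplying by a cutoff \<open>min 1 (k * \<bar>b x\<bar>)\<close>, which vanishes on the boundary and tends to
  1 inside, gives dominated convergence by functions covered by the previous case.
\<close>

lemma trig_approximable_bounded:
  fixes f :: "real ^ 'n \<Rightarrow> real"
  assumes f: "f \<in> borel_measurable lebesgue" and M: "\<And>x. \<bar>f x\<bar> \<le> M"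
  shows "trig_approximable (\<lambda>x. complex_of_real (f x))"
proof -
  have M0: "0 \<le> M" using M[of 0] by linarith
  have "f measurable_on UNIV"
    using f by (intro lebesgue_measurable_imp_measurable_on) auto
  then obtain N g where N: "negligible N" and cg: "\<And>k. continuous_on UNIV (g k)"
    and g: "\<And>x. x \<notin> N \<Longrightarrow> (\<lambda>k. g k x) \<longlonglongrightarrow> f x"
    unfolding measurable_on_def by auto
  define b where "b x = (\<Prod>i\<in>UNIV. x $ i * (1 - x $ i))" for x :: "real ^ 'n"
  define h where "h k x = clamp_abs M (g k x) * min 1 (real k * \<bar>b x\<bar>)" for k x
  have cb: "continuous_on UNIV b"
    unfolding b_def by (intro continuous_intros)
  have ch: "continuous_on UNIV (h k)" for k
    unfolding h_def
    by (intro continuous_intros cb continuous_on_compose2[OF continuous_clamp_abs cg]) auto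
  have hM: "\<bar>h k x\<bar> \<le> M" for k x
  proof -
    have "\<bar>h k x\<bar> \<le> M * 1"
      unfolding h_def abs_mult by (intro mult_mono clamp_abs_le M0) auto
    then show ?thesis by simp
  qed
  have hm: "h k \<in> borel_measurable lebesgue" for k
    using borel_measurable_continuous_onI[OF ch] by (intro measurable_completion) simp
  show ?thesis
  proof (rule trig_approximable_limit[where g = "\<lambda>k x. complex_of_real (h k x)"])
    show "cube_L2 (\<lambda>x. complex_of_real (f x))"
      using f M by (intro cube_L2_bounded[of _ M]) auto
    show "cube_L2 (\<lambda>x. complex_of_real (h k x))" for k
      using hm hM by (intro cube_L2_bounded[of _ M]) auto
    show "trig_approximable (\<lambda>x. complex_of_real (h k x))" for k
    proof (rule trig_approximable_continuous[OF ch])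
      fix x :: "real ^ 'n" and i assume "x $ i = 0 \<or> x $ i = 1"
      then have "b x = 0" unfolding b_def by (intro prod_zero) auto
      then show "h k x = 0" by (simp add: h_def)
    qed
    show "(\<lambda>k. cube_norm_sq (\<lambda>x. complex_of_real (f x) - complex_of_real (h k x))) \<longlonglongrightarrow> 0"
    proof (rule cube_norm_sq_dominated[where w = "\<lambda>x. (2 * M)\<^sup>2"])
      show "integrable cube_measure (\<lambda>x. (2 * M)\<^sup>2)"
        by (rule finite_measure.integrable_const[OF finite_cube_measure])
      show "(cmod (complex_of_real (f x) - complex_of_real (h k x)))\<^sup>2 \<le> (2 * M)\<^sup>2" for k x
        using M[of x] hM[of k x] unfolding of_real_diff[symmetric] norm_of_real
        by (intro power_mono) auto
      have "AE x in lebesgue. x \<notin> N"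
        using N by (simp add: AE_not_in negligible_iff_null_sets)
      then have "AE x in cube_measure. x \<notin> N"
        by (subst AE_restrict_space_iff) auto
      then show "AE x in cube_measure. (\<lambda>k. complex_of_real (h k x)) \<longlonglongrightarrow> complex_of_real (f x)"
        using AE_cube_measure_interior
      proof eventually_elim
        case (elim x)
        have "b x > 0" unfolding b_def using elim by (intro prod_pos) auto
        then obtain k0 :: nat where k0: "1 \<le> real k0 * \<bar>b x\<bar>"
          by (metis abs_of_pos less_imp_le mult.commute reals_Archimedean3)
        have ev: "eventually (\<lambda>k. min 1 (real k * \<bar>b x\<bar>) = 1) sequentially"
          using eventually_ge_at_top[of k0]
        proof eventually_elim
          case (elim k)
          have "real k0 * \<bar>b x\<bar> \<le> real k * \<bar>b x\<bar>" using elim by (intro mult_right_mono) auto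
          then show ?case using k0 by simp
        qed
        have "isCont (clamp_abs M) (f x)"
          using continuous_clamp_abs[of UNIV M] by (simp add: continuous_on_eq_continuous_at)
        then have "(\<lambda>k. clamp_abs M (g k x)) \<longlonglongrightarrow> clamp_abs M (f x)"
          using g elim by (intro isCont_tendsto_compose[of _ "clamp_abs M"]) auto
        then have "(\<lambda>k. clamp_abs M (g k x) * min 1 (real k * \<bar>b x\<bar>)) \<longlonglongrightarrow> clamp_abs M (f x) * 1"
          by (rule tendsto_mult[OF _ tendsto_eventually[OF ev]])
        then have "(\<lambda>k. h k x) \<longlonglongrightarrow> f x"
          using clamp_abs_eq[OF M, of x] by (simp add: h_def)
        then show ?case by (rule tendsto_of_real)
      qed
    qed (use f hm in auto)
  qed
qed

lemma trig_approximable_real: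
  fixes f :: "real ^ 'n \<Rightarrow> real"
  assumes f: "cube_L2 (\<lambda>x. complex_of_real (f x))" "f \<in> borel_measurable lebesgue"
  shows "trig_approximable (\<lambda>x. complex_of_real (f x))"
proof (rule trig_approximable_limit[where g = "\<lambda>k x. complex_of_real (clamp_abs (real k) (f x))"])
  have m: "(\<lambda>x. clamp_abs (real k) (f x)) \<in> borel_measurable lebesgue" for k
    using f(2) by measurable
  show "cube_L2 (\<lambda>x. complex_of_real (clamp_abs (real k) (f x)))" for k
    using m[of k] clamp_abs_le[of "real k"] by (intro cube_L2_bounded[of _ "real k"]) auto
  show "trig_approximable (\<lambda>x. complex_of_real (clamp_abs (real k) (f x)))" for k
    by (rule trig_approximable_bounded[OF m, of k "real k"]) (simp add: clamp_abs_le)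
  show "(\<lambda>k. cube_norm_sq (\<lambda>x. complex_of_real (f x) - complex_of_real (clamp_abs (real k) (f x)))) \<longlonglongrightarrow> 0"
  proof (rule cube_norm_sq_dominated[where w = "\<lambda>x. (cmod (complex_of_real (f x)))\<^sup>2"])
    show "integrable cube_measure (\<lambda>x. (cmod (complex_of_real (f x)))\<^sup>2)"
      using f by (simp add: cube_L2_def)
    show "(cmod (complex_of_real (f x) - complex_of_real (clamp_abs (real k) (f x))))\<^sup>2 \<le> (cmod (complex_of_real (f x)))\<^sup>2" for k x
      unfolding of_real_diff[symmetric] norm_of_real
      by (intro power_mono) (auto simp: clamp_abs_def)
    show "AE x in cube_measure. (\<lambda>k. complex_of_real (clamp_abs (real k) (f x))) \<longlonglongrightarrow> complex_of_real (f x)"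
    proof (rule AE_I2)
      fix x
      have "eventually (\<lambda>k. complex_of_real (clamp_abs (real k) (f x)) = complex_of_real (f x)) sequentially"
        using eventually_ge_at_top[of "nat \<lceil>\<bar>f x\<bar>\<rceil>"]
      proof eventually_elim
        case (elim k)
        then have "\<bar>f x\<bar> \<le> real k" by linarith
        then show ?case by (simp add: clamp_abs_eq)
      qed
      then show "(\<lambda>k. complex_of_real (clamp_abs (real k) (f x))) \<longlonglongrightarrow> complex_of_real (f x)"
        by (rule tendsto_eventually)
    qed
  qed (use f m in auto)
qed (rule f)

lemma trig_poly_dense:
  assumes f: "cube_L2 f" and e: "\<epsilon> > 0"
  obtains p where "trig_poly p" "cube_norm_sq (\<lambda>x. f x - p x) < \<epsilon>"
proof -
  have m: "f \<in> borel_measurable lebesgue" and i: "integrable cube_measure (\<lambda>x. (cmod (f x))\<^sup>2)"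
    using f by (auto simp: cube_L2_def)
  have mr: "(\<lambda>x. Re (f x)) \<in> borel_measurable lebesgue" "(\<lambda>x. Im (f x)) \<in> borel_measurable lebesgue"
    using m by measurable
  have L: "cube_L2 (\<lambda>x. complex_of_real (Re (f x)))" "cube_L2 (\<lambda>x. complex_of_real (Im (f x)))"
    using mr abs_Re_le_cmod abs_Im_le_cmod by (auto intro: cube_L2_mono[OF f])
  obtain p where p: "trig_poly p" "cube_norm_sq (\<lambda>x. complex_of_real (Re (f x)) - p x) < \<epsilon> / 4"
    using trig_approximable_real[OF L(1) mr(1)] e unfolding trig_approximable_def
    by (meson divide_pos_pos zero_less_numeral)
  obtain q where q: "trig_poly q" "cube_norm_sq (\<lambda>x. complex_of_real (Im (f x)) - q x) < \<epsilon> / 4"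
    using trig_approximable_real[OF L(2) mr(2)] e unfolding trig_approximable_def
    by (meson divide_pos_pos zero_less_numeral)
  have L2: "cube_L2 (\<lambda>x. complex_of_real (Im (f x)) - q x)"
    by (intro cube_L2_diff L cube_L2_trig_poly q)
  have "cube_norm_sq (\<lambda>x. (complex_of_real (Re (f x)) - p x) + \<i> * (complex_of_real (Im (f x)) - q x))
      \<le> 2 * cube_norm_sq (\<lambda>x. complex_of_real (Re (f x)) - p x) + 2 * cube_norm_sq (\<lambda>x. \<i> * (complex_of_real (Im (f x)) - q x))"
    by (intro cube_L2_add cube_L2_diff cube_L2_cmult L cube_L2_trig_poly p q)
  also have "\<dots> < \<epsilon>"
    using p(2) q(2) cube_L2_cmult(2)[OF L2, of \<i>] by simp
  also have "(\<lambda>x. (complex_of_real (Re (f x)) - p x) + \<i> * (complex_of_real (Im (f x)) - q x))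
      = (\<lambda>x. f x - (p x + \<i> * q x))"
    by (simp add: fun_eq_iff complex_eq_iff)
  finally show thesis
    by (intro that[of "\<lambda>x. p x + \<i> * q x"] trig_poly_add trig_poly_cmult p q)
qed

section \<open>An average over isometries that contracts mean zero functions\<close>

definition avg :: "('a \<Rightarrow> 'a) list \<Rightarrow> ('a \<Rightarrow> 'b::real_vector) \<Rightarrow> 'a \<Rightarrow> 'b" where
  "avg gs F x = (\<Sum>g\<leftarrow>gs. F (g x)) /\<^sub>R real (length gs)"

lemma avg_avg:
  "avg gs (avg hs F) = avg [h \<circ> g. g \<leftarrow> gs, h \<leftarrow> hs] F"
proof
  fix x
  have len: "length [h \<circ> g. g \<leftarrow> gs, h \<leftarrow> hs] = length gs * length hs"
    by (induction gs) auto
  have sum: "(\<Sum>f\<leftarrow>[h \<circ> g. g \<leftarrow> gs, h \<leftarrow> hs]. F (f x)) = (\<Sum>g\<leftarrow>gs. \<Sum>h\<leftarrow>hs. F (h (g x)))"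
    by (induction gs) (simp_all add: comp_def)
  have pull: "(\<Sum>g\<leftarrow>gs. c *\<^sub>R k g) = c *\<^sub>R (\<Sum>g\<leftarrow>gs. k g)" for c and k :: "_ \<Rightarrow> 'b"
    by (induction gs) (simp_all add: scaleR_right_distrib)
  show "avg gs (avg hs F) x = avg [h \<circ> g. g \<leftarrow> gs, h \<leftarrow> hs] F x"
    unfolding avg_def sum len pull by (simp add: mult.commute)
qed

lemma hecke_eq_avg:
  assumes n: "CARD('n::finite) \<ge> 3"
  obtains gs :: "(real ^ 'n \<Rightarrow> real ^ 'n) list"
  where "gs \<noteq> []" "set gs \<subseteq> iso_plus" "\<And>F :: real ^ 'n \<Rightarrow> complex. hecke F = avg gs F"
proof -
  obtain ps :: "('n \<times> 'n) list" where ps: "set ps = distinct_pairs" "distinct ps"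
    using finite_distinct_list[of "distinct_pairs :: ('n \<times> 'n) set"] by auto
  define gs where "gs = [branch (fst p) (snd p) k. p \<leftarrow> ps, k \<leftarrow> [0..<5]]"
  have lenps: "length ps = card (distinct_pairs :: ('n \<times> 'n) set)"
    using ps distinct_card by metis
  have len: "length gs = 5 * length ps"
    unfolding gs_def by (induction ps) auto
  show thesis
  proof
    show "gs \<noteq> []"
      using len lenps card_distinct_pairs_pos[OF n] by auto
    show "set gs \<subseteq> iso_plus"
      using ps(1) branch_iso_plus by (auto simp: gs_def distinct_pairs_def)
    fix F :: "real ^ 'n \<Rightarrow> complex"
    have "(\<Sum>g\<leftarrow>gs. F (g x)) = (\<Sum>(i, j)\<in>distinct_pairs. \<Sum>k<5. F (branch i j k x))" for x
    proof -
      have "(\<Sum>g\<leftarrow>[branch (fst p) (snd p) k. p \<leftarrow> qs, k \<leftarrow> [0..<5]]. F (g x)) = (\<Sum>p\<leftarrow>qs. \<Sum>k<5. F (branch (fst p) (snd p) k x))" for qs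
      proof (induction qs)
        case (Cons p qs)
        have "(\<Sum>k\<leftarrow>[0..<5]. F (branch (fst p) (snd p) k x)) = (\<Sum>k<5. F (branch (fst p) (snd p) k x))"
          by (simp add: interv_sum_list_conv_sum_set_nat atLeast0LessThan)
        with Cons show ?case by (simp add: comp_def)
      qed simp
      then have "(\<Sum>g\<leftarrow>gs. F (g x)) = (\<Sum>p\<in>distinct_pairs. \<Sum>k<5. F (branch (fst p) (snd p) k x))"
        unfolding gs_def using ps by (simp add: sum_list_distinct_conv_sum_set)
      then show ?thesis by (simp add: case_prod_unfold)
    qed
    then show "hecke F = avg gs F"
      by (simp add: fun_eq_iff hecke_def avg_def len lenps)
  qed
qed

lemma hecke_coeff_gap:
  assumes n: "CARD('n::finite) \<ge> 3"
  obtains \<rho> where "0 \<le> \<rho>" "\<rho> < 1"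
    "\<And>a :: int ^ 'n \<Rightarrow> complex. finite (supp a) \<Longrightarrow>
       (\<Sum>m\<in>supp (hecke_coeff a) - {0}. (cmod (hecke_coeff a m))\<^sup>2) \<le> \<rho> * (\<Sum>m\<in>supp a - {0}. (cmod (a m))\<^sup>2)"
proof -
  define N where "N = card (distinct_pairs :: ('n \<times> 'n) set)"
  define t where "t = 1 + 1 / real N"
  define \<rho> where "\<rho> = (real N / 2 * (t + 1 / t) - (t - 1 / t)) / real N"
  have N: "N > 0" using card_distinct_pairs_pos[OF n] by (simp add: N_def)
  have "real N / 2 * (t + 1 / t) - (t - 1 / t) < real N"
    unfolding t_def by (rule schur_constant_less[OF N])
  then have less: "\<rho> < 1" using N by (simp add: \<rho>_def)
  have ge: "0 \<le> \<rho>"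
  proof -
    let ?m = "axis undefined 1 :: int ^ 'n"
    have t: "t > 0" using N by (simp add: t_def add_pos_nonneg)
    have "?m \<noteq> 0" by (simp add: axis_eq_0_iff)
    have "0 \<le> (\<Sum>(i, j) \<in> distinct_pairs. if integral_rot i j ?m then t ^ val5 (int_rot i j ?m) else 0)"
      using t by (intro sum_nonneg) auto
    also have "\<dots> \<le> (real N / 2 * (t + 1 / t) - (t - 1 / t)) * t ^ val5 ?m"
      unfolding t_def N_def by (rule schur_weight[OF n \<open>?m \<noteq> 0\<close>])
    finally have prod: "0 \<le> (real N / 2 * (t + 1 / t) - (t - 1 / t)) * t ^ val5 ?m" .
    have "0 \<le> x" if "0 \<le> x * y" "0 < y" for x y :: real
      using that by (simp add: zero_le_mult_iff)
    from this[OF prod] have "0 \<le> real N / 2 * (t + 1 / t) - (t - 1 / t)"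
      using t by simp
    then show ?thesis
      unfolding \<rho>_def by (rule divide_nonneg_nonneg) simp
  qed
  show thesis
  proof
    show "0 \<le> \<rho>\<^sup>2" by simp
    show "\<rho>\<^sup>2 < 1" using ge less by (simp add: power_less_one_iff)
    show "(\<Sum>m\<in>supp (hecke_coeff a) - {0}. (cmod (hecke_coeff a m))\<^sup>2) \<le> \<rho>\<^sup>2 * (\<Sum>m\<in>supp a - {0}. (cmod (a m))\<^sup>2)"
      if "finite (supp a)" for a :: "int ^ 'n \<Rightarrow> complex"
      using hecke_coeff_contraction[OF n that] unfolding \<rho>_def t_def N_def .
  qed
qed

definition floor_vec :: "real ^ 'n \<Rightarrow> real ^ 'n" where
  "floor_vec x = (\<chi> i. of_int \<lfloor>x $ i\<rfloor>)"

lemma lattice_floor_vec [simp]: "lattice_vec (floor_vec x)"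
  by (simp add: lattice_vec_def floor_vec_def)

lemma diff_floor_vec_in_cube: "x - floor_vec x \<in> unit_cube"
proof -
  have "0 \<le> x $ i - of_int \<lfloor>x $ i\<rfloor> \<and> x $ i - of_int \<lfloor>x $ i\<rfloor> \<le> 1" for i
    by linarith
  then show ?thesis by (simp add: mem_unit_cube floor_vec_def)
qed

lemma finite_floor_vec:
  assumes "bounded S"
  shows "finite (floor_vec ` (S :: (real ^ 'n) set))"
proof -
  obtain B where B: "\<And>x. x \<in> S \<Longrightarrow> norm x \<le> B"
    using assms by (auto simp: bounded_iff)
  let ?R = "{\<lfloor>- B\<rfloor>..\<lfloor>B\<rfloor>}"
  have "floor_vec ` S \<subseteq> (\<lambda>h. \<chi> i. of_int (h i)) ` (UNIV \<rightarrow>\<^sub>E ?R)"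
  proof
    fix y assume "y \<in> floor_vec ` S"
    then obtain x where x: "x \<in> S" "y = floor_vec x" by blast
    have "\<bar>x $ i\<bar> \<le> B" for i
      using component_le_norm_cart[of x i] B[OF x(1)] by linarith
    then have "- B \<le> x $ i" "x $ i \<le> B" for i
      by (simp_all add: abs_le_iff minus_le_iff)
    then have "\<lfloor>x $ i\<rfloor> \<in> ?R" for i
      by (auto intro: floor_mono)
    then show "y \<in> (\<lambda>h. \<chi> i. of_int (h i)) ` (UNIV \<rightarrow>\<^sub>E ?R)"
      unfolding x(2) floor_vec_def by (intro image_eqI[of _ _ "\<lambda>i. \<lfloor>x $ i\<rfloor>"]) auto
  qed
  moreover have "finite (UNIV \<rightarrow>\<^sub>E ?R :: ('n \<Rightarrow> int) set)"
    by (intro finite_PiE) auto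
  ultimately show ?thesis by (meson finite_imageI finite_subset)
qed

lemma periodicD: "periodic F \<Longrightarrow> lattice_vec z \<Longrightarrow> F (x + z) = F x"
  by (simp add: periodic_def)

lemma cube_L2_nn:
  "cube_L2 f \<longleftrightarrow> f \<in> borel_measurable lebesgue \<and> (\<integral>\<^sup>+x. ennreal ((cmod (f x))\<^sup>2) * indicator unit_cube x \<partial>lebesgue) < \<infinity>"
proof -
  have "integrable cube_measure (\<lambda>x. (cmod (f x))\<^sup>2) \<longleftrightarrow> (\<integral>\<^sup>+x. ennreal ((cmod (f x))\<^sup>2) \<partial>cube_measure) < \<infinity>"
    if "f \<in> borel_measurable lebesgue"
  proof -
    have "(\<lambda>x. (cmod (f x))\<^sup>2) \<in> borel_measurable cube_measure"
      using that by (intro measurable_restrict_space1) measurable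
    then show ?thesis by (simp add: integrable_iff_bounded)
  qed
  then show ?thesis
    by (auto simp: cube_L2_def nn_integral_restrict_space)
qed

lemma cube_norm_sq_nn:
  assumes "cube_L2 f"
  shows "ennreal (cube_norm_sq f) = (\<integral>\<^sup>+x. ennreal ((cmod (f x))\<^sup>2) * indicator unit_cube x \<partial>lebesgue)"
  using assms by (simp add: cube_L2_def nn_integral_eq_integral[symmetric] nn_integral_restrict_space)

text \<open>
  The image of the cube under an isometry meets only finitely many translates of the cube, so
  composition with the isometry is bounded on periodic functions. Boundedness with any constant is
  enough to extend estimates from the dense set of trigonometric polynomials.
\<close>

lemma cube_L2_comp_iso:
  fixes g :: "real ^ 'n \<Rightarrow> real ^ 'n"
  assumes g: "g \<in> iso_plus"
  obtains K where "0 \<le> K"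
    "\<And>F. periodic F \<Longrightarrow> cube_L2 F \<Longrightarrow> cube_L2 (\<lambda>x. F (g x)) \<and> cube_norm_sq (\<lambda>x. F (g x)) \<le> K * cube_norm_sq F"
proof -
  define Z where "Z = floor_vec ` (g ` (unit_cube :: (real ^ 'n) set))"
  have comp: "compact (g ` (unit_cube :: (real ^ 'n) set))"
    by (intro compact_continuous_image iso_plus_continuous[OF g]) (simp add: unit_cube_def)
  then have Z: "finite Z"
    unfolding Z_def by (intro finite_floor_vec compact_imp_bounded)
  have bound: "cube_L2 (\<lambda>x. F (g x)) \<and> cube_norm_sq (\<lambda>x. F (g x)) \<le> real (card Z) * cube_norm_sq F"
    if per: "periodic F" and F: "cube_L2 F" for F
  proof -
    have m: "F \<in> borel_measurable lebesgue" using F by (simp add: cube_L2_def)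
    have m2: "(\<lambda>y. ennreal ((cmod (F y))\<^sup>2)) \<in> borel_measurable lebesgue"
      using m by measurable
    have gi: "indicator (g ` unit_cube) (g x) = (indicator unit_cube x :: ennreal)" for x
      using iso_plus_bij[OF g] by (simp add: indicator_def inj_image_mem_iff bij_is_inj)
    have gm: "g ` unit_cube \<in> sets lebesgue"
      using comp by (intro fmeasurableD lmeasurable_compact)
    have cubem: "(\<lambda>y. indicator unit_cube (y - z) :: ennreal) \<in> borel_measurable lebesgue" for z :: "real ^ 'n"
    proof -
      have "(\<lambda>y. indicator unit_cube (y - z) :: ennreal) \<in> borel_measurable borel"
        by (rule measurable_compose[of "\<lambda>y. y - z" borel borel]) simp_all
      then show ?thesis by (intro measurable_completion) simp
    qed
    have "(\<integral>\<^sup>+x. ennreal ((cmod (F (g x)))\<^sup>2) * indicator unit_cube x \<partial>lebesgue)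
        = (\<integral>\<^sup>+x. ennreal ((cmod (F (g x)))\<^sup>2) * indicator (g ` unit_cube) (g x) \<partial>lebesgue)"
      by (simp add: gi)
    also have "\<dots> = (\<integral>\<^sup>+y. ennreal ((cmod (F y))\<^sup>2) * indicator (g ` unit_cube) y \<partial>lebesgue)"
      by (intro nn_integral_iso_plus[OF g] borel_measurable_times_ennreal m2 borel_measurable_indicator gm)
    also have "\<dots> \<le> (\<integral>\<^sup>+y. (\<Sum>z\<in>Z. ennreal ((cmod (F y))\<^sup>2) * indicator unit_cube (y - z)) \<partial>lebesgue)"
    proof (rule nn_integral_mono)
      fix y :: "real ^ 'n"
      show "ennreal ((cmod (F y))\<^sup>2) * indicator (g ` unit_cube) y
          \<le> (\<Sum>z\<in>Z. ennreal ((cmod (F y))\<^sup>2) * indicator unit_cube (y - z))"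
      proof (cases "y \<in> g ` unit_cube")
        case True
        then have "floor_vec y \<in> Z" by (simp add: Z_def)
        then have "ennreal ((cmod (F y))\<^sup>2) * indicator unit_cube (y - floor_vec y)
            \<le> (\<Sum>z\<in>Z. ennreal ((cmod (F y))\<^sup>2) * indicator unit_cube (y - z))"
          using Z by (intro member_le_sum[of _ Z "\<lambda>z. ennreal ((cmod (F y))\<^sup>2) * indicator unit_cube (y - z)"]) simp_all
        then show ?thesis using True diff_floor_vec_in_cube[of y] by simp
      qed simp
    qed
    also have "\<dots> = (\<Sum>z\<in>Z. \<integral>\<^sup>+y. ennreal ((cmod (F y))\<^sup>2) * indicator unit_cube (y - z) \<partial>lebesgue)"
      by (intro nn_integral_sum borel_measurable_times_ennreal m2 cubem)
    also have "\<dots> = (\<Sum>z\<in>Z. \<integral>\<^sup>+x. ennreal ((cmod (F x))\<^sup>2) * indicator unit_cube x \<partial>lebesgue)"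
    proof (rule sum.cong[OF refl])
      fix z assume "z \<in> Z"
      then have z: "lattice_vec z" by (auto simp: Z_def)
      have "(\<integral>\<^sup>+y. ennreal ((cmod (F y))\<^sup>2) * indicator unit_cube (y - z) \<partial>lebesgue)
          = (\<integral>\<^sup>+x. ennreal ((cmod (F (x + z)))\<^sup>2) * indicator unit_cube ((x + z) - z) \<partial>lebesgue)"
        by (intro nn_integral_iso_plus[OF iso_plus_translation, symmetric] borel_measurable_times_ennreal m2 cubem)
      then show "(\<integral>\<^sup>+y. ennreal ((cmod (F y))\<^sup>2) * indicator unit_cube (y - z) \<partial>lebesgue)
          = (\<integral>\<^sup>+x. ennreal ((cmod (F x))\<^sup>2) * indicator unit_cube x \<partial>lebesgue)"
        by (simp add: periodicD[OF per z])
    qed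
    also have "\<dots> = of_nat (card Z) * ennreal (cube_norm_sq F)"
      by (simp add: cube_norm_sq_nn[OF F])
    also have "\<dots> = ennreal (real (card Z) * cube_norm_sq F)"
      by (simp add: ennreal_mult ennreal_of_nat_eq_real_of_nat)
    finally have le: "(\<integral>\<^sup>+x. ennreal ((cmod (F (g x)))\<^sup>2) * indicator unit_cube x \<partial>lebesgue)
        \<le> ennreal (real (card Z) * cube_norm_sq F)" .
    have L: "cube_L2 (\<lambda>x. F (g x))"
      unfolding cube_L2_nn using le measurable_iso_plus_comp[OF g m] order_le_less_trans[OF le] by simp
    moreover have "ennreal (cube_norm_sq (\<lambda>x. F (g x))) \<le> ennreal (real (card Z) * cube_norm_sq F)"
      using le cube_norm_sq_nn[OF L] by simp
    then have "cube_norm_sq (\<lambda>x. F (g x)) \<le> real (card Z) * cube_norm_sq F"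
      by (subst (asm) ennreal_le_iff) (auto intro: integral_nonneg_AE)
    ultimately show ?thesis by blast
  qed
  show thesis
    by (rule that[of "real (card Z)"]) (use bound in auto)
qed

lemma cube_L2_avg:
  fixes gs :: "(real ^ 'n \<Rightarrow> real ^ 'n) list"
  assumes "set gs \<subseteq> iso_plus"
  obtains K where "0 \<le> K"
    "\<And>F :: real ^ 'n \<Rightarrow> complex. periodic F \<Longrightarrow> cube_L2 F \<Longrightarrow> cube_L2 (avg gs F) \<and> cube_norm_sq (avg gs F) \<le> K * cube_norm_sq F"
proof -
  have "\<exists>K\<ge>0. \<forall>F :: real ^ 'n \<Rightarrow> complex. periodic F \<longrightarrow> cube_L2 F \<longrightarrow>
      cube_L2 (\<lambda>x. \<Sum>g\<leftarrow>gs. F (g x)) \<and> cube_norm_sq (\<lambda>x. \<Sum>g\<leftarrow>gs. F (g x)) \<le> K * cube_norm_sq F"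
    using assms
  proof (induction gs)
    case Nil
    show ?case
      by (intro exI[of _ 0]) (simp add: cube_L2_const)
  next
    case (Cons g gs)
    then obtain K where K: "K \<ge> 0" "\<And>F :: real ^ 'n \<Rightarrow> complex. periodic F \<Longrightarrow> cube_L2 F \<Longrightarrow>
      cube_L2 (\<lambda>x. \<Sum>g\<leftarrow>gs. F (g x)) \<and> cube_norm_sq (\<lambda>x. \<Sum>g\<leftarrow>gs. F (g x)) \<le> K * cube_norm_sq F"
      by auto
    obtain K' where K': "K' \<ge> 0"
      "\<And>F. periodic F \<Longrightarrow> cube_L2 F \<Longrightarrow> cube_L2 (\<lambda>x. F (g x)) \<and> cube_norm_sq (\<lambda>x. F (g x)) \<le> K' * cube_norm_sq F"
      using cube_L2_comp_iso[of g] Cons.prems by auto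
    show ?case
    proof (intro exI[of _ "2 * K' + 2 * K"] conjI allI impI)
      show "0 \<le> 2 * K' + 2 * K" using K(1) K'(1) by simp
      fix F :: "real ^ 'n \<Rightarrow> complex" assume F: "periodic F" "cube_L2 F"
      have a: "cube_L2 (\<lambda>x. F (g x))" "cube_norm_sq (\<lambda>x. F (g x)) \<le> K' * cube_norm_sq F"
        using K'(2)[OF F] by auto
      have b: "cube_L2 (\<lambda>x. \<Sum>g\<leftarrow>gs. F (g x))" "cube_norm_sq (\<lambda>x. \<Sum>g\<leftarrow>gs. F (g x)) \<le> K * cube_norm_sq F"
        using K(2)[OF F] by auto
      show "cube_L2 (\<lambda>x. \<Sum>g\<leftarrow>g # gs. F (g x))"
        using cube_L2_add(1)[OF a(1) b(1)] by simp
      have "cube_norm_sq (\<lambda>x. \<Sum>g\<leftarrow>g # gs. F (g x)) \<le> 2 * cube_norm_sq (\<lambda>x. F (g x)) + 2 * cube_norm_sq (\<lambda>x. \<Sum>g\<leftarrow>gs. F (g x))"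
        using cube_L2_add(2)[OF a(1) b(1)] by simp
      also have "\<dots> \<le> (2 * K' + 2 * K) * cube_norm_sq F"
        using a(2) b(2) by (simp add: distrib_right)
      finally show "cube_norm_sq (\<lambda>x. \<Sum>g\<leftarrow>g # gs. F (g x)) \<le> (2 * K' + 2 * K) * cube_norm_sq F" .
    qed
  qed
  then obtain K where K: "K \<ge> 0" "\<And>F :: real ^ 'n \<Rightarrow> complex. periodic F \<Longrightarrow> cube_L2 F \<Longrightarrow>
      cube_L2 (\<lambda>x. \<Sum>g\<leftarrow>gs. F (g x)) \<and> cube_norm_sq (\<lambda>x. \<Sum>g\<leftarrow>gs. F (g x)) \<le> K * cube_norm_sq F"
    by blast
  define c where "c = complex_of_real (inverse (real (length gs)))"
  show thesis
  proof
    show "0 \<le> (cmod c)\<^sup>2 * K" using K(1) by simp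
    fix F :: "real ^ 'n \<Rightarrow> complex" assume F: "periodic F" "cube_L2 F"
    have eq: "avg gs F = (\<lambda>x. c * (\<Sum>g\<leftarrow>gs. F (g x)))"
      by (simp add: fun_eq_iff avg_def c_def scaleR_conv_of_real)
    have L: "cube_L2 (\<lambda>x. \<Sum>g\<leftarrow>gs. F (g x))" "cube_norm_sq (\<lambda>x. \<Sum>g\<leftarrow>gs. F (g x)) \<le> K * cube_norm_sq F"
      using K(2)[OF F] by auto
    have "(cmod c)\<^sup>2 * cube_norm_sq (\<lambda>x. \<Sum>g\<leftarrow>gs. F (g x)) \<le> (cmod c)\<^sup>2 * (K * cube_norm_sq F)"
      using L(2) by (intro mult_left_mono) auto
    then show "cube_L2 (avg gs F) \<and> cube_norm_sq (avg gs F) \<le> (cmod c)\<^sup>2 * K * cube_norm_sq F"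
      unfolding eq using cube_L2_cmult[OF L(1), of c] by (simp add: mult.assoc)
  qed
qed

lemma avg_diff: "avg gs (\<lambda>x. F x - G x) x = avg gs F x - avg gs G x"
proof -
  have "(\<Sum>g\<leftarrow>gs. F (g x) - G (g x)) = (\<Sum>g\<leftarrow>gs. F (g x)) - (\<Sum>g\<leftarrow>gs. G (g x))"
    by (rule sum_list_subtractf)
  then show ?thesis by (simp add: avg_def scaleR_diff_right)
qed

lemma periodic_trig: "periodic (trig (a :: int ^ 'n \<Rightarrow> complex))"
  unfolding periodic_def trig_def
  by (intro allI impI sum.cong refl arg_cong2[where f = "(*)"] periodicD[OF periodic_chr])

text \<open>
  The constant 64 leaves enough room for both later uses: the Chebyshev estimate in
  \<open>exists_robust_set\<close> and the cross term in \<open>pointwise_energy_bound\<close>.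
\<close>

definition contracting_average :: "(real ^ 'n \<Rightarrow> real ^ 'n) list \<Rightarrow> bool" where
  "contracting_average gs \<longleftrightarrow> gs \<noteq> [] \<and> set gs \<subseteq> iso_plus \<and>
     (\<forall>F :: real ^ 'n \<Rightarrow> complex. periodic F \<longrightarrow> periodic (avg gs F)) \<and>
     (\<forall>F :: real ^ 'n \<Rightarrow> complex. periodic F \<longrightarrow> cube_L2 F \<longrightarrow>
        cube_L2 (avg gs F) \<and> cube_norm_sq (\<lambda>x. avg gs F x - cube_integral F) \<le> cube_norm_sq F / 64)"

lemma contracting_averageD:
  fixes F :: "real ^ 'n \<Rightarrow> complex"
  assumes "contracting_average gs"
  shows "gs \<noteq> []" "set gs \<subseteq> iso_plus" "periodic F \<Longrightarrow> periodic (avg gs F)"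
    "periodic F \<Longrightarrow> cube_L2 F \<Longrightarrow> cube_L2 (avg gs F)"
    "periodic F \<Longrightarrow> cube_L2 F \<Longrightarrow>
       cube_norm_sq (\<lambda>x. avg gs F x - cube_integral F) \<le> cube_norm_sq F / 64"
  using assms unfolding contracting_average_def by blast+

text \<open>
  A high power of the Hecke operator. On trigonometric polynomials it contracts the mean zero part
  by \<open>1/256\<close> in square norm; the crude inequality \<open>|u + v|\<^sup>2 \<le> 2 |u|\<^sup>2 + 2 |v|\<^sup>2\<close>, used twice for the
  approximation, costs a factor 4.
\<close>

lemma exists_contracting_average:
  assumes n: "CARD('n::finite) \<ge> 3"
  obtains gs :: "(real ^ 'n \<Rightarrow> real ^ 'n) list" where "contracting_average gs"
proof -
  obtain hs :: "(real ^ 'n \<Rightarrow> real ^ 'n) list" where hs: "hs \<noteq> []" "set hs \<subseteq> iso_plus"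
    and hecke: "\<And>F :: real ^ 'n \<Rightarrow> complex. hecke F = avg hs F"
    using hecke_eq_avg[OF n] by blast
  obtain \<rho> where \<rho>: "0 \<le> \<rho>" "\<rho> < 1" and gap: "\<And>a :: int ^ 'n \<Rightarrow> complex. finite (supp a) \<Longrightarrow>
       (\<Sum>m\<in>supp (hecke_coeff a) - {0}. (cmod (hecke_coeff a m))\<^sup>2) \<le> \<rho> * (\<Sum>m\<in>supp a - {0}. (cmod (a m))\<^sup>2)"
    using hecke_coeff_gap[OF n] by blast
  have "(\<lambda>l. \<rho> ^ l) \<longlonglongrightarrow> 0" using \<rho> by (intro LIMSEQ_power_zero) simp
  then have "eventually (\<lambda>l. \<rho> ^ l < 1 / 256) sequentially"
    by (rule order_tendstoD) simp
  then obtain l where l: "\<rho> ^ l < 1 / 256" by (auto simp: eventually_sequentially)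
  have iter: "\<exists>gs. gs \<noteq> [] \<and> set gs \<subseteq> iso_plus \<and> (\<forall>F :: real ^ 'n \<Rightarrow> complex. (hecke ^^ k) F = avg gs F)" for k
  proof (induction k)
    case 0
    show ?case by (intro exI[of _ "[id]"]) (simp add: iso_plus_id avg_def fun_eq_iff)
  next
    case (Suc k)
    then obtain gs where gs: "gs \<noteq> []" "set gs \<subseteq> iso_plus" "\<forall>F :: real ^ 'n \<Rightarrow> complex. (hecke ^^ k) F = avg gs F"
      by blast
    show ?case
    proof (intro exI conjI allI)
      show "[h \<circ> g. g \<leftarrow> hs, h \<leftarrow> gs] \<noteq> []" using hs gs by (cases hs; cases gs) auto
      show "set [h \<circ> g. g \<leftarrow> hs, h \<leftarrow> gs] \<subseteq> iso_plus" using hs gs by (auto intro: iso_plus_comp)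
      show "(hecke ^^ Suc k) F = avg [h \<circ> g. g \<leftarrow> hs, h \<leftarrow> gs] F" for F :: "real ^ 'n \<Rightarrow> complex"
        using gs(3) by (simp add: hecke avg_avg)
    qed
  qed
  obtain gs where gs: "gs \<noteq> []" "set gs \<subseteq> iso_plus" "\<And>F :: real ^ 'n \<Rightarrow> complex. (hecke ^^ l) F = avg gs F"
    using iter[of l] by blast
  have coeff: "finite (supp ((hecke_coeff ^^ k) a)) \<and> (hecke ^^ k) (trig a) = trig ((hecke_coeff ^^ k) a)
      \<and> (hecke_coeff ^^ k) a 0 = a 0
      \<and> (\<Sum>m\<in>supp ((hecke_coeff ^^ k) a) - {0}. (cmod ((hecke_coeff ^^ k) a m))\<^sup>2) \<le> \<rho> ^ k * (\<Sum>m\<in>supp a - {0}. (cmod (a m))\<^sup>2)"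
    if fin: "finite (supp a)" for a :: "int ^ 'n \<Rightarrow> complex" and k
  proof (induction k)
    case 0
    show ?case using fin by simp
  next
    case (Suc k)
    let ?b = "(hecke_coeff ^^ k) a"
    have b: "finite (supp ?b)" using Suc by blast
    have "(\<Sum>m\<in>supp (hecke_coeff ?b) - {0}. (cmod (hecke_coeff ?b m))\<^sup>2) \<le> \<rho> * (\<Sum>m\<in>supp ?b - {0}. (cmod (?b m))\<^sup>2)"
      by (rule gap[OF b])
    also have "\<dots> \<le> \<rho> * (\<rho> ^ k * (\<Sum>m\<in>supp a - {0}. (cmod (a m))\<^sup>2))"
      using Suc \<rho> by (intro mult_left_mono) auto
    finally show ?case
      using Suc b finite_supp_hecke_coeff[OF b] hecke_trig[OF n b] hecke_coeff_zero[OF n, of ?b]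
      by (simp add: mult.assoc)
  qed
  have trig_gap: "cube_norm_sq (\<lambda>x. avg gs p x - cube_integral p) \<le> cube_norm_sq p / 256"
    if "trig_poly p" for p :: "real ^ 'n \<Rightarrow> complex"
  proof -
    obtain a where a: "finite (supp a)" "p = trig a" using \<open>trig_poly p\<close> by (auto simp: trig_poly_def)
    let ?b = "(hecke_coeff ^^ l) a"
    define b where "b m = (if m = 0 then 0 else ?b m)" for m
    have fb: "finite (supp ?b)" and b0: "?b 0 = a 0" and Tp: "avg gs p = trig ?b"
      and le: "(\<Sum>m\<in>supp ?b - {0}. (cmod (?b m))\<^sup>2) \<le> \<rho> ^ l * (\<Sum>m\<in>supp a - {0}. (cmod (a m))\<^sup>2)"
      using coeff[OF a(1), of l] gs(3)[of p] a(2) by auto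
    have sb: "supp b = supp ?b - {0}" by (auto simp: supp_def b_def)
    have fb': "finite (supp b)" using fb by (simp add: sb)
    have "trig ?b x - a 0 = trig b x" for x
    proof -
      have "trig ?b x = (\<Sum>m\<in>insert 0 (supp ?b). ?b m * chr m x)"
        using fb by (intro trig_superset) auto
      also have "\<dots> = ?b 0 * chr 0 x + (\<Sum>m\<in>supp ?b - {0}. ?b m * chr m x)"
        using fb by (subst sum.insert_remove) auto
      also have "chr 0 x = 1" by (simp add: chr_def)
      also have "(\<Sum>m\<in>supp ?b - {0}. ?b m * chr m x) = trig b x"
        unfolding trig_def sb by (intro sum.cong) (auto simp: b_def)
      finally show ?thesis by (simp add: b0)
    qed
    moreover have "cube_integral p = a 0"
      unfolding a(2) by (rule integral_trig[OF a(1)])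
    ultimately have "(\<lambda>x. avg gs p x - cube_integral p) = trig b"
      by (simp add: fun_eq_iff Tp)
    then have "cube_norm_sq (\<lambda>x. avg gs p x - cube_integral p) = cube_norm_sq (trig b)"
      by (simp add: fun_eq_iff)
    also have "\<dots> = (\<Sum>m\<in>supp ?b - {0}. (cmod (?b m))\<^sup>2)"
      unfolding parseval_trig[OF fb'] sb by (intro sum.cong) (auto simp: b_def)
    also have "\<dots> \<le> \<rho> ^ l * (\<Sum>m\<in>supp a - {0}. (cmod (a m))\<^sup>2)" by (rule le)
    also have "\<dots> \<le> (1 / 256) * (\<Sum>m\<in>supp a. (cmod (a m))\<^sup>2)"
      using l \<rho> a(1) by (intro mult_mono sum_mono2 sum_nonneg) auto
    also have "\<dots> = cube_norm_sq p / 256"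
      unfolding a(2) parseval_trig[OF a(1)] by simp
    finally show ?thesis .
  qed
  obtain K where K: "0 \<le> K" and bdd: "\<And>F :: real ^ 'n \<Rightarrow> complex. periodic F \<Longrightarrow> cube_L2 F \<Longrightarrow>
      cube_L2 (avg gs F) \<and> cube_norm_sq (avg gs F) \<le> K * cube_norm_sq F"
    using cube_L2_avg[OF gs(2)] by blast
  show thesis
  proof (rule that[of gs], unfold contracting_average_def, intro conjI allI impI)
    show "gs \<noteq> []" "set gs \<subseteq> iso_plus" by (fact gs)+
    show "periodic (avg gs F)" if "periodic F" for F :: "real ^ 'n \<Rightarrow> complex"
    proof -
      have "periodic ((hecke ^^ k) F)" for k
        by (induction k) (simp_all add: that hecke_periodic)
      then show ?thesis using gs(3) by metis
    qed
    show "cube_L2 (avg gs F)" if "periodic F" "cube_L2 F" for F :: "real ^ 'n \<Rightarrow> complex"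
      using bdd that by blast
    fix F :: "real ^ 'n \<Rightarrow> complex" assume F: "periodic F" "cube_L2 F"
    define c where "c = cube_integral F"
    have approx: "cube_norm_sq (\<lambda>x. avg gs F x - c) \<le> cube_norm_sq F / 64 + (4 * K + 5) * \<epsilon>" if \<epsilon>: "\<epsilon> > 0" for \<epsilon>
    proof -
      obtain p where p: "trig_poly p" "cube_norm_sq (\<lambda>x. F x - p x) < \<epsilon>"
        using trig_poly_dense[OF F(2) \<epsilon>] by blast
      have pp: "periodic p" and pL: "cube_L2 p"
        using p(1) periodic_trig cube_L2_trig_poly by (auto simp: trig_poly_def)
      define D where "D x = F x - p x" for x
      have D: "periodic D" "cube_L2 D" "cube_norm_sq D < \<epsilon>"
        using F pp pL p(2) by (auto simp: D_def[abs_def] periodic_def intro: cube_L2_diff)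
      define d where "d = cube_integral p"
      have cd: "c - d = cube_integral D"
        unfolding c_def d_def D_def[abs_def]
        by (intro Bochner_Integration.integral_diff[symmetric] integrable_cube_L2 F pL)
      have e1: "cube_norm_sq (\<lambda>x. avg gs p x - d) \<le> cube_norm_sq p / 256"
        unfolding d_def by (rule trig_gap[OF p(1)])
      have "cube_norm_sq (\<lambda>x. F x - D x) \<le> 2 * cube_norm_sq F + 2 * cube_norm_sq D"
        by (intro cube_L2_diff F D)
      then have e2: "cube_norm_sq p \<le> 2 * cube_norm_sq F + 2 * cube_norm_sq D"
        by (simp add: D_def)
      have LpT: "cube_L2 (avg gs p)" "cube_L2 (avg gs D)"
        using bdd[OF pp pL] bdd[OF D(1,2)] by auto
      have e3: "cube_norm_sq (avg gs D) \<le> K * \<epsilon>"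
      proof -
        have "cube_norm_sq (avg gs D) \<le> K * cube_norm_sq D" using bdd[OF D(1,2)] by blast
        also have "\<dots> \<le> K * \<epsilon>" using D(3) K by (intro mult_left_mono) auto
        finally show ?thesis .
      qed
      have e4: "(cmod (c - d))\<^sup>2 \<le> \<epsilon>"
        unfolding cd using cmod_integral_sq_le[OF D(2)] D(3) by simp
      have L1: "cube_L2 (\<lambda>x. avg gs p x - d)" "cube_L2 (\<lambda>x. avg gs D x - (c - d))"
        by (intro cube_L2_diff LpT cube_L2_const)+
      have "cube_norm_sq (\<lambda>x. avg gs F x - c) = cube_norm_sq (\<lambda>x. (avg gs p x - d) + (avg gs D x - (c - d)))"
        by (intro Bochner_Integration.integral_cong refl) (simp add: D_def[abs_def] avg_diff)
      also have "\<dots> \<le> 2 * cube_norm_sq (\<lambda>x. avg gs p x - d) + 2 * cube_norm_sq (\<lambda>x. avg gs D x - (c - d))"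
        by (intro cube_L2_add L1)
      also have "cube_norm_sq (\<lambda>x. avg gs D x - (c - d)) \<le> 2 * cube_norm_sq (avg gs D) + 2 * cube_norm_sq (\<lambda>x :: real ^ 'n. c - d)"
        by (intro cube_L2_diff LpT cube_L2_const)
      finally have "cube_norm_sq (\<lambda>x. avg gs F x - c)
          \<le> 2 * cube_norm_sq (\<lambda>x. avg gs p x - d) + 4 * cube_norm_sq (avg gs D) + 4 * (cmod (c - d))\<^sup>2"
        by simp
      also have "\<dots> \<le> 2 * ((2 * cube_norm_sq F + 2 * \<epsilon>) / 256) + 4 * (K * \<epsilon>) + 4 * \<epsilon>"
      proof -
        have "cube_norm_sq p \<le> 2 * cube_norm_sq F + 2 * \<epsilon>"
          using e2 D(3) by simp
        then have "cube_norm_sq p / 256 \<le> (2 * cube_norm_sq F + 2 * \<epsilon>) / 256"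
          by (rule divide_right_mono) simp
        then have "2 * cube_norm_sq (\<lambda>x. avg gs p x - d) \<le> 2 * ((2 * cube_norm_sq F + 2 * \<epsilon>) / 256)"
          using e1 by simp
        then show ?thesis
          using e3 e4 by (intro add_mono mult_left_mono) simp_all
      qed
      also have "\<dots> \<le> cube_norm_sq F / 64 + (4 * K + 5) * \<epsilon>"
        using \<epsilon> by (simp add: field_simps)
      finally show ?thesis .
    qed
    show "cube_norm_sq (\<lambda>x. avg gs F x - cube_integral F) \<le> cube_norm_sq F / 64"
    proof (rule field_le_epsilon)
      fix \<epsilon> :: real assume "\<epsilon> > 0"
      then have "\<epsilon> / (4 * K + 5) > 0" using K by simp
      from approx[OF this] show "cube_norm_sq (\<lambda>x. avg gs F x - cube_integral F) \<le> cube_norm_sq F / 64 + \<epsilon>"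
        using K by (simp add: c_def)
    qed
  qed
qed

section \<open>Removing a dense open set\<close>

lemma lattice_floor_eq:
  assumes "x - z \<in> box 0 1" "lattice_vec z"
  shows "floor_vec x = z"
proof -
  have "floor_vec x $ i = z $ i" for i
  proof -
    obtain n :: int where n: "z $ i = of_int n"
      using assms(2) by (auto simp: lattice_vec_def elim: Ints_cases)
    have "0 < x $ i - z $ i" "x $ i - z $ i < 1"
      using assms(1) by (auto simp: mem_box_cart)
    then have "\<lfloor>x $ i\<rfloor> = n" unfolding n by linarith
    then show ?thesis by (simp add: floor_vec_def n)
  qed
  then show ?thesis by (simp add: vec_eq_iff)
qed

lemma lattice_vec_diff: "lattice_vec x \<Longrightarrow> lattice_vec y \<Longrightarrow> lattice_vec (x - y)"
  and lattice_vec_add: "lattice_vec x \<Longrightarrow> lattice_vec y \<Longrightarrow> lattice_vec (x + y)"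
  and lattice_vec_minus: "lattice_vec x \<Longrightarrow> lattice_vec (- x)"
  by (auto simp: lattice_vec_def)

text \<open>
  Take a small open neighbourhood of a countable dense set, restrict it to the open unit cube, and
  repeat it periodically. Density survives because almost every point has no integral coordinate
  and can thus be translated into the open cube.
\<close>

lemma exists_small_open_dense:
  assumes e: "e > 0"
  obtains U :: "(real ^ 'n) set" where "open U" "periodic (\<lambda>x. x \<in> U)"
    "\<And>S. open S \<Longrightarrow> S \<noteq> {} \<Longrightarrow> S \<inter> U \<noteq> {}"
    "measure lebesgue (U \<inter> unit_cube) \<le> e"
proof -
  obtain C :: "(real ^ 'n) set" where C: "countable C" "\<And>X. open X \<Longrightarrow> X \<noteq> {} \<Longrightarrow> \<exists>d\<in>C. d \<in> X"
    using countable_dense_setE by blast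
  have nC: "C \<in> null_sets lebesgue"
    by (intro null_sets_completionI countable_imp_null_set_lborel C(1))
  obtain T where T: "open T" "C \<subseteq> T" "emeasure lebesgue (T - C) < ennreal e"
    using sets_lebesgue_outer_open[OF null_setsD2[OF nC] e] by metis
  have "emeasure lebesgue T = emeasure lebesgue ((T - C) \<union> C)"
    using T(2) by (simp add: Un_absorb2)
  also have "\<dots> = emeasure lebesgue (T - C)"
    using T(1) nC by (intro emeasure_Un_null_set) (auto simp: null_setsD2)
  finally have mT: "emeasure lebesgue T < ennreal e" using T(3) by simp
  define O' where "O' = T \<inter> box 0 (1 :: real ^ 'n)"
  define U where "U = {x. \<exists>z. lattice_vec z \<and> x - z \<in> O'}"
  have oO: "open O'" using T(1) by (auto simp: O'_def)
  have "U = (\<Union>z\<in>Collect lattice_vec. (\<lambda>x. x - z) -` O')" by (auto simp: U_def)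
  moreover have "open ((\<lambda>x. x - z) -` O')" for z
    by (intro open_vimage oO continuous_intros)
  ultimately have oU: "open U" by auto
  have pU: "periodic (\<lambda>x. x \<in> U)"
  proof -
    have "x + z \<in> U \<longleftrightarrow> x \<in> U" if z: "lattice_vec z" for x z
    proof
      assume "x + z \<in> U"
      then obtain w where "lattice_vec w" "x + z - w \<in> O'" by (auto simp: U_def)
      then show "x \<in> U" unfolding U_def using z lattice_vec_diff[of w z]
        by (intro CollectI exI[of _ "w - z"]) (auto simp: algebra_simps)
    next
      assume "x \<in> U"
      then obtain w where "lattice_vec w" "x - w \<in> O'" by (auto simp: U_def)
      then show "x + z \<in> U" unfolding U_def using z lattice_vec_add[of w z]
        by (intro CollectI exI[of _ "w + z"]) (auto simp: algebra_simps)
    qed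
    then show ?thesis by (simp add: periodic_def)
  qed
  have dU: "S \<inter> U \<noteq> {}" if S: "open S" "S \<noteq> {}" for S
  proof -
    have "\<not> negligible S" using S open_not_negligible by blast
    then obtain y where y: "y \<in> S" "\<forall>i. y $ i \<notin> \<int>"
    proof -
      have "negligible {x :: real ^ 'n. \<not> (\<forall>i. x $ i \<notin> \<int>)}"
        using AE_not_integer by (simp add: AE_iff_null_sets negligible_iff_null_sets completion.AE_iff_null_sets)
      then have "\<not> S \<subseteq> {x. \<not> (\<forall>i. x $ i \<notin> \<int>)}"
        using \<open>\<not> negligible S\<close> negligible_subset by blast
      then show ?thesis using that by blast
    qed
    let ?z = "floor_vec y"
    have "y - ?z \<in> box 0 1"
    proof -
      have "0 < y $ i - of_int \<lfloor>y $ i\<rfloor> \<and> y $ i - of_int \<lfloor>y $ i\<rfloor> < 1" for i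
      proof -
        have "y $ i \<noteq> of_int \<lfloor>y $ i\<rfloor>" using y(2) by (metis Ints_of_int)
        then show ?thesis using of_int_floor_le[of "y $ i"] floor_less_iff[of "y $ i"] by linarith
      qed
      then show ?thesis by (simp add: mem_box_cart floor_vec_def)
    qed
    moreover define S' where "S' = (\<lambda>x. x + ?z) -` S \<inter> box 0 1"
    ultimately have "y - ?z \<in> S'" using y(1) by simp
    moreover have "open S'"
      unfolding S'_def by (intro open_Int open_vimage S continuous_intros open_box)
    ultimately obtain d where d: "d \<in> C" "d \<in> S'" using C(2) by blast
    then have "d + ?z \<in> S" "d \<in> O'" using T(2) by (auto simp: S'_def O'_def)
    moreover have "d + ?z \<in> U" unfolding U_def using \<open>d \<in> O'\<close>
      by (intro CollectI exI[of _ ?z]) simp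
    ultimately show ?thesis by blast
  qed
  have "U \<inter> unit_cube \<subseteq> T \<union> (cbox 0 1 - box 0 1)"
  proof
    fix x assume x: "x \<in> U \<inter> unit_cube"
    show "x \<in> T \<union> (cbox 0 1 - box 0 1)"
    proof (cases "x \<in> box 0 1")
      case True
      obtain w where w: "lattice_vec w" "x - w \<in> O'" using x by (auto simp: U_def)
      have "floor_vec x = w" using w by (intro lattice_floor_eq) (auto simp: O'_def)
      moreover have "floor_vec x = 0"
        using True by (intro lattice_floor_eq) (auto simp: lattice_vec_def)
      ultimately show ?thesis using w by (simp add: O'_def)
    qed (use x in \<open>simp add: unit_cube_def\<close>)
  qed
  moreover have frontier: "cbox 0 1 - box 0 (1 :: real ^ 'n) \<in> null_sets lebesgue"
    using negligible_frontier_interval by (simp add: negligible_iff_null_sets)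
  ultimately have "emeasure lebesgue (U \<inter> unit_cube) \<le> emeasure lebesgue (T \<union> (cbox 0 1 - box 0 1))"
    using T(1) by (intro emeasure_mono) auto
  also have "\<dots> = emeasure lebesgue T"
    using T(1) frontier by (intro emeasure_Un_null_set) auto
  finally have "emeasure lebesgue (U \<inter> unit_cube) \<le> ennreal e" using mT by simp
  then have "measure lebesgue (U \<inter> unit_cube) \<le> e"
    using e by (simp add: measure_def enn2real_leI)
  then show thesis using that oU pU dU by blast
qed

lemma avg_mono:
  fixes F G :: "'a \<Rightarrow> real"
  assumes "\<And>g. g \<in> set gs \<Longrightarrow> F (g x) \<le> G (g y)"
  shows "avg gs F x \<le> avg gs G y"
proof -
  have "(\<Sum>g\<leftarrow>gs. F (g x)) \<le> (\<Sum>g\<leftarrow>gs. G (g y))"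
    using assms by (rule sum_list_mono)
  then show ?thesis
    unfolding avg_def by (intro scaleR_left_mono) auto
qed

lemma avg_indicator_mono:
  assumes "A \<subseteq> B"
  shows "avg gs (indicator A :: 'a \<Rightarrow> real) x \<le> avg gs (indicator B) x"
  using assms by (intro avg_mono) (auto simp: indicator_def)

text \<open>
  The average of the indicator of an open set is lower semicontinuous: nearby points have at least
  the same images in the set.
\<close>

lemma open_avg_indicator_gt:
  fixes gs :: "('a::topological_space \<Rightarrow> 'a) list"
  assumes "open V" and cont: "\<And>g. g \<in> set gs \<Longrightarrow> continuous_on UNIV g"
  shows "open {x. avg gs (indicator V :: 'a \<Rightarrow> real) x > c}"
proof (subst open_subopen, intro ballI)
  fix x assume x: "x \<in> {x. avg gs (indicator V :: 'a \<Rightarrow> real) x > c}"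
  define W where "W = (\<Inter>g\<in>{g\<in>set gs. g x \<in> V}. g -` V)"
  have "open W" unfolding W_def
    using assms by (intro open_INT) (auto intro: open_vimage)
  moreover have "x \<in> W" by (auto simp: W_def)
  moreover have "W \<subseteq> {x. avg gs (indicator V :: 'a \<Rightarrow> real) x > c}"
  proof
    fix y assume "y \<in> W"
    then have "g x \<in> V \<Longrightarrow> g y \<in> V" if "g \<in> set gs" for g
      using that by (auto simp: W_def)
    then have "avg gs (indicator V :: 'a \<Rightarrow> real) x \<le> avg gs (indicator V) y"
      by (intro avg_mono) (auto simp: indicator_def)
    then show "y \<in> {x. avg gs (indicator V :: 'a \<Rightarrow> real) x > c}" using x by simp
  qed
  ultimately show "\<exists>T. open T \<and> x \<in> T \<and> T \<subseteq> {x. avg gs (indicator V :: 'a \<Rightarrow> real) x > c}" by blast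
qed

lemma avg_of_real: "avg gs (\<lambda>x. complex_of_real (F x)) x = complex_of_real (avg gs F x)"
proof -
  have "(\<Sum>g\<leftarrow>gs. complex_of_real (F (g x))) = complex_of_real (\<Sum>g\<leftarrow>gs. F (g x))"
    by (induction gs) auto
  then show ?thesis by (simp add: avg_def scaleR_conv_of_real)
qed

text \<open>
  Start with a small open dense set and repeatedly add all points with more than half of their images
  in the current set. As long as the current set has measure \<open>v \<le> 1/8\<close>, on the added points the
  average of its indicator exceeds its mean by at least \<open>3/8\<close>, so by Chebyshev and contraction
  they have measure at most \<open>(v / 64) / (9 / 64) = v / 9\<close>; together with the starting set of measure
  at most \<open>1/16\<close> the bound \<open>1/8\<close> persists. A point outside the union keeps half of its images
  because it has only finitely many.
\<close>

lemma exists_robust_set: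
  fixes gs :: "(real ^ 'n \<Rightarrow> real ^ 'n) list"
  assumes gs_contr: "contracting_average gs"
  obtains P :: "(real ^ 'n) set" where "closed P" "interior P = {}" "periodic (\<lambda>x. x \<in> P)"
    "measure lebesgue (P \<inter> unit_cube) > 0" "\<And>x. x \<in> P \<Longrightarrow> (1 / 2 :: real) \<le> avg gs (indicator P) x"
proof -
  note gs = contracting_averageD(1,2)[OF gs_contr] and per = contracting_averageD(3)[OF gs_contr]
    and L2 = contracting_averageD(4)[OF gs_contr] and contr = contracting_averageD(5)[OF gs_contr]
  obtain U0 :: "(real ^ 'n) set" where U0: "open U0" "periodic (\<lambda>x. x \<in> U0)"
    "\<And>S. open S \<Longrightarrow> S \<noteq> {} \<Longrightarrow> S \<inter> U0 \<noteq> {}" "measure lebesgue (U0 \<inter> unit_cube) \<le> 1 / 16"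
  proof (rule exists_small_open_dense[of "1 / 16"])
    show "(0 :: real) < 1 / 16" by simp
  qed (rule that)
  define bad where "bad V = {x. avg gs (indicator V :: _ \<Rightarrow> real) x > 1 / 2}" for V
  define U where "U k = ((\<lambda>V. U0 \<union> bad V) ^^ k) U0" for k
  have U_0: "U 0 = U0" and U_Suc: "U (Suc k) = U0 \<union> bad (U k)" for k
    by (simp_all add: U_def)
  have op: "open (U k)" for k
  proof (induction k)
    case (Suc k)
    have "open (bad (U k))" unfolding bad_def
      using gs(2) iso_plus_continuous by (intro open_avg_indicator_gt Suc) blast
    then show ?case using U0(1) by (simp add: U_Suc open_Un)
  qed (simp add: U_0 U0)
  have pr: "periodic (\<lambda>x. x \<in> U k)" for k
  proof (induction k)
    case (Suc k)
    have "periodic (\<lambda>x. complex_of_real (indicator (U k) x))"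
      using Suc unfolding periodic_def indicator_def by simp
    from per[OF this] have "periodic (\<lambda>x. x \<in> bad (U k))"
      unfolding periodic_def bad_def avg_of_real by simp
    then show ?case using U0(2) by (simp add: U_Suc periodic_def)
  qed (simp add: U_0 U0)
  have inc: "U k \<subseteq> U (Suc k)" for k
  proof (induction k)
    case (Suc k)
    have "bad (U k) \<subseteq> bad (U (Suc k))"
      unfolding bad_def using avg_indicator_mono[OF Suc, of gs] by (auto intro: less_le_trans)
    then show ?case by (auto simp: U_Suc[of "Suc k"] U_Suc[of k])
  qed (auto simp: U_0 U_Suc)
  have fin: "S \<inter> unit_cube \<in> lmeasurable" if "open S" for S :: "(real ^ 'n) set"
    using that by (intro bounded_set_imp_lmeasurable bounded_Int) (auto simp: unit_cube_def)
  have small: "measure lebesgue (U k \<inter> unit_cube) \<le> 1 / 8" for k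
  proof (induction k)
    case 0
    then show ?case using U0(4) by (simp add: U_0)
  next
    case (Suc k)
    define v where "v = measure lebesgue (U k \<inter> unit_cube)"
    define F where "F x = complex_of_real (indicator (U k) x)" for x
    have v: "0 \<le> v" "v \<le> 1 / 8" using Suc by (auto simp: v_def)
    have pF: "periodic F" using pr[of k] unfolding periodic_def F_def indicator_def by simp
    have bo: "U k \<in> sets borel" "bad (U k) \<in> sets borel"
    proof -
      show "U k \<in> sets borel" using op by simp
      have "open (bad (U k))" unfolding bad_def
        using gs(2) iso_plus_continuous by (intro open_avg_indicator_gt op) blast
      then show "bad (U k) \<in> sets borel" by simp
    qed
    have mF: "F \<in> borel_measurable lebesgue"
      unfolding F_def using bo(1) by (intro measurable_completion) simp
    have LF: "cube_L2 F" using mF by (intro cube_L2_bounded[of _ 1]) (auto simp: F_def indicator_def)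
    have iv: "cube_integral (indicator (U k) :: _ \<Rightarrow> real) = v"
      using bo(1) by (simp add: v_def measure_restrict_space)
    have intF: "cube_integral F = complex_of_real v"
      unfolding F_def integral_complex_of_real iv ..
    have "(\<lambda>x. (cmod (F x))\<^sup>2) = (indicator (U k) :: _ \<Rightarrow> real)"
      by (auto simp: F_def indicator_def)
    then have sqF: "cube_norm_sq F = v" using iv by simp
    let ?T = "\<lambda>x. (cmod (avg gs F x - complex_of_real v))\<^sup>2"
    have le: "cube_integral ?T \<le> v / 64"
      using contr[OF pF LF] by (simp add: intF sqF)
    have LT: "cube_L2 (\<lambda>x. avg gs F x - complex_of_real v)"
      by (intro cube_L2_diff L2 pF LF cube_L2_const)
    have "9 / 64 * measure lebesgue (bad (U k) \<inter> unit_cube) = cube_integral (\<lambda>x. 9 / 64 * indicator (bad (U k)) x)"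
      using bo(2) by (simp add: measure_restrict_space)
    also have "\<dots> \<le> cube_integral ?T"
    proof (rule integral_mono)
      show "integrable cube_measure (\<lambda>x. 9 / 64 * indicator (bad (U k)) x :: real)"
        using bo(2) by (intro integrable_cube_bounded[where B = 1] measurable_completion) (auto simp: indicator_def)
      show "integrable cube_measure ?T" using LT by (simp add: cube_L2_def)
      show "9 / 64 * indicator (bad (U k)) x \<le> ?T x" for x
      proof (cases "x \<in> bad (U k)")
        case True
        have "?T x = (avg gs (indicator (U k)) x - v)\<^sup>2"
          unfolding F_def avg_of_real by (simp flip: of_real_diff)
        moreover have "(3 / 8)\<^sup>2 \<le> (avg gs (indicator (U k)) x - v)\<^sup>2"
          using True v by (intro power_mono) (auto simp: bad_def)
        ultimately show ?thesis using True by (simp add: power2_eq_square)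
      qed simp
    qed
    finally have b: "measure lebesgue (bad (U k) \<inter> unit_cube) \<le> v / 9" using le by simp
    have "measure lebesgue (U (Suc k) \<inter> unit_cube) = measure lebesgue ((U0 \<inter> unit_cube) \<union> (bad (U k) \<inter> unit_cube))"
      by (simp add: U_Suc Int_Un_distrib2)
    also have "\<dots> \<le> measure lebesgue (U0 \<inter> unit_cube) + measure lebesgue (bad (U k) \<inter> unit_cube)"
      using bo(2) U0(1) by (intro measure_Un_le) auto
    also have "\<dots> \<le> 1 / 8" using U0(4) b v by simp
    finally show ?case .
  qed
  define V where "V = (\<Union>k. U k)"
  have oV: "open V" using op by (auto simp: V_def)
  have mV: "measure lebesgue (V \<inter> unit_cube) \<le> 1 / 8"
  proof -
    have "(\<lambda>k. measure lebesgue (U k \<inter> unit_cube)) \<longlonglongrightarrow> measure lebesgue (\<Union>k. U k \<inter> unit_cube)"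
    proof (rule Lim_measure_incseq)
      show "range (\<lambda>k. U k \<inter> unit_cube) \<subseteq> sets lebesgue" using fin[OF op] by auto
      show "incseq (\<lambda>k. U k \<inter> unit_cube)" using inc by (intro incseq_SucI) blast
      have "(\<Union>k. U k \<inter> unit_cube) = V \<inter> unit_cube" by (auto simp: V_def)
      then show "emeasure lebesgue (\<Union>k. U k \<inter> unit_cube) \<noteq> \<infinity>"
        using fmeasurableD2[OF fin[OF oV]] by simp
    qed
    moreover have "(\<Union>k. U k \<inter> unit_cube) = V \<inter> unit_cube" by (auto simp: V_def)
    ultimately show ?thesis using small by (intro LIMSEQ_le_const2) auto
  qed
  show thesis
  proof
    show "closed (- V)" by (rule closed_Compl[OF oV])
    show "interior (- V) = {}"
    proof (rule ccontr)
      assume "interior (- V) \<noteq> {}"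
      then have "interior (- V) \<inter> U0 \<noteq> {}" by (intro U0(3)) auto
      moreover have "U0 \<subseteq> V" using U_0 by (auto simp: V_def)
      ultimately show False using interior_subset by blast
    qed
    show "periodic (\<lambda>x. x \<in> - V)" using pr by (simp add: periodic_def V_def)
    have "V \<in> sets lebesgue" using oV by simp
    moreover from this have "- V \<in> sets lebesgue" using sets.compl_sets[of V lebesgue] by (simp add: Compl_eq_Diff_UNIV)
    ultimately have "measure lebesgue ((V \<inter> unit_cube) \<union> (- V \<inter> unit_cube)) \<le> measure lebesgue (V \<inter> unit_cube) + measure lebesgue (- V \<inter> unit_cube)"
      by (intro measure_Un_le sets.Int) auto
    moreover have "(V \<inter> unit_cube) \<union> (- V \<inter> unit_cube) = unit_cube" by auto
    ultimately have "measure lebesgue (unit_cube :: (real ^ 'n) set) \<le> measure lebesgue (V \<inter> unit_cube) + measure lebesgue (- V \<inter> unit_cube)"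
      by simp
    then show "measure lebesgue (- V \<inter> unit_cube) > 0"
      using mV by (simp add: measure_unit_cube)
    fix x assume x: "x \<in> - V"
    have "\<exists>k. \<forall>g\<in>set gs. g x \<in> V \<longrightarrow> g x \<in> U k"
    proof -
      have "\<forall>g\<in>set gs. \<exists>k. g x \<in> V \<longrightarrow> g x \<in> U k" by (auto simp: V_def)
      then obtain k where k: "\<And>g. g \<in> set gs \<Longrightarrow> g x \<in> V \<Longrightarrow> g x \<in> U (k g)" by metis
      have mono: "U i \<subseteq> U j" if "i \<le> j" for i j using inc that by (rule lift_Suc_mono_le)
      have "g x \<in> U (Max (k ` set gs))" if "g \<in> set gs" "g x \<in> V" for g
        using k[OF that] mono[of "k g" "Max (k ` set gs)"] that by auto
      then show ?thesis by blast
    qed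
    then obtain k where k: "\<And>g. g \<in> set gs \<Longrightarrow> g x \<in> V \<Longrightarrow> g x \<in> U k" by blast
    have "x \<notin> U (Suc k)" using x by (auto simp: V_def)
    then have le: "avg gs (indicator (U k)) x \<le> (1 / 2 :: real)" by (auto simp: U_Suc bad_def)
    have "(\<Sum>g\<leftarrow>gs. indicator (- V) (g x) :: real) \<ge> (\<Sum>g\<leftarrow>gs. 1 - indicator (U k) (g x))"
      using k by (intro sum_list_mono) (auto simp: indicator_def)
    also have "(\<Sum>g\<leftarrow>gs. 1 - indicator (U k) (g x) :: real) = real (length gs) - (\<Sum>g\<leftarrow>gs. indicator (U k) (g x))"
      by (simp add: sum_list_subtractf sum_list_triv)
    finally have "(real (length gs) - (\<Sum>g\<leftarrow>gs. indicator (U k) (g x))) / real (length gs) \<le> avg gs (indicator (- V)) x"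
      by (simp add: avg_def divide_inverse mult.commute mult_left_mono)
    moreover have "(real (length gs) - (\<Sum>g\<leftarrow>gs. indicator (U k) (g x))) / real (length gs) = 1 - avg gs (indicator (U k)) x"
      using gs(1) by (simp add: avg_def field_simps)
    ultimately show "(1 / 2 :: real) \<le> avg gs (indicator (- V)) x" using le by simp
  qed
qed

section \<open>From a Poincare inequality to spectral gap and expansion\<close>

text \<open>
  As long as the measure of the current set is below \<open>(1 - \<eta>)\<close> times that of \<open>X\<close>, a step multiplies
  it by at least \<open>1 + \<kappa> \<eta>\<close>. Above this threshold a step still does not decrease the measure.
\<close>

lemma domain_of_expansionI:
  fixes X :: "(real ^ 'n) set"
  assumes X: "X \<in> lmeasurable" "measure lebesgue X > 0"
    and R: "finite R" "R \<subseteq> iso_plus" and \<kappa>: "\<kappa> > 0"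
    and step: "\<And>Y. Y \<in> sets lebesgue \<Longrightarrow> Y \<subseteq> X \<Longrightarrow>
      measure lebesgue Y + \<kappa> * measure lebesgue Y * (1 - measure lebesgue Y / measure lebesgue X)
        \<le> measure lebesgue ((\<Union>g\<in>R. g ` Y) \<inter> X)"
  shows "domain_of_expansion iso_plus X"
  unfolding domain_of_expansion_def
proof (intro conjI X allI impI)
  fix \<eta> :: real assume \<eta>: "\<eta> > 0"
  let ?M = "measure lebesgue X"
  obtain k where k: "1 / \<eta> < (1 + \<kappa> * \<eta>) ^ k"
    using real_arch_pow[of "1 + \<kappa> * \<eta>" "1 / \<eta>"] \<kappa> \<eta> by auto
  (* W j consists of the words of length j in R. Intersecting with X after every letter only makes
     the set smaller, so the bound for the iterated step applies to the words. *)
  define W where "W j = ((\<lambda>S. (\<lambda>(g, h). g \<circ> h) ` (R \<times> S)) ^^ j) {id :: real ^ 'n \<Rightarrow> real ^ 'n}" for j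
  have W: "finite (W j) \<and> W j \<subseteq> iso_plus" for j
  proof (induction j)
    case (Suc j)
    then show ?case using R by (auto simp: W_def intro: iso_plus_comp)
  qed (simp add: W_def iso_plus_id)
  have main: "min ((1 - \<eta>) * ?M) ((1 + \<kappa> * \<eta>) ^ j * measure lebesgue Y)
      \<le> measure lebesgue ((\<Union>g\<in>W j. g ` Y) \<inter> X) \<and> (\<Union>g\<in>W j. g ` Y) \<inter> X \<in> sets lebesgue"
    if Y: "Y \<in> sets lebesgue" "Y \<subseteq> X" for Y j
  proof (induction j)
    case 0
    have "Y \<inter> X = Y" using Y by auto
    then show ?case using Y by (simp add: W_def)
  next
    case (Suc j)
    define Z where "Z = (\<Union>g\<in>W j. g ` Y) \<inter> X"
    define Z' where "Z' = (\<Union>g\<in>W (Suc j). g ` Y) \<inter> X"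
    have Z: "Z \<in> sets lebesgue" "Z \<subseteq> X" using Suc by (auto simp: Z_def)
    have Z': "Z' \<in> sets lebesgue"
      unfolding Z'_def using W[of "Suc j"] X Y
      by (intro sets.Int sets.finite_UN) (auto intro: iso_plus_image_sets)
    let ?a = "measure lebesgue Z"
    have Zfin: "Z \<in> lmeasurable" using Z X(1) by (metis fmeasurableI2)
    have aM: "?a \<le> ?M" using Z X(1) by (intro measure_mono_fmeasurable) auto
    have a0: "0 \<le> ?a" by simp
    have "(\<Union>g\<in>R. g ` Z) \<inter> X \<subseteq> Z'"
      unfolding Z_def Z'_def W_def by (force simp: image_iff)
    then have "measure lebesgue ((\<Union>g\<in>R. g ` Z) \<inter> X) \<le> measure lebesgue Z'"
      using R Z Z' X by (intro measure_mono_fmeasurable sets.Int sets.finite_UN)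
        (auto intro: iso_plus_image_sets fmeasurableI2[of X] simp: Z'_def)
    then have grow: "?a + \<kappa> * ?a * (1 - ?a / ?M) \<le> measure lebesgue Z'"
      using step[OF Z] by linarith
    have "min ((1 - \<eta>) * ?M) ((1 + \<kappa> * \<eta>) ^ Suc j * measure lebesgue Y) \<le> measure lebesgue Z'"
    proof (cases "(1 - \<eta>) * ?M \<le> ?a")
      case True
      have "?a / ?M \<le> 1" using aM X(2) by simp
      then have "0 \<le> \<kappa> * ?a * (1 - ?a / ?M)" using \<kappa> a0 by (intro mult_nonneg_nonneg) auto
      then show ?thesis using grow True by linarith
    next
      case False
      then have "?a / ?M < 1 - \<eta>" using X(2) by (simp add: field_simps)
      then have "\<kappa> * ?a * \<eta> \<le> \<kappa> * ?a * (1 - ?a / ?M)" using \<kappa> a0 by (intro mult_left_mono) auto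
      then have "(1 + \<kappa> * \<eta>) * ?a \<le> measure lebesgue Z'" using grow by (simp add: algebra_simps)
      moreover have "(1 + \<kappa> * \<eta>) ^ j * measure lebesgue Y \<le> ?a"
        using Suc False unfolding Z_def[symmetric] by (auto simp: min_def split: if_splits)
      then have "(1 + \<kappa> * \<eta>) * ((1 + \<kappa> * \<eta>) ^ j * measure lebesgue Y) \<le> (1 + \<kappa> * \<eta>) * ?a"
        using \<kappa> \<eta> by (intro mult_left_mono) auto
      ultimately show ?thesis by (simp add: mult.assoc)
    qed
    then show ?case using Z' by (simp add: Z'_def)
  qed
  show "\<exists>R. finite R \<and> R \<subseteq> iso_plus \<and>
       (\<forall>Y\<in>sets lebesgue. Y \<subseteq> X \<longrightarrow>
          min ((1 - \<eta>) * ?M) (measure lebesgue Y / \<eta>) \<le> measure lebesgue ((\<Union>g\<in>R. g ` Y) \<inter> X))"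
  proof (intro exI[of _ "W k"] conjI ballI impI)
    fix Y assume Y: "Y \<in> sets lebesgue" "Y \<subseteq> X"
    have "1 / \<eta> * measure lebesgue Y \<le> (1 + \<kappa> * \<eta>) ^ k * measure lebesgue Y"
      using k by (intro mult_right_mono) auto
    then show "min ((1 - \<eta>) * ?M) (measure lebesgue Y / \<eta>) \<le> measure lebesgue ((\<Union>g\<in>W k. g ` Y) \<inter> X)"
      using main[OF Y, of k] by (auto simp: min_def split: if_splits)
  qed (use W in auto)
qed

text \<open>
  Only pairs with both points in \<open>X\<close> count. This makes the inequality strong enough for expansion,
  where mass moved out of \<open>X\<close> must not contribute.
\<close>

definition inner_energy :: "('a::euclidean_space) set \<Rightarrow> ('a \<Rightarrow> 'a) \<Rightarrow> ('a \<Rightarrow> complex) \<Rightarrow> 'a \<Rightarrow> real" where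
  "inner_energy X g f x = indicator X x * indicator X (g x) * (cmod (f (g x) - f x))\<^sup>2"

lemma inner_energy_nonneg: "0 \<le> inner_energy X g f x"
  by (simp add: inner_energy_def)

lemma L2_diff_comp:
  fixes f :: "real ^ 'n \<Rightarrow> complex"
  assumes f: "f \<in> L2" and g: "g \<in> iso_plus"
  shows "integrable lebesgue (\<lambda>x. (cmod (f (g x) - f x))\<^sup>2)"
proof -
  have m: "f \<in> borel_measurable lebesgue" and i: "integrable lebesgue (\<lambda>x. (cmod (f x))\<^sup>2)"
    using f by (auto simp: L2_def)
  have mg: "(\<lambda>x. f (g x)) \<in> borel_measurable lebesgue"
    by (rule measurable_iso_plus_comp[OF g m])
  have ig: "integrable lebesgue (\<lambda>x. (cmod (f (g x)))\<^sup>2)"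
    by (rule integrable_iso_plus[OF g i])
  have "integrable lebesgue (\<lambda>x. 2 * (cmod (f (g x)))\<^sup>2 + 2 * (cmod (f x))\<^sup>2)"
    using i ig by auto
  then show ?thesis
  proof (rule Bochner_Integration.integrable_bound)
    show "(\<lambda>x. (cmod (f (g x) - f x))\<^sup>2) \<in> borel_measurable lebesgue"
      using m mg by measurable
    show "AE x in lebesgue. norm ((cmod (f (g x) - f x))\<^sup>2) \<le> norm (2 * (cmod (f (g x)))\<^sup>2 + 2 * (cmod (f x))\<^sup>2)"
      using cmod_add_sq[of "f (g x)" "- f x" for x] by (intro AE_I2) simp
  qed
qed

lemma integrable_inner_energy:
  fixes f :: "real ^ 'n \<Rightarrow> complex"
  assumes f: "f \<in> L2" and g: "g \<in> iso_plus" and X: "X \<in> sets lebesgue"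
  shows "integrable lebesgue (inner_energy X g f)"
  using L2_diff_comp[OF f g]
proof (rule Bochner_Integration.integrable_bound)
  have m: "f \<in> borel_measurable lebesgue" using f by (auto simp: L2_def)
  have "(\<lambda>x. indicator X (g x) :: real) \<in> borel_measurable lebesgue"
    by (rule measurable_iso_plus_comp[OF g borel_measurable_indicator[OF X]])
  then show "inner_energy X g f \<in> borel_measurable lebesgue"
    unfolding inner_energy_def[abs_def] using X m measurable_iso_plus_comp[OF g m] by measurable
  show "AE x in lebesgue. norm (inner_energy X g f x) \<le> norm ((cmod (f (g x) - f x))\<^sup>2)"
    by (intro AE_I2) (auto simp: inner_energy_def indicator_def)
qed

text \<open>
  The action on functions uses inverses, so the finite set for the gap consists of the inverses of
  the isometries in the Poincare inequality.
\<close>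

lemma local_spectral_gapI:
  fixes X :: "(real ^ 'n) set"
  assumes X: "X \<in> lmeasurable" "measure lebesgue X > 0"
    and Q: "finite Q" "Q \<subseteq> iso_plus"
    and poincare: "\<And>f. f \<in> L2 \<Longrightarrow> set_lebesgue_integral lebesgue X f = 0 \<Longrightarrow>
      set_lebesgue_integral lebesgue X (\<lambda>x. (cmod (f x))\<^sup>2) \<le> 4 * (\<Sum>g\<in>Q. integral\<^sup>L lebesgue (inner_energy X g f))"
  shows "local_spectral_gap iso_plus X"
  unfolding local_spectral_gap_def
proof (intro conjI X exI[of _ "inv ` Q"] exI[of _ 2] ballI impI)
  show "finite (inv ` Q)" "inv ` Q \<subseteq> iso_plus" "(0 :: real) < 2"
    using Q iso_plus_inv by auto
  fix f :: "real ^ 'n \<Rightarrow> complex" assume f: "f \<in> L2" and zero: "set_lebesgue_integral lebesgue X f = 0"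
  define b where "b g = integral\<^sup>L lebesgue (inner_energy X g f)" for g
  have b: "0 \<le> b g" for g unfolding b_def by (rule integral_nonneg_AE) (simp add: inner_energy_nonneg)
  have b_le: "sqrt (b g) \<le> norm2_on X (\<lambda>x. act (inv g) f x - f x)" if "g \<in> Q" for g
  proof -
    have g: "g \<in> iso_plus" using that Q by auto
    have "act (inv g) f = (\<lambda>x. f (g x))"
      by (simp add: act_def inv_inv_eq[OF iso_plus_bij[OF g]])
    moreover have "b g \<le> set_lebesgue_integral lebesgue X (\<lambda>x. (cmod (f (g x) - f x))\<^sup>2)"
      unfolding b_def set_lebesgue_integral_def
    proof (rule integral_mono)
      show "integrable lebesgue (inner_energy X g f)"
        by (rule integrable_inner_energy[OF f g]) (simp add: X fmeasurableD)
      show "integrable lebesgue (\<lambda>x. indicator X x *\<^sub>R (cmod (f (g x) - f x))\<^sup>2)"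
        using integrable_mult_indicator[OF fmeasurableD[OF X(1)] L2_diff_comp[OF f g]] by simp
      show "inner_energy X g f x \<le> indicator X x *\<^sub>R (cmod (f (g x) - f x))\<^sup>2" for x
        by (auto simp: inner_energy_def indicator_def)
    qed
    ultimately show ?thesis by (simp add: norm2_on_def)
  qed
  have "norm2_on X f \<le> sqrt (4 * (\<Sum>g\<in>Q. b g))"
    unfolding norm2_on_def b_def using poincare[OF f zero] by simp
  also have "\<dots> = 2 * sqrt (\<Sum>g\<in>Q. b g)"
    by (simp add: real_sqrt_mult)
  also have "sqrt (\<Sum>g\<in>Q. b g) \<le> (\<Sum>g\<in>Q. sqrt (b g))"
    using Q(1)
  proof (induction Q rule: finite_induct)
    case (insert g Q)
    have "sqrt (b g + (\<Sum>g\<in>Q. b g)) \<le> sqrt (b g) + sqrt (\<Sum>g\<in>Q. b g)"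
      by (intro sqrt_add_le_add_sqrt b sum_nonneg)
    then show ?case using insert by simp
  qed simp
  also have "(\<Sum>g\<in>Q. sqrt (b g)) \<le> (\<Sum>g\<in>Q. norm2_on X (\<lambda>x. act (inv g) f x - f x))"
    by (rule sum_mono) (rule b_le)
  also have "\<dots> = (\<Sum>h\<in>inv ` Q. norm2_on X (\<lambda>x. act h f x - f x))"
  proof (subst sum.reindex)
    show "inj_on inv Q"
      using Q iso_plus_bij inv_inv_eq by (intro inj_on_inverseI[of _ inv]) blast
  qed simp
  finally show "norm2_on X f \<le> 2 * (\<Sum>h\<in>inv ` Q. norm2_on X (\<lambda>x. act h f x - f x))"
    by simp
qed

text \<open>
  For the centred indicator of \<open>Y\<close>, a point contributes to the energy only if exactly one of \<open>x\<close> and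
  \<open>g x\<close> lies in \<open>Y\<close>; the other one is then a point of \<open>X\<close> newly reached from \<open>Y\<close> by \<open>g\<close> or its inverse.
\<close>

lemma expansion_of_poincare:
  fixes X :: "(real ^ 'n) set"
  assumes X: "X \<in> lmeasurable" "measure lebesgue X > 0"
    and Q: "finite Q" "Q \<subseteq> iso_plus"
    and poincare: "\<And>f. f \<in> L2 \<Longrightarrow> set_lebesgue_integral lebesgue X f = 0 \<Longrightarrow>
      set_lebesgue_integral lebesgue X (\<lambda>x. (cmod (f x))\<^sup>2) \<le> 4 * (\<Sum>g\<in>Q. integral\<^sup>L lebesgue (inner_energy X g f))"
  shows "domain_of_expansion iso_plus X"
proof (rule domain_of_expansionI[OF X])
  define R where "R = insert id (Q \<union> inv ` Q)"
  have R: "finite R" "R \<subseteq> iso_plus" "id \<in> R"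
    using Q iso_plus_inv iso_plus_id by (auto simp: R_def)
  show "finite R" "R \<subseteq> iso_plus" by (fact R)+
  define \<kappa> where "\<kappa> = 1 / (8 * real (card Q) + 1)"
  show "\<kappa> > 0" by (simp add: \<kappa>_def add_nonneg_pos)
  let ?M = "measure lebesgue X"
  have Xs: "X \<in> sets lebesgue" using X(1) by (rule fmeasurableD)
  fix Y assume Y: "Y \<in> sets lebesgue" "Y \<subseteq> X"
  have Yl: "Y \<in> lmeasurable" using fmeasurableI2[OF X(1) Y(2,1)] .
  define y where "y = measure lebesgue Y"
  define m where "m = y / ?M"
  define B where "B = (\<Union>g\<in>R. g ` Y) \<inter> X"
  have Bs: "B \<in> sets lebesgue"
    unfolding B_def using R Y Xs by (intro sets.Int sets.finite_UN) (auto intro: iso_plus_image_sets)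
  have Bl: "B \<in> lmeasurable" using fmeasurableI2[OF X(1) _ Bs] by (auto simp: B_def)
  have YB: "Y \<subseteq> B" using Y(2) R(3) by (auto simp: B_def)
  define D where "D = B - Y"
  have Dl: "D \<in> lmeasurable" unfolding D_def using Bl Yl by (rule fmeasurable.Diff)
  have mD: "measure lebesgue D = measure lebesgue B - y"
    unfolding D_def y_def using Bl Yl YB by (intro measurable_measure_Diff) auto
  define f where "f x = complex_of_real (indicator Y x - m * indicator X x)" for x
  have iX: "integrable lebesgue (indicator X :: _ \<Rightarrow> real)" "integrable lebesgue (indicator Y :: _ \<Rightarrow> real)"
    using X(1) Yl by (auto simp: fmeasurable_def)
  have fm: "f \<in> borel_measurable lebesgue"
    unfolding f_def using Xs Y(1) by measurable
  have sq: "(cmod (f x))\<^sup>2 = (1 - 2 * m) * indicator Y x + m\<^sup>2 * indicator X x" for x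
    unfolding f_def norm_of_real using Y(2) by (auto simp: indicator_def power2_eq_square algebra_simps)
  have fL2: "f \<in> L2"
    unfolding L2_def using fm iX by (auto simp: sq)
  have "set_lebesgue_integral lebesgue X f = integral\<^sup>L lebesgue f"
    unfolding set_lebesgue_integral_def f_def using Y(2)
    by (intro Bochner_Integration.integral_cong refl) (auto simp: indicator_def)
  also have "\<dots> = complex_of_real (y - m * ?M)"
    unfolding f_def integral_complex_of_real using iX Xs Y(1) by (simp add: y_def)
  finally have zero: "set_lebesgue_integral lebesgue X f = 0"
    using X(2) by (simp add: m_def)
  have "set_lebesgue_integral lebesgue X (\<lambda>x. (cmod (f x))\<^sup>2) = integral\<^sup>L lebesgue (\<lambda>x. (1 - 2 * m) * indicator Y x + m\<^sup>2 * indicator X x)"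
    unfolding set_lebesgue_integral_def sq using Y(2)
    by (intro Bochner_Integration.integral_cong refl) (auto simp: indicator_def)
  also have "\<dots> = (1 - 2 * m) * y + m\<^sup>2 * ?M"
    using iX Xs Y(1) by (simp add: y_def)
  also have "\<dots> = y * (1 - y / ?M)"
    using X(2) by (simp add: m_def field_simps power2_eq_square)
  finally have lhs: "set_lebesgue_integral lebesgue X (\<lambda>x. (cmod (f x))\<^sup>2) = y * (1 - y / ?M)" .
  have en: "integral\<^sup>L lebesgue (inner_energy X g f) \<le> 2 * measure lebesgue D" if gQ: "g \<in> Q" for g
  proof -
    have g: "g \<in> iso_plus" using gQ Q by auto
    have iD: "integrable lebesgue (indicator D :: _ \<Rightarrow> real)" using Dl by (auto simp: fmeasurable_def)
    have iDg: "integrable lebesgue (\<lambda>x. indicator D (g x) :: real)"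
      by (rule integrable_iso_plus[OF g iD])
    have "integral\<^sup>L lebesgue (inner_energy X g f) \<le> integral\<^sup>L lebesgue (\<lambda>x. indicator D x + indicator D (g x))"
    proof (rule integral_mono)
      show "integrable lebesgue (inner_energy X g f)" by (rule integrable_inner_energy[OF fL2 g Xs])
      show "integrable lebesgue (\<lambda>x. indicator D x + indicator D (g x) :: real)" using iD iDg by auto
      fix x
      show "inner_energy X g f x \<le> indicator D x + indicator D (g x)"
      proof (cases "x \<in> X \<and> g x \<in> X \<and> (x \<in> Y \<longleftrightarrow> g x \<notin> Y)")
        case False
        then have "inner_energy X g f x = 0" by (auto simp: inner_energy_def f_def indicator_def)
        then show ?thesis by simp
      next
        case True
        have one: "inner_energy X g f x \<le> 1"
          using True by (auto simp: inner_energy_def f_def indicator_def norm_power)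
        have "x \<in> D \<or> g x \<in> D"
        proof (cases "x \<in> Y")
          case xY: True
          then have "g x \<in> g ` Y" "g \<in> R" using gQ by (auto simp: R_def)
          then show ?thesis using True xY by (auto simp: D_def B_def)
        next
          case xY: False
          then have "g x \<in> Y" using True by blast
          moreover have "inv g (g x) = x"
            using iso_plus_bij[OF g] by (simp add: bij_is_inj)
          ultimately have "x \<in> inv g ` Y" by (metis imageI)
          moreover have "inv g \<in> R" using gQ by (auto simp: R_def)
          ultimately show ?thesis using True xY by (auto simp: D_def B_def)
        qed
        then show ?thesis using one by (auto simp: indicator_def)
      qed
    qed
    also have "\<dots> = integral\<^sup>L lebesgue (indicator D :: _ \<Rightarrow> real) + integral\<^sup>L lebesgue (\<lambda>x. indicator D (g x) :: real)"
      using iD iDg by (rule Bochner_Integration.integral_add)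
    also have "integral\<^sup>L lebesgue (\<lambda>x. indicator D (g x) :: real) = integral\<^sup>L lebesgue (indicator D)"
      using iD by (intro integral_iso_plus[OF g]) auto
    also have "integral\<^sup>L lebesgue (indicator D :: _ \<Rightarrow> real) = measure lebesgue D"
      using Dl by (simp add: fmeasurableD)
    finally show ?thesis by simp
  qed
  have "y * (1 - y / ?M) \<le> 4 * (\<Sum>g\<in>Q. integral\<^sup>L lebesgue (inner_energy X g f))"
    using poincare[OF fL2 zero] unfolding lhs .
  also have "\<dots> \<le> 4 * (\<Sum>g\<in>Q. 2 * measure lebesgue D)"
    using en by (intro mult_left_mono sum_mono) auto
  also have "\<dots> \<le> (8 * real (card Q) + 1) * measure lebesgue D"
    by (simp add: distrib_right)
  finally have "\<kappa> * (y * (1 - y / ?M)) \<le> \<kappa> * ((8 * real (card Q) + 1) * measure lebesgue D)"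
    using \<open>\<kappa> > 0\<close> by (intro mult_left_mono) auto
  also have "\<dots> = measure lebesgue D"
    by (simp add: \<kappa>_def field_simps add_nonneg_pos)
  finally show "measure lebesgue Y + \<kappa> * measure lebesgue Y * (1 - measure lebesgue Y / ?M)
      \<le> measure lebesgue ((\<Union>g\<in>R. g ` Y) \<inter> X)"
    unfolding mD y_def B_def by (simp add: mult.assoc)
qed

section \<open>The Poincare inequality on the robust set\<close>

lemma measurable_frac: "(\<lambda>y :: real ^ 'n. y - floor_vec y) \<in> lebesgue \<rightarrow>\<^sub>M lebesgue"
proof (rule measurableI)
  fix A :: "(real ^ 'n) set" assume A: "A \<in> sets lebesgue"
  define c where "c h = (\<chi> i. real_of_int (h i))" for h :: "'n \<Rightarrow> int"
  have eq: "(\<lambda>y. y - floor_vec y) -` A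
      = (\<Union>h. {y. \<forall>i. \<lfloor>y $ i\<rfloor> = h i} \<inter> (\<lambda>y. y + - c h) -` A)"
    by (auto simp: floor_vec_def c_def)
  have m1: "{y :: real ^ 'n. \<forall>i. \<lfloor>y $ i\<rfloor> = h i} \<in> sets lebesgue" for h
  proof -
    have "{y \<in> space borel. \<forall>i. \<lfloor>y $ i\<rfloor> = h i} \<in> sets (borel :: (real ^ 'n) measure)"
      by measurable
    then show ?thesis by simp
  qed
  have m2: "(\<lambda>y. y + - c h) -` A \<in> sets lebesgue" for h
    using measurable_sets[OF iso_plus_measurable[OF iso_plus_translation] A, of "- c h"] by simp
  have "(\<lambda>y :: real ^ 'n. y - floor_vec y) -` A \<in> sets lebesgue"
    unfolding eq by (intro sets.countable_UN'' sets.Int m1 m2) auto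
  then show "(\<lambda>y :: real ^ 'n. y - floor_vec y) -` A \<inter> space lebesgue \<in> sets lebesgue"
    by simp
qed simp

lemma floor_vec_add_lattice:
  assumes "lattice_vec z"
  shows "floor_vec (x + z) = floor_vec x + z"
proof -
  have "floor_vec (x + z) $ i = (floor_vec x + z) $ i" for i
  proof -
    obtain n :: int where "z $ i = of_int n"
      using assms by (auto simp: lattice_vec_def elim: Ints_cases)
    then show ?thesis by (simp add: floor_vec_def)
  qed
  then show ?thesis by (simp add: vec_eq_iff)
qed

text \<open>
  Expand the square for the images that stay in \<open>P\<close>. Half of the images do, which gives
  \<open>1/2 |F x|\<^sup>2\<close>; the cross term is a multiple of the average of \<open>F\<close> over all images, because \<open>F\<close>
  vanishes off \<open>P\<close>, and \<open>2 a b \<le> 8 a\<^sup>2 + b\<^sup>2 / 8\<close> bounds it by eight times the squared average and \<open>1/8 |F x|\<^sup>2\<close>.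
\<close>

lemma pointwise_energy_bound:
  fixes F :: "'a \<Rightarrow> complex"
  assumes gs: "gs \<noteq> []" and off: "\<And>y. y \<notin> P \<Longrightarrow> F y = 0"
    and half: "x \<in> P \<Longrightarrow> (1 / 2 :: real) \<le> avg gs (indicator P) x"
  shows "3 / 8 * (cmod (F x))\<^sup>2 - 8 * (cmod (avg gs F x))\<^sup>2
    \<le> avg gs (\<lambda>y. indicator P x * indicator P y * (cmod (F y - F x))\<^sup>2) x"
proof (cases "x \<in> P")
  case False
  have "(\<Sum>g\<leftarrow>gs. indicator P x * indicator P (g x) * (cmod (F (g x) - F x))\<^sup>2) = 0"
    using False by (simp add: sum_list_triv)
  then show ?thesis using off[OF False] by (simp add: avg_def)
next
  case True
  define M where "M = real (length gs)"
  have M: "M > 0" using gs by (simp add: M_def)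
  let ?s = "avg gs F x"
  have g1: "indicator P y * (cmod (F x))\<^sup>2 - 2 * Re (F y * cnj (F x)) \<le> indicator P y * (cmod (F y - F x))\<^sup>2" for y
  proof (cases "y \<in> P")
    case True
    have "(cmod (F y - F x))\<^sup>2 = (cmod (F y))\<^sup>2 + (cmod (F x))\<^sup>2 - 2 * Re (F y * cnj (F x))"
      unfolding cmod_power2 by (simp add: power2_eq_square algebra_simps)
    then show ?thesis using True by simp
  qed (simp add: off)
  have "(\<Sum>g\<leftarrow>gs. indicator P (g x) * (cmod (F x))\<^sup>2 - 2 * Re (F (g x) * cnj (F x)))
      \<le> (\<Sum>g\<leftarrow>gs. indicator P x * indicator P (g x) * (cmod (F (g x) - F x))\<^sup>2)"
    using g1 True by (intro sum_list_mono) simp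
  also have "(\<Sum>g\<leftarrow>gs. indicator P (g x) * (cmod (F x))\<^sup>2 - 2 * Re (F (g x) * cnj (F x)))
      = (\<Sum>g\<leftarrow>gs. indicator P (g x)) * (cmod (F x))\<^sup>2 - 2 * Re ((\<Sum>g\<leftarrow>gs. F (g x)) * cnj (F x))"
    by (induction gs) (simp_all add: algebra_simps)
  finally have "((\<Sum>g\<leftarrow>gs. indicator P (g x)) * (cmod (F x))\<^sup>2 - 2 * Re ((\<Sum>g\<leftarrow>gs. F (g x)) * cnj (F x))) / M
      \<le> (\<Sum>g\<leftarrow>gs. indicator P x * indicator P (g x) * (cmod (F (g x) - F x))\<^sup>2) / M"
    using M by (intro divide_right_mono) auto
  also have "\<dots> = avg gs (\<lambda>y. indicator P x * indicator P y * (cmod (F y - F x))\<^sup>2) x"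
    by (simp add: avg_def M_def divide_inverse mult.commute)
  also have "((\<Sum>g\<leftarrow>gs. indicator P (g x)) * (cmod (F x))\<^sup>2 - 2 * Re ((\<Sum>g\<leftarrow>gs. F (g x)) * cnj (F x))) / M
      = avg gs (indicator P) x * (cmod (F x))\<^sup>2 - 2 * Re (?s * cnj (F x))"
    using M by (simp add: avg_def M_def field_simps)
  finally have main: "avg gs (indicator P) x * (cmod (F x))\<^sup>2 - 2 * Re (?s * cnj (F x))
      \<le> avg gs (\<lambda>y. indicator P x * indicator P y * (cmod (F y - F x))\<^sup>2) x" .
  have "1 / 2 * (cmod (F x))\<^sup>2 \<le> avg gs (indicator P) x * (cmod (F x))\<^sup>2"
    using half[OF True] by (intro mult_right_mono) auto
  moreover have "2 * Re (?s * cnj (F x)) \<le> 8 * (cmod ?s)\<^sup>2 + 1 / 8 * (cmod (F x))\<^sup>2"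
  proof -
    have "Re (?s * cnj (F x)) \<le> cmod ?s * cmod (F x)"
      using complex_Re_le_cmod[of "?s * cnj (F x)"] by (simp add: norm_mult)
    moreover have "0 \<le> (8 * cmod ?s - cmod (F x))\<^sup>2 / 8" by simp
    then have "2 * (cmod ?s * cmod (F x)) \<le> 8 * (cmod ?s)\<^sup>2 + 1 / 8 * (cmod (F x))\<^sup>2"
      by (simp add: power2_eq_square algebra_simps)
    ultimately show ?thesis by linarith
  qed
  ultimately show ?thesis using main by linarith
qed

text \<open>
  Integrating \<open>pointwise_energy_bound\<close> over the cube and using the contraction gives the factor
  \<open>3/8 - 8/64 = 1/4\<close>. The isometries are the given ones followed by the finitely many lattice
  translations that bring images of the cube back into it.
\<close>

lemma robust_poincare:
  fixes gs :: "(real ^ 'n \<Rightarrow> real ^ 'n) list"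
  assumes gs_contr: "contracting_average gs"
    and P: "closed P" "periodic (\<lambda>x. x \<in> P)" "\<And>x. x \<in> P \<Longrightarrow> (1 / 2 :: real) \<le> avg gs (indicator P) x"
  obtains Q where "finite Q" "Q \<subseteq> iso_plus"
    "\<And>f. f \<in> L2 \<Longrightarrow> set_lebesgue_integral lebesgue (P \<inter> unit_cube) f = 0 \<Longrightarrow>
      set_lebesgue_integral lebesgue (P \<inter> unit_cube) (\<lambda>x. (cmod (f x))\<^sup>2)
        \<le> 4 * (\<Sum>g\<in>Q. integral\<^sup>L lebesgue (inner_energy (P \<inter> unit_cube) g f))"
proof -
  note gs = contracting_averageD(1,2)[OF gs_contr]
    and L2' = contracting_averageD(4)[OF gs_contr] and contr = contracting_averageD(5)[OF gs_contr]
  let ?X = "P \<inter> unit_cube"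
  define Z where "Z = floor_vec ` (\<Union>g\<in>set gs. g ` (unit_cube :: (real ^ 'n) set))"
  have "compact (\<Union>g\<in>set gs. g ` (unit_cube :: (real ^ 'n) set))"
    using gs(2) by (intro compact_UN compact_continuous_image) (auto intro: iso_plus_continuous simp: unit_cube_def)
  then have Zf: "finite Z" unfolding Z_def by (intro finite_floor_vec compact_imp_bounded)
  define Q where "Q = (\<lambda>(g, z) x. g x + - z) ` (set gs \<times> Z)"
  have Qf: "finite Q" using Zf by (simp add: Q_def)
  have Qi: "Q \<subseteq> iso_plus"
  proof
    fix h assume "h \<in> Q"
    then obtain g z where "g \<in> set gs" "h = (\<lambda>x. g x + - z)" by (auto simp: Q_def)
    then show "h \<in> iso_plus"
      using iso_plus_comp[OF iso_plus_translation[of "- z"], of g] gs(2) by (auto simp: comp_def)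
  qed
  have Xs: "?X \<in> sets lebesgue" using P(1) by auto
  have Pmeas: "P \<in> sets lebesgue" using P(1) by auto
  show thesis
  proof (rule that[OF Qf Qi])
    fix f :: "real ^ 'n \<Rightarrow> complex" assume f: "f \<in> L2" and zero: "set_lebesgue_integral lebesgue ?X f = 0"
    have fm: "f \<in> borel_measurable lebesgue" and fi: "integrable lebesgue (\<lambda>x. (cmod (f x))\<^sup>2)"
      using f by (auto simp: L2_def)
    define F where "F y = (if y \<in> P then f (y - floor_vec y) else 0)" for y
    have F_eq: "F y = indicator P y *\<^sub>R f (y - floor_vec y)" for y by (simp add: F_def)
    have pF: "periodic F"
      using P(2) by (simp add: periodic_def F_def floor_vec_add_lattice)
    have Fm: "F \<in> borel_measurable lebesgue"
      unfolding F_eq[abs_def] using measurable_compose[OF measurable_frac fm] Pmeas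
      by (intro borel_measurable_scaleR borel_measurable_indicator)
    have zero_floor: "floor_vec x = 0" if "\<forall>i. 0 < x $ i \<and> x $ i < 1" for x :: "real ^ 'n"
      using that by (intro lattice_floor_eq) (auto simp: mem_box_cart lattice_vec_def)
    have AEF: "AE x in cube_measure. F x = indicator ?X x *\<^sub>R f x"
      using AE_cube_measure_interior AE_space
    proof eventually_elim
      case (elim x)
      then have "x \<in> unit_cube" by (simp add: space_restrict_space)
      then show ?case using zero_floor[OF elim(1)] by (auto simp: F_def indicator_def)
    qed
    have iXf: "integrable lebesgue (\<lambda>x. indicator ?X x *\<^sub>R (cmod (f x))\<^sup>2)"
      by (rule integrable_mult_indicator[OF Xs fi])
    have cm: "h \<in> borel_measurable cube_measure" if "h \<in> borel_measurable lebesgue" for h :: "real ^ 'n \<Rightarrow> 'z::{second_countable_topology,banach}"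
      using that by (rule measurable_restrict_space1)
    have AEsq: "AE x in cube_measure. (cmod (F x))\<^sup>2 = indicator ?X x *\<^sub>R (cmod (f x))\<^sup>2"
      using AEF by eventually_elim (auto simp: indicator_def)
    have toUNIV: "cube_integral (\<lambda>x. indicator ?X x *\<^sub>R h x) = set_lebesgue_integral lebesgue ?X h"
      for h :: "real ^ 'n \<Rightarrow> 'z::{second_countable_topology,banach}"
      unfolding set_lebesgue_integral_def
      by (subst integral_restrict_space) (auto intro!: Bochner_Integration.integral_cong simp: indicator_def)
    have mX: "(\<lambda>x. indicator ?X x *\<^sub>R (cmod (f x))\<^sup>2) \<in> borel_measurable lebesgue" "(\<lambda>x. indicator ?X x *\<^sub>R f x) \<in> borel_measurable lebesgue"
      using Xs fm by measurable
    have Fsqm: "(\<lambda>x. (cmod (F x))\<^sup>2) \<in> borel_measurable lebesgue" using Fm by measurable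
    have FL: "cube_L2 F"
      unfolding cube_L2_def
    proof (intro conjI Fm)
      have "integrable cube_measure (\<lambda>x. indicator ?X x *\<^sub>R (cmod (f x))\<^sup>2)"
        by (subst integrable_restrict_space) (auto intro!: integrable_mult_indicator[OF _ iXf, simplified])
      then show "integrable cube_measure (\<lambda>x. (cmod (F x))\<^sup>2)"
        using integrable_cong_AE[OF cm[OF Fsqm] cm[OF mX(1)] AEsq] by simp
    qed
    have intF: "cube_integral F = 0"
      using integral_cong_AE[OF cm[OF Fm] cm[OF mX(2)] AEF] toUNIV[of f] zero by simp
    have sqF: "cube_norm_sq F = set_lebesgue_integral lebesgue ?X (\<lambda>x. (cmod (f x))\<^sup>2)"
      by (rule trans[OF integral_cong_AE[OF cm[OF Fsqm] cm[OF mX(1)] AEsq] toUNIV])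
    have le: "cube_norm_sq (avg gs F) \<le> cube_norm_sq F / 64"
      using contr[OF pF FL] by (simp add: intF)
    have LT: "cube_L2 (avg gs F)" by (rule L2'[OF pF FL])
    define S where "S x = (\<Sum>g\<in>Q. inner_energy ?X g f x)" for x
    have Si: "integrable lebesgue S"
      unfolding S_def[abs_def] using Qi Xs by (intro Bochner_Integration.integrable_sum integrable_inner_energy f) auto
    have Sic: "integrable cube_measure S"
      using integrable_mult_indicator[OF unit_cube_sets Si] by (subst integrable_restrict_space) simp_all
    have point: "AE x in cube_measure. 3 / 8 * (cmod (F x))\<^sup>2 - 8 * (cmod (avg gs F x))\<^sup>2 \<le> S x"
      using AE_cube_measure_interior AE_space
    proof eventually_elim
      case (elim x)
      then have x: "x \<in> unit_cube" by (simp add: space_restrict_space)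
      have fl: "floor_vec x = 0" by (rule zero_floor[OF elim(1)])
      have term_le: "indicator P x * indicator P (g x) * (cmod (F (g x) - F x))\<^sup>2 \<le> S x" if g: "g \<in> set gs" for g
      proof (cases "x \<in> P \<and> g x \<in> P")
        case False
        then show ?thesis by (auto simp: S_def intro!: sum_nonneg inner_energy_nonneg)
      next
        case True
        define z where "z = floor_vec (g x)"
        define h where "h = (\<lambda>x. g x + - z)"
        have "z \<in> Z" using g x by (auto simp: z_def Z_def)
        then have hQ: "h \<in> Q" using g by (force simp: h_def Q_def)
        have "h x \<in> unit_cube" using diff_floor_vec_in_cube[of "g x"] by (simp add: h_def z_def)
        moreover have "h x \<in> P"
          using True periodicD[OF P(2), of "- z" "g x"] lattice_vec_minus[OF lattice_floor_vec, of "g x"]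
          by (simp add: h_def z_def)
        ultimately have "inner_energy ?X h f x = (cmod (F (g x) - F x))\<^sup>2"
          using True x by (simp add: inner_energy_def F_def fl h_def z_def)
        moreover have "inner_energy ?X h f x \<le> S x"
          unfolding S_def using Qf hQ by (intro member_le_sum[of h Q "\<lambda>g. inner_energy ?X g f x"]) (auto intro: inner_energy_nonneg)
        ultimately show ?thesis using True by simp
      qed
      have "avg gs (\<lambda>y. indicator P x * indicator P y * (cmod (F y - F x))\<^sup>2) x \<le> avg gs (\<lambda>y. S x) x"
        by (rule avg_mono) (rule term_le)
      also have "\<dots> = S x" using gs(1) by (simp add: avg_def sum_list_triv)
      finally show ?case
        using pointwise_energy_bound[of gs P F x, OF gs(1) _ P(3)] by (simp add: F_def)
    qed
    have i1: "integrable cube_measure (\<lambda>x. 3 / 8 * (cmod (F x))\<^sup>2)" "integrable cube_measure (\<lambda>x. 8 * (cmod (avg gs F x))\<^sup>2)"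
      using FL LT by (auto simp: cube_L2_def)
    have "3 / 8 * cube_norm_sq F - 8 * cube_norm_sq (avg gs F) = cube_integral (\<lambda>x. 3 / 8 * (cmod (F x))\<^sup>2 - 8 * (cmod (avg gs F x))\<^sup>2)"
      using Bochner_Integration.integral_diff[OF i1] by simp
    also have "\<dots> \<le> cube_integral S"
      by (rule integral_mono_AE[OF Bochner_Integration.integrable_diff[OF i1] Sic point])
    also have "\<dots> = integral\<^sup>L lebesgue S"
      by (subst integral_restrict_space)
        (auto intro!: Bochner_Integration.integral_cong simp: S_def inner_energy_def indicator_def)
    also have "\<dots> = (\<Sum>g\<in>Q. integral\<^sup>L lebesgue (inner_energy ?X g f))"
      unfolding S_def[abs_def] using Qi Xs by (intro Bochner_Integration.integral_sum integrable_inner_energy f) auto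
    finally show "set_lebesgue_integral lebesgue ?X (\<lambda>x. (cmod (f x))\<^sup>2)
        \<le> 4 * (\<Sum>g\<in>Q. integral\<^sup>L lebesgue (inner_energy ?X g f))"
      using le unfolding sqF[symmetric] by linarith
  qed
qed

theorem theorem1p13:
  assumes "CARD('n::finite) \<ge> 3"
  shows "\<exists>X :: (real ^ 'n) set.
           closed X \<and> interior (closure X) = {} \<and> bounded X \<and> emeasure lebesgue X > 0 \<and>
           local_spectral_gap iso_plus X \<and> domain_of_expansion iso_plus X"
proof -
  obtain gs :: "(real ^ 'n \<Rightarrow> real ^ 'n) list" where gs: "contracting_average gs"
    by (rule exists_contracting_average[OF assms])
  obtain P :: "(real ^ 'n) set" where P: "closed P" "interior P = {}" "periodic (\<lambda>x. x \<in> P)"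
    "measure lebesgue (P \<inter> unit_cube) > 0" "\<And>x. x \<in> P \<Longrightarrow> (1 / 2 :: real) \<le> avg gs (indicator P) x"
    by (rule exists_robust_set[OF gs]) (rule that)
  obtain Q where Q: "finite Q" "Q \<subseteq> iso_plus"
    "\<And>f. f \<in> L2 \<Longrightarrow> set_lebesgue_integral lebesgue (P \<inter> unit_cube) f = 0 \<Longrightarrow>
      set_lebesgue_integral lebesgue (P \<inter> unit_cube) (\<lambda>x. (cmod (f x))\<^sup>2)
        \<le> 4 * (\<Sum>g\<in>Q. integral\<^sup>L lebesgue (inner_energy (P \<inter> unit_cube) g f))"
    by (rule robust_poincare[OF gs P(1,3,5)], assumption) (rule that)
  let ?X = "P \<inter> unit_cube"
  have closed: "closed ?X" by (intro closed_Int P(1)) (simp add: unit_cube_def closed_cbox)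
  have bounded: "bounded ?X" by (intro bounded_Int) (simp add: unit_cube_def)
  have lm: "?X \<in> lmeasurable" using closed bounded by (intro lmeasurable_compact) (simp add: compact_eq_bounded_closed)
  have "interior (closure ?X) = {}"
    using interior_mono[of ?X P] P(2) closed by auto
  moreover have "emeasure lebesgue ?X > 0"
    using P(4) lm by (simp add: emeasure_eq_measure2)
  ultimately show ?thesis
    using closed bounded local_spectral_gapI[OF lm P(4) Q] expansion_of_poincare[OF lm P(4) Q] by blast
qed

end
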